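(* Fix $\alpha\in\mathbb{R}$ with $\alpha\ge2$ and $\alpha\neq 24$, and let $n,\ell\ge 2$ be integers with $n>\ell+1$. Set $N:=n-1-\frac{\alpha}{24}$ and $L:=\ell-\frac{\alpha}{24}$, and suppose that $L\ge\max\left\{2\alpha^{11},\frac{100}{\alpha-24}\right\}$. Then $$p_\alpha(n-1)p_\alpha(\ell+1)-p_\alpha(n)p_\alpha(\ell)=\pi\left(\frac{\alpha}{24}\right)^{\frac{\alpha}{2}+1}N^{-\frac{\alpha}{4}-\frac54}L^{-\frac{\alpha}{4}-\frac54}e^{\pi\sqrt{\frac{2\alpha}{3}}\left(\sqrt N+\sqrt L\right)}\left(\sqrt N-\sqrt L\right)\left(1+O_{\le}\left(\tfrac{14}{15}\right)\right).$$
   Context: For real $\alpha>0$, the numbers $p_\alpha(n)$ ($n\ge 0$) are defined by $\prod_{m\ge1}(1-q^m)^{-\alpha}=\sum_{n\ge0}p_\alpha(n)q^n$ (for $|q|<1$, with the branch having constant term $1$). The notation $f=O_\le(g)$ means $|f|\le g$ on the whole domain of definition; so $1+O_\le(\frac{14}{15})$ denotes a quantity of the form $1+E$ with $|E|\le\frac{14}{15}$ (where $E$ may depend on $\alpha,n,\ell$). *)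

theory Defs
  imports "HOL-Complex_Analysis.Complex_Analysis"
begin

text \<open>
  For \<open>norm q < 1\<close> every factor \<open>1 - q ^ Suc m\<close> has positive real part, so the principal power
  \<open>powr\<close> is holomorphic in \<open>q\<close> and equals \<open>1\<close> at \<open>q = 0\<close>: the product below is the branch
  with constant term \<open>1\<close>. The index is shifted, \<open>m = 0, 1, 2, ...\<close>.
\<close>

definition frac_partition_gf :: "real \<Rightarrow> complex \<Rightarrow> complex" where
  "frac_partition_gf \<alpha> q = (\<Prod>m. (1 - q ^ Suc m) powr (- complex_of_real \<alpha>))"

text \<open>
  The description is proper: \<open>frac_partition_ex1\<close> gives existence and uniqueness, and
  \<open>frac_partition_gf_has_prod\<close> the convergence of the product.
\<close>

definition frac_partition :: "real \<Rightarrow> nat \<Rightarrow> real" where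
  "frac_partition \<alpha> =
     (THE p. \<forall>q::complex. norm q < 1 \<longrightarrow>
        (\<lambda>n. complex_of_real (p n) * q ^ n) sums frac_partition_gf \<alpha> q)"

lemma Re_one_minus_power_pos:
  fixes q :: complex
  assumes "norm q < 1"
  shows "Re (1 - q ^ Suc m) > 0"
proof -
  have "Re (q ^ Suc m) \<le> norm (q ^ Suc m)"
    by (rule complex_Re_le_cmod)
  also have "\<dots> = norm q ^ Suc m"
    by (rule norm_power)
  also have "\<dots> < 1"
    using assms by (simp add: power_less_one_iff del: power_Suc)
  finally show ?thesis
    by simp
qed

lemma frac_partition_log_uniform_limit:
  fixes \<alpha> r :: real
  assumes r: "0 \<le> r" "r < 1"
  shows "uniform_limit (cball 0 r)
           (\<lambda>n q. \<Sum>m<n. - complex_of_real \<alpha> * Ln (1 - q ^ Suc m))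
           (\<lambda>q. \<Sum>m. - complex_of_real \<alpha> * Ln (1 - q ^ Suc m)) sequentially"
proof (rule Weierstrass_m_test_ev)
  have "(\<lambda>m. r ^ Suc m) \<longlonglongrightarrow> 0"
    using r by (intro LIMSEQ_Suc LIMSEQ_power_zero) auto
  hence "eventually (\<lambda>m. r ^ Suc m < 1/2) sequentially"
    by (rule order_tendstoD) auto
  thus "\<forall>\<^sub>F m in sequentially. \<forall>q\<in>cball 0 r.
          norm (- complex_of_real \<alpha> * Ln (1 - q ^ Suc m)) \<le> \<bar>\<alpha>\<bar> * (2 * r ^ Suc m)"
  proof eventually_elim
    case (elim m)
    show ?case
    proof
      fix q :: complex assume q: "q \<in> cball 0 r"
      have le: "norm (- (q ^ Suc m)) \<le> r ^ Suc m"
        unfolding norm_minus_cancel norm_power using q by (intro power_mono) auto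
      hence "norm (Ln (1 + - (q ^ Suc m))) \<le> 2 * norm (- (q ^ Suc m))"
        using elim by (intro norm_Ln_le) linarith
      with le have "norm (Ln (1 - q ^ Suc m)) \<le> 2 * r ^ Suc m"
        by simp
      thus "norm (- complex_of_real \<alpha> * Ln (1 - q ^ Suc m)) \<le> \<bar>\<alpha>\<bar> * (2 * r ^ Suc m)"
        unfolding norm_mult norm_minus_cancel norm_of_real by (intro mult_left_mono) auto
    qed
  qed
  show "summable (\<lambda>m. \<bar>\<alpha>\<bar> * (2 * r ^ Suc m))"
    using r by (intro summable_mult) (simp add: summable_geometric summable_mult)
qed

lemma frac_partition_log_summable:
  fixes q :: complex
  assumes "norm q < 1"
  shows "summable (\<lambda>m. - complex_of_real \<alpha> * Ln (1 - q ^ Suc m))"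
proof -
  have "(\<lambda>n. \<Sum>m<n. - complex_of_real \<alpha> * Ln (1 - q ^ Suc m)) \<longlonglongrightarrow>
          (\<Sum>m. - complex_of_real \<alpha> * Ln (1 - q ^ Suc m))"
    using frac_partition_log_uniform_limit[of "norm q" \<alpha>] assms
    by (intro tendsto_uniform_limitI) auto
  thus ?thesis
    unfolding summable_def sums_def by blast
qed

lemma frac_partition_factor_eq_exp:
  fixes q :: complex
  assumes "norm q < 1"
  shows "(1 - q ^ Suc m) powr (- complex_of_real \<alpha>) =
         exp (- complex_of_real \<alpha> * Ln (1 - q ^ Suc m))"
proof -
  have "1 - q ^ Suc m \<noteq> 0"
    using Re_one_minus_power_pos[OF assms, of m] by (metis less_irrefl zero_complex.sel(1))
  thus ?thesis
    unfolding powr_def by (simp only: if_False)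
qed

lemma frac_partition_gf_eq_exp:
  fixes q :: complex
  assumes "norm q < 1"
  shows "frac_partition_gf \<alpha> q = exp (\<Sum>m. - complex_of_real \<alpha> * Ln (1 - q ^ Suc m))"
  unfolding frac_partition_gf_def frac_partition_factor_eq_exp[OF assms]
  by (rule prodinf_exp[OF frac_partition_log_summable[OF assms]])

lemma frac_partition_gf_has_prod:
  fixes q :: complex
  assumes "norm q < 1"
  shows "(\<lambda>m. (1 - q ^ Suc m) powr (- complex_of_real \<alpha>)) has_prod frac_partition_gf \<alpha> q"
  unfolding frac_partition_gf_def frac_partition_factor_eq_exp[OF assms]
  by (rule convergent_prod_has_prod[OF convergent_prod_exp[OF frac_partition_log_summable[OF assms]]])

lemma frac_partition_gf_holomorphic: "frac_partition_gf \<alpha> holomorphic_on ball 0 1"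
proof -
  have "(\<lambda>q. \<Sum>m. - complex_of_real \<alpha> * Ln (1 - q ^ Suc m)) holomorphic_on ball 0 1"
  proof (rule holomorphic_uniform_sequence)
    fix n
    show "(\<lambda>q. \<Sum>m<n. - complex_of_real \<alpha> * Ln (1 - q ^ Suc m)) holomorphic_on ball 0 1"
    proof (intro holomorphic_intros)
      fix m and q :: complex assume "q \<in> ball 0 1"
      hence "Re (1 - q ^ Suc m) > 0"
        by (intro Re_one_minus_power_pos) auto
      thus "1 - q ^ Suc m \<notin> \<real>\<^sub>\<le>\<^sub>0"
        by (meson complex_nonpos_Reals_iff not_less)
    qed
  next
    fix x :: complex assume x: "x \<in> ball 0 1"
    define d where "d = (1 - norm x) / 2"
    have d: "d > 0" "norm x + d < 1"
      using x by (auto simp: d_def field_simps)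
    have sub: "cball x d \<subseteq> cball 0 (norm x + d)"
      by (auto simp: dist_norm) (smt (verit) norm_minus_commute norm_triangle_sub)
    have "uniform_limit (cball x d) (\<lambda>n q. \<Sum>m<n. - complex_of_real \<alpha> * Ln (1 - q ^ Suc m))
            (\<lambda>q. \<Sum>m. - complex_of_real \<alpha> * Ln (1 - q ^ Suc m)) sequentially"
      by (rule uniform_limit_on_subset[OF frac_partition_log_uniform_limit sub]) (use d in auto)
    moreover have "cball x d \<subseteq> ball 0 1"
      using sub d(2) by (force simp: subset_iff)
    ultimately show "\<exists>d. 0 < d \<and> cball x d \<subseteq> ball 0 1 \<and>
        uniform_limit (cball x d) (\<lambda>n q. \<Sum>m<n. - complex_of_real \<alpha> * Ln (1 - q ^ Suc m))
            (\<lambda>q. \<Sum>m. - complex_of_real \<alpha> * Ln (1 - q ^ Suc m)) sequentially"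
      using d(1) by blast
  qed auto
  hence "(\<lambda>q. exp (\<Sum>m. - complex_of_real \<alpha> * Ln (1 - q ^ Suc m))) holomorphic_on ball 0 1"
    by (rule holomorphic_on_exp')
  thus ?thesis
    by (rule holomorphic_transform) (simp only: mem_ball_0 frac_partition_gf_eq_exp)
qed

lemma frac_partition_gf_cnj:
  assumes "norm q < 1"
  shows "frac_partition_gf \<alpha> (cnj q) = cnj (frac_partition_gf \<alpha> q)"
proof -
  have eq: "- complex_of_real \<alpha> * Ln (1 - cnj q ^ Suc m) =
            cnj (- complex_of_real \<alpha> * Ln (1 - q ^ Suc m))" for m
  proof -
    have "1 - q ^ Suc m \<notin> \<real>\<^sub>\<le>\<^sub>0"
      using Re_one_minus_power_pos[OF assms, of m] by (meson complex_nonpos_Reals_iff not_less)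
    hence "cnj (Ln (1 - q ^ Suc m)) = Ln (cnj (1 - q ^ Suc m))"
      by (rule cnj_Ln)
    thus ?thesis
      by simp
  qed
  have "(\<lambda>m. cnj (- complex_of_real \<alpha> * Ln (1 - q ^ Suc m))) sums
          cnj (\<Sum>m. - complex_of_real \<alpha> * Ln (1 - q ^ Suc m))"
    unfolding sums_cnj by (rule summable_sums[OF frac_partition_log_summable[OF assms]])
  hence "(\<Sum>m. - complex_of_real \<alpha> * Ln (1 - cnj q ^ Suc m)) =
          cnj (\<Sum>m. - complex_of_real \<alpha> * Ln (1 - q ^ Suc m))"
    unfolding eq by (rule sums_unique[symmetric])
  moreover have "norm (cnj q) < 1"
    using assms by simp
  ultimately show ?thesis
    by (simp only: frac_partition_gf_eq_exp assms exp_cnj)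
qed

lemma unit_disc_power_series_unique:
  fixes a b :: "nat \<Rightarrow> complex"
  assumes a: "\<And>q. norm q < 1 \<Longrightarrow> (\<lambda>n. a n * q ^ n) sums f q"
      and b: "\<And>q. norm q < 1 \<Longrightarrow> (\<lambda>n. b n * q ^ n) sums f q"
  shows "a = b"
proof -
  have radius: "fps_conv_radius (Abs_fps c) > 0"
    if c: "\<And>q. norm q < 1 \<Longrightarrow> (\<lambda>n. c n * q ^ n) sums f q" for c :: "nat \<Rightarrow> complex"
  proof -
    have "summable (\<lambda>n. c n * (1/2) ^ n)"
      using c[of "1/2"] by (auto simp: sums_iff)
    hence "conv_radius c \<ge> norm (1/2 :: complex)"
      by (rule conv_radius_geI)
    moreover have "ereal (norm (1/2 :: complex)) > 0"
      by simp
    ultimately have "conv_radius c > 0"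
      by (metis less_le_trans)
    thus ?thesis
      by (simp add: fps_conv_radius_def)
  qed
  have "\<forall>\<^sub>F q in nhds 0. q \<in> ball (0::complex) 1"
    by (intro eventually_nhds_in_open) auto
  hence "\<forall>\<^sub>F q in nhds 0. eval_fps (Abs_fps a) q = eval_fps (Abs_fps b) q"
  proof eventually_elim
    case (elim q)
    thus ?case
      using a[of q] b[of q] by (simp add: eval_fps_def sums_iff)
  qed
  hence "Abs_fps a = Abs_fps b"
    by (intro eval_fps_eqD radius a b)
  thus ?thesis
    by (simp add: fps_eq_iff fun_eq_iff)
qed

theorem frac_partition_ex1:
  "\<exists>!p::nat \<Rightarrow> real. \<forall>q::complex. norm q < 1 \<longrightarrow>
     (\<lambda>n. complex_of_real (p n) * q ^ n) sums frac_partition_gf \<alpha> q"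
proof -
  define c where "c n = (deriv ^^ n) (frac_partition_gf \<alpha>) 0 / fact n" for n
  have c: "(\<lambda>n. c n * q ^ n) sums frac_partition_gf \<alpha> q" if "norm q < 1" for q
    using holomorphic_power_series[OF frac_partition_gf_holomorphic, of q \<alpha>] that
    by (simp add: c_def)
  have "(\<lambda>n. cnj (c n) * q ^ n) sums frac_partition_gf \<alpha> q" if "norm q < 1" for q
  proof -
    have "(\<lambda>n. c n * cnj q ^ n) sums cnj (frac_partition_gf \<alpha> q)"
      using c[of "cnj q"] that by (simp add: frac_partition_gf_cnj)
    hence "(\<lambda>n. cnj (c n * cnj q ^ n)) sums cnj (cnj (frac_partition_gf \<alpha> q))"
      by (subst sums_cnj)
    thus ?thesis
      by simp
  qed
  hence "(\<lambda>n. cnj (c n)) = c"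
    by (rule unit_disc_power_series_unique[OF _ c])
  hence "complex_of_real (Re (c n)) = c n" for n
    by (metis Reals_cnj_iff of_real_Re)
  with c have ex: "\<forall>q::complex. norm q < 1 \<longrightarrow>
      (\<lambda>n. complex_of_real (Re (c n)) * q ^ n) sums frac_partition_gf \<alpha> q"
    by simp
  show ?thesis
  proof (rule ex1I[of _ "\<lambda>n. Re (c n)"])
    show "\<forall>q::complex. norm q < 1 \<longrightarrow>
      (\<lambda>n. complex_of_real (Re (c n)) * q ^ n) sums frac_partition_gf \<alpha> q"
      by (rule ex)
  next
    fix p :: "nat \<Rightarrow> real"
    assume p: "\<forall>q::complex. norm q < 1 \<longrightarrow>
      (\<lambda>n. complex_of_real (p n) * q ^ n) sums frac_partition_gf \<alpha> q"
    have "(\<lambda>n. complex_of_real (p n)) = (\<lambda>n. complex_of_real (Re (c n)))"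
      by (rule unit_disc_power_series_unique) (use p ex in blast)+
    thus "p = (\<lambda>n. Re (c n))"
      by (simp add: fun_eq_iff)
  qed
qed

theorem frac_partition_sums:
  fixes q :: complex
  assumes "norm q < 1"
  shows "(\<lambda>n. complex_of_real (frac_partition \<alpha> n) * q ^ n) sums
           (\<Prod>m. (1 - q ^ Suc m) powr (- complex_of_real \<alpha>))"
  using theI'[OF frac_partition_ex1[of \<alpha>]] assms
  unfolding frac_partition_def frac_partition_gf_def by blast

end

theory Submission
  imports Defs "HOL-Probability.Distributions" "HOL-Real_Asymp.Real_Asymp"
begin

text \<open>
  Write \<open>F\<close> for the generating function and \<open>r j = p (j + 1) / p j\<close>. The left-hand side is
  \<open>p (n - 1) * p l * (r l - r (n - 1))\<close>, and \<open>r l - r (n - 1)\<close> is a sum of terms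
  \<open>r (j - 1) - r j = (p j ^ 2 - p (j - 1) * p (j + 1)) / (p (j - 1) * p j)\<close>. By Cauchy's formula on the circle
  \<open>q = exp (- (y + i * \<theta>))\<close> with \<open>y = pi * sqrt (\<alpha> / (6 * \<lambda>))\<close> and \<open>\<lambda> = j - \<alpha> / 24\<close>, the numerator is a double
  integral of \<open>F * F\<close> against \<open>1 - cos (\<theta> - \<phi>)\<close>. This weight already carries the second difference, so
  it suffices to know \<open>F\<close> near the saddle point up to a relative error bounded by a constant: the modular
  transformation of \<open>F\<close>, Bessel functions and Kloosterman sums are not needed. On the real axis,
  \<open>log F (exp (- y)) = \<alpha> * (pi\<^sup>2 / (6 * y) + ln (y / (2 * pi)) / 2 + O(y))\<close> gives the size of \<open>p j\<close>.
\<close>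

section \<open>Weighted divisor sums\<close>

text \<open>The two products agree to leading order, so bounds for p up to a constant factor cannot
  even reveal the sign of their difference. For the ratios such bounds are enough: every step r (j -
  1) - r j is positive, so constant-factor bounds on the steps survive summation, and the tolerance
  14/15 leaves room for all of them. The narrowest place is the lower bound for
  \<open>ca - cb\<close>, where estimating the cubic phase by its absolute value consumes about half
  of the leading value. All derivatives of log F on the real axis come from a single estimate, that
  of \<open>wsum 1\<close> with absolute error 1/10. The sums \<open>wsum i\<close> are alternately
  signed derivatives of a completely monotone function, so finite differences carry this estimate to
  the higher ones. The chosen y solves the saddle equation only to leading order. What remains is a
  linear phase whose square, on the scale of the Gaussian, is of order \<alpha>^2 / u = \<alpha> *
  y; the lower bound on L by a high power of \<alpha> makes this small.\<close>

definition wt :: "nat \<times> nat \<Rightarrow> real" where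
  "wt x = real (Suc (fst x)) * real (Suc (snd x))"

definition wterm :: "nat \<Rightarrow> real \<Rightarrow> nat \<times> nat \<Rightarrow> real" where
  "wterm i y x = wt x ^ i * exp (- wt x * y) / real (Suc (snd x))"

text \<open>With weights \<open>w = m * k\<close> (\<open>m, k \<ge> 1\<close>, shifted to start at \<open>0\<close>), \<open>wsum 0 y\<close> is
  \<open>- (\<Sum>m. ln (1 - exp (- m * y)))\<close>, and \<open>wsum i\<close> is \<open>(- 1) ^ i\<close> times its \<open>i\<close>-th derivative.\<close>

definition wsum :: "nat \<Rightarrow> real \<Rightarrow> real" where
  "wsum i y = (\<Sum>\<^sub>\<infinity>x. wterm i y x)"

lemma has_sum_diff:
  fixes f g :: "'a \<Rightarrow> 'b :: {topological_ab_group_add}"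
  assumes "(f has_sum a) A" "(g has_sum b) A"
  shows "((\<lambda>x. f x - g x) has_sum (a - b)) A"
  using has_sum_add[OF assms(1), of "\<lambda>x. - g x" "- b"] assms(2) by (simp add: has_sum_uminus)

lemma wt_ge_1: "wt x \<ge> 1"
  unfolding wt_def using mult_mono[of 1 "real (Suc (fst x))" 1 "real (Suc (snd x))"] by simp

lemma wt_pos [simp]: "wt x > 0"
  using wt_ge_1[of x] by linarith

lemma wterm_nonneg [simp]: "wterm i y x \<ge> 0"
  by (simp add: wterm_def less_imp_le)

text \<open>Splits the exponent into a part in m and a part in k, so that the double sum is
  dominated by a product of two geometric series.\<close>

lemma wt_ge_average: "2 * wt x \<ge> real (Suc (fst x)) + real (Suc (snd x))"
proof -
  have "0 \<le> real (fst x) * real (snd x)" by simp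
  thus ?thesis unfolding wt_def by (simp add: algebra_simps)
qed

lemma summable_exp_wt:
  assumes "y > 0"
  shows "(\<lambda>x. exp (- wt x * y)) summable_on UNIV"
proof -
  define r where "r = exp (- y / 2)"
  have r: "0 < r" "r < 1" using assms by (auto simp: r_def)
  have "summable (\<lambda>m. r ^ Suc m)" unfolding power_Suc using r by (intro summable_mult summable_geometric) auto
  hence g: "(\<lambda>m. r ^ Suc m) summable_on UNIV"
    by (rule summable_nonneg_imp_summable_on) (use r in auto)
  have "(\<lambda>x. r ^ Suc (fst x) * r ^ Suc (snd x)) summable_on UNIV \<times> UNIV"
  proof (rule summable_on_SigmaI)
    fix m :: nat
    show "((\<lambda>k. r ^ Suc (fst (m, k)) * r ^ Suc (snd (m, k))) has_sum r ^ Suc m * (\<Sum>\<^sub>\<infinity>k. r ^ Suc k)) UNIV"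
      unfolding fst_conv snd_conv by (intro has_sum_cmult_right has_sum_infsum g)
  next
    show "(\<lambda>m. r ^ Suc m * (\<Sum>\<^sub>\<infinity>k. r ^ Suc k)) summable_on UNIV"
      by (intro summable_on_cmult_left g)
  qed (use r in auto)
  hence "(\<lambda>x. r ^ Suc (fst x) * r ^ Suc (snd x)) summable_on UNIV" by simp
  thus ?thesis
  proof (rule summable_on_comparison_test)
    fix x :: "nat \<times> nat"
    have "exp (- wt x * y) \<le> exp (- (real (Suc (fst x)) + real (Suc (snd x))) * y / 2)"
      using mult_right_mono[OF wt_ge_average[of x], of y] assms by (simp add: algebra_simps)
    also have "\<dots> = r ^ Suc (fst x) * r ^ Suc (snd x)"
      unfolding r_def exp_of_nat_mult[symmetric] exp_add[symmetric] by (simp add: field_simps)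
    finally show "exp (- wt x * y) \<le> r ^ Suc (fst x) * r ^ Suc (snd x)" .
  qed auto
qed

lemma summable_wterm:
  assumes "y > 0"
  shows "wterm i y summable_on UNIV"
proof -
  \<comment> \<open>Half of the exponent pays for the power: one term of the exponential series at
    \<open>t = w * y / 2\<close> bounds \<open>t ^ i\<close>, and the other half stays
    summable.\<close>
  have le: "w ^ i * exp (- w * y) \<le> fact i * (2 / y) ^ i * exp (- w * (y / 2))" if "w \<ge> 0" for w
  proof -
    define t where "t = w * y / 2"
    have t: "t \<ge> 0" using that assms by (simp add: t_def)
    have s: "(\<lambda>n. t ^ n /\<^sub>R fact n) sums exp t" by (rule exp_converges)
    have "t ^ i /\<^sub>R fact i \<le> exp t"
      using sum_le_suminf[OF sums_summable[OF s], of "{i}"] sums_unique[OF s] t by simp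
    hence "t ^ i \<le> fact i * exp t" by (simp add: field_simps)
    hence "t ^ i * exp (- 2 * t) \<le> fact i * exp t * exp (- 2 * t)"
      by (intro mult_right_mono) auto
    also have "\<dots> = fact i * exp (-t)" by (simp add: exp_minus field_simps mult_exp_exp)
    finally have "(2 / y) ^ i * (t ^ i * exp (- 2 * t)) \<le> (2 / y) ^ i * (fact i * exp (- t))"
      using assms by (intro mult_left_mono) auto
    moreover have "(2 / y) ^ i * t ^ i = w ^ i"
      unfolding power_mult_distrib[symmetric] using assms by (simp add: t_def)
    moreover have "exp (- 2 * t) = exp (- w * y)" "exp (- t) = exp (- w * (y / 2))"
      by (simp_all add: t_def)
    ultimately show ?thesis by (simp only: mult.assoc[symmetric]) (simp only: mult.commute)
  qed
  have "(\<lambda>x. fact i * (2 / y) ^ i * exp (- wt x * (y / 2))) summable_on UNIV"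
    by (intro summable_on_cmult_right summable_exp_wt) (use assms in auto)
  thus ?thesis
  proof (rule summable_on_comparison_test)
    fix x
    have "wterm i y x \<le> wt x ^ i * exp (- wt x * y) / 1"
      unfolding wterm_def by (intro divide_left_mono) (auto simp: less_imp_le)
    also have "\<dots> \<le> fact i * (2 / y) ^ i * exp (- wt x * (y / 2))"
      using le[of "wt x"] by (simp add: less_imp_le)
    finally show "wterm i y x \<le> fact i * (2 / y) ^ i * exp (- wt x * (y / 2))" .
  qed auto
qed

lemma wsum_nonneg [simp]: "wsum i y \<ge> 0"
  unfolding wsum_def by (intro infsum_nonneg) auto

lemma wsum_has_sum: "y > 0 \<Longrightarrow> (wterm i y has_sum wsum i y) UNIV"
  unfolding wsum_def by (intro has_sum_infsum summable_wterm)

section \<open>Difference quotients and derivatives on the real axis\<close>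

lemma wterm_shift: "wterm (i + j) y x = wt x ^ j * exp (- wt x * h) * wterm i (y - h) x"
proof -
  have "exp (- wt x * y) = exp (- wt x * h) * exp (- wt x * (y - h))"
    by (simp add: exp_add[symmetric] algebra_simps)
  thus ?thesis by (simp add: wterm_def power_add)
qed

text \<open>Tangent bounds of a decreasing convex function, obtained summand by summand. By
  \<open>wterm_shift\<close> a shift of y and a raised index only multiply a summand, so
  \<open>1 + t \<le> exp t\<close> suffices, and differentiability of \<open>wsum i\<close> is a
  consequence rather than a prerequisite.\<close>

lemma wsum_diff_lower:
  assumes "y > 0" "h \<ge> 0"
  shows "h * wsum (Suc i) (y + h) \<le> wsum i y - wsum i (y + h)"
proof (rule has_sum_mono)
  show "((\<lambda>x. h * wterm (Suc i) (y + h) x) has_sum (h * wsum (Suc i) (y + h))) UNIV"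
    by (intro has_sum_cmult_right wsum_has_sum) (use assms in auto)
  show "((\<lambda>x. wterm i y x - wterm i (y + h) x) has_sum (wsum i y - wsum i (y + h))) UNIV"
    by (intro has_sum_diff wsum_has_sum) (use assms in auto)
  fix x
  have "1 + wt x * h \<le> exp (wt x * h)" by (rule exp_ge_add_one_self)
  hence "(1 + wt x * h) * wterm i (y + h) x \<le> exp (wt x * h) * wterm i (y + h) x"
    by (intro mult_right_mono) auto
  also have "\<dots> = wterm i y x"
    using wterm_shift[of i 0 y x "-h"] by simp
  finally show "h * wterm (Suc i) (y + h) x \<le> wterm i y x - wterm i (y + h) x"
    using wterm_shift[of i 1 "y + h" x 0] by (simp add: algebra_simps)
qed

lemma wsum_diff_upper:
  assumes "y > 0" "h \<ge> 0"
  shows "wsum i y - wsum i (y + h) \<le> h * wsum (Suc i) y"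
proof (rule has_sum_mono)
  show "((\<lambda>x. h * wterm (Suc i) y x) has_sum (h * wsum (Suc i) y)) UNIV"
    by (intro has_sum_cmult_right wsum_has_sum) (use assms in auto)
  show "((\<lambda>x. wterm i y x - wterm i (y + h) x) has_sum (wsum i y - wsum i (y + h))) UNIV"
    by (intro has_sum_diff wsum_has_sum) (use assms in auto)
  fix x
  have "1 + - wt x * h \<le> exp (- wt x * h)" by (rule exp_ge_add_one_self)
  hence "(1 - wt x * h) * wterm i y x \<le> exp (- wt x * h) * wterm i y x"
    by (intro mult_right_mono) auto
  also have "\<dots> = wterm i (y + h) x"
    using wterm_shift[of i 0 "y + h" x h] by simp
  finally show "wterm i y x - wterm i (y + h) x \<le> h * wterm (Suc i) y x"
    using wterm_shift[of i 1 y x 0] by (simp add: algebra_simps)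
qed

lemma sinh_ge_real:
  fixes t :: real assumes "t \<ge> 0" shows "sinh t \<ge> t"
proof -
  have "sinh 0 - 0 \<le> sinh t - t"
  proof (rule DERIV_nonneg_imp_nondecreasing[OF assms])
    fix x :: real assume "0 \<le> x"
    have "((\<lambda>t. sinh t - t) has_real_derivative (cosh x - 1)) (at x)"
      by (auto intro!: derivative_eq_intros)
    thus "\<exists>y. ((\<lambda>t. sinh t - t) has_real_derivative y) (at x) \<and> 0 \<le> y"
      using cosh_real_ge_1[of x] by (intro exI[of _ "cosh x - 1"]) auto
  qed
  thus ?thesis by simp
qed

lemma cosh_ge_real:
  fixes t :: real shows "cosh t \<ge> 1 + t\<^sup>2 / 2"
proof -
  have *: "cosh t \<ge> 1 + t\<^sup>2 / 2" if "t \<ge> 0" for t :: real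
  proof -
    have "cosh 0 - 0\<^sup>2 / 2 \<le> cosh t - t\<^sup>2 / 2"
    proof (rule DERIV_nonneg_imp_nondecreasing[OF that])
      fix x :: real assume "0 \<le> x"
      have "((\<lambda>t. cosh t - t\<^sup>2/2) has_real_derivative (sinh x - x)) (at x)"
        by (auto intro!: derivative_eq_intros)
      thus "\<exists>y. ((\<lambda>t. cosh t - t\<^sup>2/2) has_real_derivative y) (at x) \<and> 0 \<le> y"
        using sinh_ge_real[OF \<open>0 \<le> x\<close>] by (intro exI[of _ "sinh x - x"]) auto
    qed
    thus ?thesis by simp
  qed
  show ?thesis using *[of t] *[of "-t"] by (cases "t \<ge> 0") auto
qed

text \<open>All odd derivatives of a summand have the same sign, so a symmetric difference
  overestimates the first one; here this is \<open>t \<le> sinh t\<close>, and in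
  \<open>wsum_second_diff\<close> the analogue for cosh. Both serve to pass from
  \<open>wsum 2\<close> to \<open>wsum 3\<close> and \<open>wsum 4\<close>.\<close>

lemma wsum_central_diff:
  assumes "0 < h" "h < y"
  shows "2 * h * wsum (Suc i) y \<le> wsum i (y - h) - wsum i (y + h)"
proof (rule has_sum_mono)
  show "((\<lambda>x. 2 * h * wterm (Suc i) y x) has_sum (2 * h * wsum (Suc i) y)) UNIV"
    by (intro has_sum_cmult_right wsum_has_sum) (use assms in auto)
  show "((\<lambda>x. wterm i (y - h) x - wterm i (y + h) x) has_sum (wsum i (y - h) - wsum i (y + h))) UNIV"
    by (intro has_sum_diff wsum_has_sum) (use assms in auto)
  fix x
  have "wt x * h \<le> sinh (wt x * h)" by (intro sinh_ge_real) (use assms in \<open>auto simp: less_imp_le\<close>)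
  hence "2 * (wt x * h) * wterm i y x \<le> 2 * sinh (wt x * h) * wterm i y x"
    by (intro mult_right_mono) auto
  also have "\<dots> = exp (wt x * h) * wterm i y x - exp (- wt x * h) * wterm i y x"
    by (simp add: sinh_field_def field_simps)
  also have "\<dots> = wterm i (y - h) x - wterm i (y + h) x"
    using wterm_shift[of i 0 "y + h" x h] wterm_shift[of i 0 "y - h" x "-h"] by simp
  finally show "2 * h * wterm (Suc i) y x \<le> wterm i (y - h) x - wterm i (y + h) x"
    using wterm_shift[of i 1 y x 0] by (simp add: algebra_simps)
qed

lemma wsum_second_diff:
  assumes "0 < h" "h < y"
  shows "h\<^sup>2 * wsum (Suc (Suc i)) y \<le> wsum i (y - h) + wsum i (y + h) - 2 * wsum i y"
proof (rule has_sum_mono)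
  show "((\<lambda>x. h\<^sup>2 * wterm (Suc (Suc i)) y x) has_sum (h\<^sup>2 * wsum (Suc (Suc i)) y)) UNIV"
    by (intro has_sum_cmult_right wsum_has_sum) (use assms in auto)
  show "((\<lambda>x. wterm i (y - h) x + wterm i (y + h) x - 2 * wterm i y x) has_sum
     (wsum i (y - h) + wsum i (y + h) - 2 * wsum i y)) UNIV"
    by (intro has_sum_diff has_sum_add has_sum_cmult_right wsum_has_sum) (use assms in auto)
  fix x
  have "(wt x * h)\<^sup>2 \<le> 2 * cosh (wt x * h) - 2" using cosh_ge_real[of "wt x * h"] by simp
  hence "(wt x * h)\<^sup>2 * wterm i y x \<le> (2 * cosh (wt x * h) - 2) * wterm i y x"
    by (intro mult_right_mono) auto
  also have "\<dots> = exp (wt x * h) * wterm i y x + exp (- wt x * h) * wterm i y x - 2 * wterm i y x"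
    by (simp add: cosh_field_def field_simps)
  also have "\<dots> = wterm i (y - h) x + wterm i (y + h) x - 2 * wterm i y x"
    using wterm_shift[of i 0 "y + h" x h] wterm_shift[of i 0 "y - h" x "-h"] by simp
  finally show "h\<^sup>2 * wterm (Suc (Suc i)) y x \<le> wterm i (y - h) x + wterm i (y + h) x - 2 * wterm i y x"
    using wterm_shift[of i 2 y x 0] by (simp add: algebra_simps power2_eq_square)
qed

lemma wsum_antimono:
  assumes "0 < y" "y \<le> z"
  shows "wsum i z \<le> wsum i y"
proof -
  have "0 \<le> (z - y) * wsum (Suc i) z" using assms by simp
  also have "\<dots> \<le> wsum i y - wsum i z" using wsum_diff_lower[of y "z - y" i] assms by simp
  finally show ?thesis by simp
qed

lemma wsum_has_derivative:
  assumes y: "y > 0"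
  shows "(wsum i has_real_derivative - wsum (Suc i) y) (at y)"
proof -
  \<comment> \<open>A Lipschitz constant of \<open>wsum (Suc i)\<close> on all of
    \<open>{y / 2..}\<close>, so that one linear error bound serves both signs of h.\<close>
  define C where "C = wsum (Suc (Suc i)) (y / 2)"
  have bound: "\<bar>(wsum i (y + h) - wsum i y) / h + wsum (Suc i) y\<bar> \<le> C * \<bar>h\<bar>"
    if h: "h \<noteq> 0" "\<bar>h\<bar> < y / 2" for h
  proof -
    have pos: "y + h > 0" "y + h \<ge> y / 2" using h y by auto
    show ?thesis
    proof (cases "h > 0")
      case True
      have "wsum (Suc i) y - wsum (Suc i) (y + h) \<le> h * wsum (Suc (Suc i)) y"
        using wsum_diff_upper[of y h "Suc i"] y True by simp
      also have "\<dots> \<le> h * C" unfolding C_def using y True by (intro mult_left_mono wsum_antimono) auto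
      finally have 1: "wsum (Suc i) y - wsum (Suc i) (y + h) \<le> h * C" .
      have "h * wsum (Suc i) (y + h) \<le> wsum i y - wsum i (y + h)"
           "wsum i y - wsum i (y + h) \<le> h * wsum (Suc i) y"
        using wsum_diff_lower[of y h i] wsum_diff_upper[of y h i] y True by auto
      hence "wsum (Suc i) (y + h) \<le> - ((wsum i (y + h) - wsum i y) / h)"
            "- ((wsum i (y + h) - wsum i y) / h) \<le> wsum (Suc i) y"
        using True by (auto simp: field_simps)
      with 1 True show ?thesis by (simp add: abs_if mult.commute)
    next
      case False
      with h have neg: "h < 0" by simp
      have "wsum (Suc i) (y + h) - wsum (Suc i) y \<le> (-h) * wsum (Suc (Suc i)) (y + h)"
        using wsum_diff_upper[of "y + h" "- h" "Suc i"] pos neg by simp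
      also have "\<dots> \<le> (-h) * C" unfolding C_def using y pos neg by (intro mult_left_mono wsum_antimono) auto
      finally have 1: "wsum (Suc i) (y + h) - wsum (Suc i) y \<le> (-h) * C" .
      have "(-h) * wsum (Suc i) y \<le> wsum i (y + h) - wsum i y"
           "wsum i (y + h) - wsum i y \<le> (-h) * wsum (Suc i) (y + h)"
        using wsum_diff_lower[of "y + h" "-h" i] wsum_diff_upper[of "y + h" "-h" i] pos neg by auto
      hence "wsum (Suc i) y \<le> - ((wsum i (y + h) - wsum i y) / h)"
            "- ((wsum i (y + h) - wsum i y) / h) \<le> wsum (Suc i) (y + h)"
        using neg by (auto simp: field_simps)
      with 1 neg show ?thesis by (simp add: abs_if mult.commute)
    qed
  qed
  have "((\<lambda>h. (wsum i (y + h) - wsum i y) / h - (- wsum (Suc i) y)) \<longlongrightarrow> 0) (at 0)"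
  proof (rule Lim_null_comparison)
    have "\<forall>\<^sub>F h::real in at 0. h \<noteq> 0 \<and> \<bar>h\<bar> < y / 2"
      unfolding eventually_at using y by (intro exI[of _ "y / 2"]) (auto simp: dist_real_def)
    thus "\<forall>\<^sub>F h in at 0. norm ((wsum i (y + h) - wsum i y) / h - (- wsum (Suc i) y)) \<le> C * \<bar>h\<bar>"
      by eventually_elim (use bound in auto)
    show "((\<lambda>h. C * \<bar>h\<bar>) \<longlongrightarrow> 0) (at 0)"
      by (auto intro!: tendsto_eq_intros)
  qed
  thus ?thesis unfolding DERIV_def by (rule LIM_zero_cancel)
qed

section \<open>The logarithm of the generating function at complex arguments\<close>

definition csum :: "complex \<Rightarrow> complex" where
  "csum z = (\<Sum>\<^sub>\<infinity>x. exp (- of_real (wt x) * z) / of_real (real (Suc (snd x))))"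

lemma norm_cterm: "norm (exp (- of_real (wt x) * z) / of_real (real (Suc (snd x)))) = wterm 0 (Re z) x"
  by (simp add: wterm_def norm_divide del: of_nat_Suc)

lemma csum_has_sum:
  assumes "Re z > 0"
  shows "((\<lambda>x. exp (- of_real (wt x) * z) / of_real (real (Suc (snd x)))) has_sum csum z) UNIV"
proof -
  have "(\<lambda>x. norm (exp (- of_real (wt x) * z) / of_real (real (Suc (snd x))))) summable_on UNIV"
    unfolding norm_cterm using summable_wterm[OF assms] by simp
  thus ?thesis
    unfolding csum_def by (intro has_sum_infsum) (rule abs_summable_summable)
qed

text \<open>Summing over k first reassembles the logarithm series; the principal \<open>Ln\<close>
  is the right branch because every power of \<open>exp (- z)\<close> has norm below 1.\<close>

lemma csum_sums_Ln:
  assumes "Re z > 0"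
  shows "(\<lambda>m. - Ln (1 - exp (- z) ^ Suc m)) sums csum z"
proof -
  have "((\<lambda>m. - Ln (1 - exp (- z) ^ Suc m)) has_sum csum z) UNIV"
  proof (rule has_sum_SigmaD)
    show "((\<lambda>x. exp (- of_real (wt x) * z) / of_real (real (Suc (snd x)))) has_sum csum z) (UNIV \<times> UNIV)"
      using csum_has_sum[OF assms] by simp
    fix m :: nat
    define w where "w = exp (- z) ^ Suc m"
    have w: "norm w < 1" using assms unfolding w_def norm_power
      by (intro power_less_one_iff[THEN iffD2]) auto
    have eq: "exp (- of_real (wt (m, k)) * z) / of_real (real (Suc (snd (m, k)))) = w ^ Suc k / of_nat (Suc k)" for k
    proof -
      have "exp (- of_real (wt (m, k)) * z) = exp (of_nat (Suc m * Suc k) * (- z))"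
        by (simp add: wt_def algebra_simps)
      also have "\<dots> = w ^ Suc k" unfolding w_def exp_of_nat_mult power_mult ..
      finally show ?thesis by (simp del: power_Suc of_nat_Suc)
    qed
    have "(\<lambda>n. - ((- (- w)) ^ n) / of_nat n) sums ln (1 + - w)"
      by (rule Ln_series') (use w in simp)
    hence "(\<lambda>n. - (w ^ Suc n / of_nat (Suc n))) sums Ln (1 - w)"
      using sums_Suc_iff[of "\<lambda>n. - (w ^ n / of_nat n)" "Ln (1 - w)"] by simp
    hence s: "(\<lambda>n. w ^ Suc n / of_nat (Suc n)) sums (- Ln (1 - w))"
      using sums_minus by fastforce
    have "summable (\<lambda>n. norm w ^ Suc n)"
      unfolding power_Suc using w by (intro summable_mult summable_geometric) auto
    hence "summable (\<lambda>n. norm (w ^ Suc n / of_nat (Suc n)))"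
    proof (rule summable_comparison_test')
      fix n
      have "norm (w ^ Suc n) / real (Suc n) \<le> norm (w ^ Suc n) / 1" by (intro divide_left_mono) auto
      thus "norm (norm (w ^ Suc n / of_nat (Suc n))) \<le> norm w ^ Suc n"
        by (simp add: norm_divide norm_power norm_mult del: of_nat_Suc)
    qed
    thus "((\<lambda>k. exp (- of_real (wt (m, k)) * z) / of_real (real (Suc (snd (m, k))))) has_sum - Ln (1 - exp (- z) ^ Suc m)) UNIV"
      unfolding eq w_def[symmetric] by (rule norm_summable_imp_has_sum) (rule s)
  qed
  thus ?thesis by (rule has_sum_imp_sums)
qed

lemma frac_partition_gf_eq_exp_csum:
  assumes "Re z > 0"
  shows "frac_partition_gf \<alpha> (exp (- z)) = exp (of_real \<alpha> * csum z)"
proof -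
  have "(\<lambda>m. of_real \<alpha> * - Ln (1 - exp (- z) ^ Suc m)) sums (of_real \<alpha> * csum z)"
    by (intro sums_mult csum_sums_Ln assms)
  hence "(\<Sum>m. - of_real \<alpha> * Ln (1 - exp (- z) ^ Suc m)) = of_real \<alpha> * csum z"
    using sums_unique by force
  thus ?thesis
    using assms by (subst frac_partition_gf_eq_exp) (auto simp del: power_Suc)
qed

lemma csum_of_real: "y > 0 \<Longrightarrow> csum (of_real y) = of_real (wsum 0 y)"
proof -
  assume y: "y > 0"
  have "((\<lambda>x. complex_of_real (wterm 0 y x)) has_sum of_real (wsum 0 y)) UNIV"
    by (intro has_sum_of_real wsum_has_sum y)
  hence "((\<lambda>x. exp (- of_real (wt x) * of_real y) / of_real (real (Suc (snd x)))) has_sum complex_of_real (wsum 0 y)) UNIV"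
    by (simp add: wterm_def exp_of_real[symmetric])
  thus ?thesis using csum_has_sum[of "of_real y"] y has_sum_unique by fastforce
qed

lemma wsum_0_sums:
  assumes "y > 0"
  shows "(\<lambda>m. - ln (1 - exp (- (real (Suc m) * y)))) sums wsum 0 y"
proof -
  have "- Ln (1 - exp (- complex_of_real y) ^ Suc m) = of_real (- ln (1 - exp (- (real (Suc m) * y))))" for m
  proof -
    have "exp (- complex_of_real y) ^ Suc m = of_real (exp (real (Suc m) * (- y)))"
      unfolding exp_of_nat_mult by (simp add: exp_of_real[symmetric])
    hence "1 - exp (- complex_of_real y) ^ Suc m = of_real (1 - exp (- (real (Suc m) * y)))"
      by (simp del: power_Suc of_nat_Suc)
    moreover have "1 - exp (- (real (Suc m) * y)) > 0" using assms by (simp del: of_nat_Suc)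
    ultimately show ?thesis by (simp only: Ln_of_real) simp
  qed
  hence "(\<lambda>m. complex_of_real (- ln (1 - exp (- (real (Suc m) * y))))) sums of_real (wsum 0 y)"
    using csum_sums_Ln[of "of_real y"] assms by (simp add: csum_of_real del: power_Suc of_nat_Suc)
  thus ?thesis by (simp only: sums_of_real_iff)
qed

lemma four_sinh_square:
  fixes x :: real
  shows "4 * (sinh (x / 2))\<^sup>2 = (exp x - 1)\<^sup>2 / exp x"
proof -
  define e where "e = exp (x / 2)"
  have e: "e > 0" and ex: "exp x = e\<^sup>2" by (simp_all add: e_def exp_double[symmetric])
  have "2 * e * sinh (x / 2) = e\<^sup>2 - 1"
    using e by (simp add: sinh_field_def e_def[symmetric] exp_minus field_simps power2_eq_square)
  hence "(2 * e * sinh (x / 2))\<^sup>2 = (e\<^sup>2 - 1)\<^sup>2" by simp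
  thus ?thesis unfolding ex using e by (simp add: field_simps power_mult_distrib)
qed

lemma sums_csch_square:
  assumes "x > 0"
  shows "(\<lambda>m. real (Suc m) * exp (- (real (Suc m) * x))) sums (1 / (4 * (sinh (x / 2))\<^sup>2))"
proof -
  define r where "r = exp (- x)"
  have r: "0 < r" "r < 1" using assms by (auto simp: r_def)
  have "(\<lambda>n. r * (of_nat (Suc n) * r ^ n)) sums (r * (1 / (1 - r)\<^sup>2))"
    by (intro sums_mult geometric_deriv_sums) (use r in auto)
  moreover have "r * (of_nat (Suc n) * r ^ n) = real (Suc n) * exp (- (real (Suc n) * x))" for n
  proof -
    have "exp (- (real (Suc n) * x)) = r ^ Suc n"
      unfolding r_def exp_of_nat_mult[symmetric] by (simp add: algebra_simps)
    thus ?thesis by simp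
  qed
  moreover have "r * (1 / (1 - r)\<^sup>2) = 1 / (4 * (sinh (x / 2))\<^sup>2)"
  proof -
    have 1: "exp x = 1 / r" by (simp add: r_def exp_minus divide_inverse)
    have 2: "1 / r - 1 = (1 - r) / r" using r by (simp add: diff_divide_distrib)
    show ?thesis
      unfolding four_sinh_square 1 2 using r by (simp add: power_divide power2_eq_square)
  qed
  ultimately show ?thesis by (simp only:)
qed

text \<open>Summing over m first is possible in closed form because the weight cancels the
  denominator k. The k-th term (counted from 1) resembles \<open>1 / (k * y)\<^sup>2\<close> for
  small y, hence the later comparison with the series for \<open>pi\<^sup>2 / 6\<close>.\<close>

lemma wsum_1_sums:
  assumes "y > 0"
  shows "(\<lambda>k. 1 / (4 * (sinh (real (Suc k) * y / 2))\<^sup>2)) sums wsum 1 y"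
proof -
  have "((\<lambda>k. 1 / (4 * (sinh (real (Suc k) * y / 2))\<^sup>2)) has_sum wsum 1 y) UNIV"
  proof (rule has_sum_SigmaD)
    show "((\<lambda>(k, m). wterm 1 y (m, k)) has_sum wsum 1 y) (UNIV \<times> UNIV)"
      using wsum_has_sum[OF assms, of 1] has_sum_swap[where f = "wterm 1 y" and A = UNIV and B = UNIV] by simp
    fix k :: nat
    have "(\<lambda>m. real (Suc m) * exp (- (real (Suc m) * (real (Suc k) * y)))) sums
             (1 / (4 * (sinh (real (Suc k) * y / 2))\<^sup>2))"
      by (rule sums_csch_square) (use assms in simp)
    hence "(\<lambda>m. wterm 1 y (m, k)) sums (1 / (4 * (sinh (real (Suc k) * y / 2))\<^sup>2))"
      by (simp add: wterm_def wt_def mult_ac del: of_nat_Suc)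
    thus "((\<lambda>m. case (k, m) of (k, m) \<Rightarrow> wterm 1 y (m, k)) has_sum 1 / (4 * (sinh (real (Suc k) * y / 2))\<^sup>2)) UNIV"
      by (simp add: sums_nonneg_imp_has_sum)
  qed
  thus ?thesis by (rule has_sum_imp_sums)
qed

section \<open>The generating function off the real axis\<close>

lemma one_minus_cos_le: "1 - cos x \<le> x\<^sup>2 / 2" for x :: real
proof -
  have "1 - cos x = 2 * (sin (x / 2))\<^sup>2" using cos_double_sin[of "x / 2"] by simp
  also have "(sin (x / 2))\<^sup>2 \<le> (x / 2)\<^sup>2"
    using power_mono[OF abs_sin_x_le_abs_x[of "x / 2"], of 2] by (simp add: power_divide)
  finally show ?thesis by (simp add: power2_eq_square)
qed

lemma one_minus_cos_ge: "1 - cos x \<ge> x\<^sup>2 / 2 - x ^ 4 / 24" for x :: real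
proof -
  obtain t where "cos x = (\<Sum>m<4. cos_coeff m * x ^ m) + (cos (t + 1/2 * real 4 * pi) / fact 4) * x ^ 4"
    using Maclaurin_cos_expansion[of x 4] by blast
  hence "cos x = 1 - x\<^sup>2 / 2 + cos t * x ^ 4 / 24"
    by (simp add: cos_coeff_def lessThan_nat_numeral fact_numeral)
  moreover have "cos t * x ^ 4 \<le> 1 * x ^ 4" by (intro mult_right_mono) auto
  ultimately show ?thesis by simp
qed

lemma abs_sin_minus_le: "\<bar>sin x - x\<bar> \<le> \<bar>x\<bar> ^ 3 / 6" for x :: real
  using Maclaurin_sin_bound[of x 3] by (simp add: sin_coeff_def eval_nat_numeral)

text \<open>Per unit of \<alpha>, \<open>rho\<close> is the drop of log |F| between angle 0 and
  \<theta>, and \<open>psi\<close> is minus the argument of F; with these signs they are sums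
  against \<open>1 - cos\<close> and \<open>sin\<close>.\<close>

definition rho :: "real \<Rightarrow> real \<Rightarrow> real" where
  "rho y \<theta> = wsum 0 y - Re (csum (Complex y \<theta>))"

definition psi :: "real \<Rightarrow> real \<Rightarrow> real" where
  "psi y \<theta> = - Im (csum (Complex y \<theta>))"

lemma exp_minus_Complex: "exp (- of_real w * Complex y \<theta>) = of_real (exp (- w * y)) * cis (- (w * \<theta>))"
proof -
  have "- of_real w * Complex y \<theta> = Complex (- w * y) (- (w * \<theta>))"
    by (simp add: complex_eq_iff)
  thus ?thesis by (simp add: exp_eq_polar)
qed

lemma csum_has_sum_polar:
  assumes "y > 0"
  shows "((\<lambda>x. of_real (wterm 0 y x) * cis (- (wt x * \<theta>))) has_sum csum (Complex y \<theta>)) UNIV"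
proof -
  have "of_real (wterm 0 y x) * cis (- (wt x * \<theta>)) =
        exp (- of_real (wt x) * Complex y \<theta>) / of_real (real (Suc (snd x)))" for x
    unfolding exp_minus_Complex by (simp add: wterm_def)
  thus ?thesis using csum_has_sum[of "Complex y \<theta>"] assms by simp
qed

lemma rho_has_sum:
  assumes "y > 0"
  shows "((\<lambda>x. wterm 0 y x * (1 - cos (wt x * \<theta>))) has_sum rho y \<theta>) UNIV"
proof -
  have "((\<lambda>x. wterm 0 y x - Re (of_real (wterm 0 y x) * cis (- (wt x * \<theta>)))) has_sum rho y \<theta>) UNIV"
    unfolding rho_def by (intro has_sum_diff wsum_has_sum has_sum_Re csum_has_sum_polar assms)
  thus ?thesis by (simp add: right_diff_distrib)
qed

lemma psi_has_sum:
  assumes "y > 0"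
  shows "((\<lambda>x. wterm 0 y x * sin (wt x * \<theta>)) has_sum psi y \<theta>) UNIV"
proof -
  have "((\<lambda>x. 0 - Im (of_real (wterm 0 y x) * cis (- (wt x * \<theta>)))) has_sum (0 - Im (csum (Complex y \<theta>)))) UNIV"
    by (intro has_sum_diff has_sum_Im csum_has_sum_polar assms) auto
  thus ?thesis by (simp add: psi_def)
qed

lemma csum_Complex: "csum (Complex y \<theta>) = Complex (wsum 0 y - rho y \<theta>) (- psi y \<theta>)"
  by (simp add: complex_eq_iff rho_def psi_def)

lemma wterm_power: "wterm i y x = wt x ^ i * wterm 0 y x"
  by (simp add: wterm_def)

text \<open>The Taylor bounds for sine and cosine hold for all real arguments. Applied to each
  summand they bound \<open>rho\<close> and \<open>psi\<close> at every \<theta>, with derivatives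
  of log F on the real axis as coefficients.\<close>

lemma rho_le:
  assumes "y > 0"
  shows "rho y \<theta> \<le> wsum 2 y * \<theta>\<^sup>2 / 2"
proof (rule has_sum_mono[OF rho_has_sum[OF assms]])
  show "((\<lambda>x. \<theta>\<^sup>2 / 2 * wterm 2 y x) has_sum (wsum 2 y * \<theta>\<^sup>2 / 2)) UNIV"
    using has_sum_cmult_right[OF wsum_has_sum[OF assms, of 2], of "\<theta>\<^sup>2 / 2"] by (simp add: mult_ac)
  fix x
  have "wterm 0 y x * (1 - cos (wt x * \<theta>)) \<le> wterm 0 y x * ((wt x * \<theta>)\<^sup>2 / 2)"
    by (intro mult_left_mono one_minus_cos_le) auto
  thus "wterm 0 y x * (1 - cos (wt x * \<theta>)) \<le> \<theta>\<^sup>2 / 2 * wterm 2 y x"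
    by (simp add: wterm_power[of 2] power_mult_distrib mult_ac)
qed

lemma rho_ge:
  assumes "y > 0"
  shows "rho y \<theta> \<ge> wsum 2 y * \<theta>\<^sup>2 / 2 - wsum 4 y * \<theta> ^ 4 / 24"
proof (rule has_sum_mono[OF _ rho_has_sum[OF assms]])
  show "((\<lambda>x. \<theta>\<^sup>2 / 2 * wterm 2 y x - \<theta> ^ 4 / 24 * wterm 4 y x) has_sum
      (wsum 2 y * \<theta>\<^sup>2 / 2 - wsum 4 y * \<theta> ^ 4 / 24)) UNIV"
    using has_sum_diff[OF has_sum_cmult_right[OF wsum_has_sum[OF assms, of 2], of "\<theta>\<^sup>2 / 2"]
      has_sum_cmult_right[OF wsum_has_sum[OF assms, of 4], of "\<theta> ^ 4 / 24"]] by (simp add: mult_ac)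
  fix x
  have "wterm 0 y x * (1 - cos (wt x * \<theta>)) \<ge> wterm 0 y x * ((wt x * \<theta>)\<^sup>2 / 2 - (wt x * \<theta>) ^ 4 / 24)"
    by (intro mult_left_mono one_minus_cos_ge) auto
  thus "\<theta>\<^sup>2 / 2 * wterm 2 y x - \<theta> ^ 4 / 24 * wterm 4 y x \<le> wterm 0 y x * (1 - cos (wt x * \<theta>))"
    by (simp add: wterm_power[of 2] wterm_power[of 4] power_mult_distrib algebra_simps)
qed

lemma psi_approx:
  assumes "y > 0"
  shows "\<bar>psi y \<theta> - wsum 1 y * \<theta>\<bar> \<le> wsum 3 y * \<bar>\<theta>\<bar> ^ 3 / 6"
proof -
  have a: "((\<lambda>x. wterm 0 y x * sin (wt x * \<theta>) - \<theta> * wterm 1 y x) has_sum (psi y \<theta> - wsum 1 y * \<theta>)) UNIV"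
    using has_sum_diff[OF psi_has_sum[OF assms] has_sum_cmult_right[OF wsum_has_sum[OF assms, of 1], of \<theta>]]
    by (simp add: mult_ac)
  have b: "((\<lambda>x. \<bar>\<theta>\<bar> ^ 3 / 6 * wterm 3 y x) has_sum (wsum 3 y * \<bar>\<theta>\<bar> ^ 3 / 6)) UNIV"
    using has_sum_cmult_right[OF wsum_has_sum[OF assms, of 3], of "\<bar>\<theta>\<bar> ^ 3 / 6"] by (simp add: mult_ac)
  have c: "((\<lambda>x. - (\<bar>\<theta>\<bar> ^ 3 / 6 * wterm 3 y x)) has_sum (- (wsum 3 y * \<bar>\<theta>\<bar> ^ 3 / 6))) UNIV"
    using b has_sum_uminus by fastforce
  have d: "\<bar>wterm 0 y x * sin (wt x * \<theta>) - \<theta> * wterm 1 y x\<bar> \<le> \<bar>\<theta>\<bar> ^ 3 / 6 * wterm 3 y x" for x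
  proof -
    have "wterm 0 y x * sin (wt x * \<theta>) - \<theta> * wterm 1 y x = wterm 0 y x * (sin (wt x * \<theta>) - wt x * \<theta>)"
      unfolding wterm_power[of 1] by (simp add: algebra_simps)
    hence "\<bar>wterm 0 y x * sin (wt x * \<theta>) - \<theta> * wterm 1 y x\<bar> = wterm 0 y x * \<bar>sin (wt x * \<theta>) - wt x * \<theta>\<bar>"
      by (simp add: abs_mult)
    also have "\<dots> \<le> wterm 0 y x * (\<bar>wt x * \<theta>\<bar> ^ 3 / 6)"
      by (intro mult_left_mono abs_sin_minus_le) auto
    also have "\<dots> = \<bar>\<theta>\<bar> ^ 3 / 6 * wterm 3 y x"
      by (simp add: wterm_power[of 3] abs_mult power_mult_distrib less_imp_le mult_ac)
    finally show ?thesis .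
  qed
  have "psi y \<theta> - wsum 1 y * \<theta> \<le> wsum 3 y * \<bar>\<theta>\<bar> ^ 3 / 6"
    by (rule has_sum_mono[OF a b]) (rule abs_le_D1[OF d])
  moreover have "- (wsum 3 y * \<bar>\<theta>\<bar> ^ 3 / 6) \<le> psi y \<theta> - wsum 1 y * \<theta>"
    by (rule has_sum_mono[OF c a]) (use abs_le_D2[OF d] minus_le_iff in blast)
  ultimately show ?thesis unfolding abs_le_iff by linarith
qed

section \<open>Decay away from the real axis\<close>

lemma sums_one_minus_cos:
  fixes y \<theta> :: real
  assumes y: "y > 0"
  defines "x \<equiv> exp (- y)" and "v \<equiv> 1 - cos \<theta>"
  shows "(\<lambda>m. x ^ Suc m * (1 - cos (real (Suc m) * \<theta>))) sums
           (x * (1 + x) * v / ((1 - x) * ((1 - x)\<^sup>2 + 2 * x * v)))"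
proof -
  have x: "0 < x" "x < 1" using y by (auto simp: x_def)
  define q where "q = of_real x * cis \<theta>"
  have q: "norm q < 1" using x by (simp add: q_def norm_mult)
  have "(\<lambda>m. Re (q * q ^ m)) sums Re (q * (1 / (1 - q)))"
    by (intro sums_Re sums_mult geometric_sums q)
  hence "(\<lambda>m. x * x ^ m - Re (q * q ^ m)) sums (x * (1 / (1 - x)) - Re (q * (1 / (1 - q))))"
    using x by (intro sums_diff sums_mult geometric_sums) auto
  moreover have "x * x ^ m - Re (q * q ^ m) = x ^ Suc m * (1 - cos (real (Suc m) * \<theta>))" for m
  proof -
    have "q * q ^ m = q ^ Suc m" by simp
    also have "\<dots> = of_real (x ^ Suc m) * cis (real (Suc m) * \<theta>)"
      by (simp only: q_def power_mult_distrib Complex.DeMoivre of_real_power)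
    finally have "q * q ^ m = of_real (x ^ Suc m) * cis (real (Suc m) * \<theta>)" .
    hence "Re (q * q ^ m) = x ^ Suc m * cos (real (Suc m) * \<theta>)" by simp
    thus ?thesis by (simp add: right_diff_distrib)
  qed
  moreover have "x * (1 / (1 - x)) - Re (q * (1 / (1 - q))) = x * (1 + x) * v / ((1 - x) * ((1 - x)\<^sup>2 + 2 * x * v))"
  proof -
    \<comment> \<open>\<open>D\<close> is the squared norm of \<open>1 - q\<close>.\<close>
    define D where "D = (1 - x)\<^sup>2 + 2 * x * v"
    have D: "D > 0" using x by (auto simp: D_def v_def intro!: add_pos_nonneg)
    have cs: "(sin \<theta>)\<^sup>2 = 1 - (cos \<theta>)\<^sup>2" by (simp add: sin_squared_eq)
    have "(1 - x * cos \<theta>)\<^sup>2 + (x * sin \<theta>)\<^sup>2 = D"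
      unfolding D_def v_def power_mult_distrib cs by (simp add: power2_eq_square algebra_simps)
    hence "Re (q * (1 / (1 - q))) = (x * cos \<theta> * (1 - x * cos \<theta>) - (x * sin \<theta>)\<^sup>2) / D"
      by (simp add: q_def Re_divide power2_eq_square algebra_simps)
    also have "x * cos \<theta> * (1 - x * cos \<theta>) - (x * sin \<theta>)\<^sup>2 = x * (1 - v) - x\<^sup>2"
      unfolding power_mult_distrib cs v_def by (simp add: power2_eq_square algebra_simps)
    finally have Re: "Re (q * (1 / (1 - q))) = (x * (1 - v) - x\<^sup>2) / D" .
    have "x * (1 / (1 - x)) - (x * (1 - v) - x\<^sup>2) / D = (x * D - (x * (1 - v) - x\<^sup>2) * (1 - x)) / ((1 - x) * D)"
      using x D by (simp add: diff_frac_eq)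
    also have "x * D - (x * (1 - v) - x\<^sup>2) * (1 - x) = x * (1 + x) * v"
      unfolding D_def by (simp add: power2_eq_square algebra_simps)
    finally show ?thesis unfolding Re D_def .
  qed
  ultimately show ?thesis by simp
qed

text \<open>The Taylor bound \<open>rho_ge\<close> becomes useless once \<theta> is of the order of
  y. All summands of \<open>rho\<close> are nonnegative, so a subseries that sums in closed form
  gives a bound that stays positive up to \<theta> = \<pi>.\<close>

lemma rho_ge_geometric:
  fixes y \<theta> :: real
  assumes y: "y > 0"
  defines "x \<equiv> exp (- y)" and "v \<equiv> 1 - cos \<theta>"
  shows "rho y \<theta> \<ge> x * (1 + x) * v / (y * (y\<^sup>2 + 2 * v))"
proof -
  have x: "0 < x" "x < 1" using y by (auto simp: x_def)
  have v: "v \<ge> 0" by (simp add: v_def)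
  have "x * (1 + x) * v / (y * (y\<^sup>2 + 2 * v)) \<le> x * (1 + x) * v / ((1 - x) * ((1 - x)\<^sup>2 + 2 * x * v))"
  proof (rule divide_left_mono)
    have 1: "1 - x \<le> y" using exp_ge_add_one_self[of "- y"] by (simp add: x_def)
    show "(1 - x) * ((1 - x)\<^sup>2 + 2 * x * v) \<le> y * (y\<^sup>2 + 2 * v)"
      using 1 x v y by (intro mult_mono add_mono power_mono mult_nonneg_nonneg) (auto simp: mult_left_le_one_le)
    show "0 \<le> x * (1 + x) * v" using x v by simp
    show "0 < y * (y\<^sup>2 + 2 * v) * ((1 - x) * ((1 - x)\<^sup>2 + 2 * x * v))"
      using x v y by (intro mult_pos_pos add_pos_nonneg) auto
  qed
  also have "\<dots> \<le> rho y \<theta>"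
  proof (rule LIMSEQ_le_const2)
    show "(\<lambda>n. \<Sum>m<n. x ^ Suc m * (1 - cos (real (Suc m) * \<theta>))) \<longlonglongrightarrow>
            x * (1 + x) * v / ((1 - x) * ((1 - x)\<^sup>2 + 2 * x * v))"
      using sums_one_minus_cos[OF y, of \<theta>] by (simp only: sums_def x_def v_def)
    have "(\<Sum>m<n. x ^ Suc m * (1 - cos (real (Suc m) * \<theta>))) \<le> rho y \<theta>" for n
    proof -
      have "(\<Sum>p\<in>(\<lambda>m. (m, 0)) ` {..<n}. wterm 0 y p * (1 - cos (wt p * \<theta>))) \<le> rho y \<theta>"
        by (rule finite_sum_le_has_sum[OF rho_has_sum[OF y]]) auto
      also have "(\<Sum>p\<in>(\<lambda>m. (m, 0)) ` {..<n}. wterm 0 y p * (1 - cos (wt p * \<theta>))) =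
                 (\<Sum>m<n. x ^ Suc m * (1 - cos (real (Suc m) * \<theta>)))"
      proof (subst sum.reindex)
        show "inj_on (\<lambda>m. (m, 0::nat)) {..<n}" by (auto simp: inj_on_def)
        have 1: "wt (m, 0) = real (Suc m)" for m by (simp add: wt_def)
        have 2: "wterm 0 y (m, 0) = x ^ Suc m" for m
          unfolding x_def exp_of_nat_mult[symmetric] wterm_def 1 by (simp add: algebra_simps)
        show "sum ((\<lambda>p. wterm 0 y p * (1 - cos (wt p * \<theta>))) \<circ> (\<lambda>m. (m, 0))) {..<n} =
              (\<Sum>m<n. x ^ Suc m * (1 - cos (real (Suc m) * \<theta>)))"
          by (simp only: o_def 1 2)
      qed
      finally show ?thesis .
    qed
    thus "\<exists>N. \<forall>n\<ge>N. (\<Sum>m<n. x ^ Suc m * (1 - cos (real (Suc m) * \<theta>))) \<le> rho y \<theta>" by blast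
  qed
  finally show ?thesis .
qed

section \<open>First derivative of the logarithm\<close>

text \<open>Lazarevic's inequality; it makes \<open>csch_gap\<close> below decreasing.\<close>

lemma lazarevic:
  fixes u :: real
  assumes "u \<ge> 0"
  shows "u ^ 3 * cosh u \<le> sinh u ^ 3"
proof -
  have "0 \<le> sinh u * cosh u powr (-1/3) - u"
  proof -
    have "sinh 0 * cosh 0 powr (-1/3) - 0 \<le> sinh u * cosh u powr (-1/3) - u"
    proof (rule DERIV_nonneg_imp_nondecreasing[OF assms])
      fix x :: real
      \<comment> \<open>With the cube root of cosh as variable the derivative becomes rational and
        contains the square \<open>(C\<^sup>2 - 1)\<^sup>2\<close>.\<close>
      define C where "C = cosh x powr (1/3)"
      have C: "C > 0" by (simp add: C_def)
      have C3: "C ^ 3 = cosh x" unfolding C_def by (simp add: powr_power)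
      have p1: "cosh x powr (-1/3) = 1 / C" by (simp add: C_def powr_minus_divide)
      have p2: "cosh x powr (-1/3 - 1) = 1 / (C * cosh x)"
        unfolding powr_diff p1 by simp
      have "((\<lambda>u. sinh u * cosh u powr (-1/3) - u) has_real_derivative
          (cosh x * cosh x powr (-1/3) + (-1/3) * sinh x * cosh x powr (-1/3 - 1) * sinh x - 1)) (at x)"
        by (auto intro!: derivative_eq_intros simp: powr_diff)
      moreover have "cosh x * cosh x powr (-1/3) + (-1/3) * sinh x * cosh x powr (-1/3 - 1) * sinh x - 1
          = (C\<^sup>2 - 1)\<^sup>2 * (2 * C\<^sup>2 + 1) / (3 * C ^ 4)"
      proof -
        have s: "sinh x * sinh x = C ^ 6 - 1"
          using cosh_square_eq[of x] C3 by (simp add: power2_eq_square flip: power_mult) (simp add: eval_nat_numeral mult.assoc flip: C3)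
        have "cosh x * cosh x powr (-1/3) + (-1/3) * sinh x * cosh x powr (-1/3 - 1) * sinh x - 1
           = C ^ 3 / C - (C ^ 6 - 1) / (3 * (C * C ^ 3)) - 1"
          unfolding p1 p2 s[symmetric] C3 by simp
        also have "\<dots> = (C\<^sup>2 - 1)\<^sup>2 * (2 * C\<^sup>2 + 1) / (3 * C ^ 4)"
          using C by (simp add: field_simps eval_nat_numeral)
        finally show ?thesis .
      qed
      ultimately show "\<exists>y. ((\<lambda>u. sinh u * cosh u powr (-1/3) - u) has_real_derivative y) (at x) \<and> 0 \<le> y"
        using C by (intro exI[of _ "(C\<^sup>2 - 1)\<^sup>2 * (2 * C\<^sup>2 + 1) / (3 * C ^ 4)"]) (auto intro!: divide_nonneg_nonneg)
    qed
    thus ?thesis by simp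
  qed
  hence "u ^ 3 \<le> (sinh u * cosh u powr (-1/3)) ^ 3"
    using assms by (intro power_mono) auto
  also have "\<dots> = sinh u ^ 3 / cosh u"
  proof -
    have "(cosh u powr (-1/3)) ^ 3 = cosh u powr (-1)" by (simp add: powr_power)
    also have "\<dots> = 1 / cosh u" by (rule powr_neg_one) simp
    finally show ?thesis unfolding power_mult_distrib by simp
  qed
  finally show ?thesis by (simp add: pos_le_divide_eq)
qed

text \<open>\<open>csch_gap\<close> is the derivative of \<open>bose_gap\<close> and decreases, so that the series for \<open>wsum 1\<close>
  can be compared with a telescoping sum of values of \<open>bose_gap\<close>.\<close>

definition csch_gap :: "real \<Rightarrow> real" where
  "csch_gap x = 1 / x\<^sup>2 - 1 / (4 * (sinh (x / 2))\<^sup>2)"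

definition bose_gap :: "real \<Rightarrow> real" where
  "bose_gap x = 1 / (exp x - 1) - 1 / x"

lemma bose_gap_has_derivative:
  assumes "x > 0"
  shows "(bose_gap has_real_derivative csch_gap x) (at x)"
proof -
  have e: "exp x > 1" using assms by simp
  have "(bose_gap has_real_derivative (1 / x\<^sup>2 - exp x / (exp x - 1)\<^sup>2)) (at x)"
    unfolding bose_gap_def using assms e
    by (auto intro!: derivative_eq_intros simp: power2_eq_square)
  moreover have "exp x / (exp x - 1)\<^sup>2 = 1 / (4 * (sinh (x / 2))\<^sup>2)"
    unfolding four_sinh_square by simp
  ultimately show ?thesis by (simp add: csch_gap_def)
qed

lemma csch_gap_antimono:
  assumes "0 < x" "x \<le> y"
  shows "csch_gap y \<le> csch_gap x"
proof (rule DERIV_nonpos_imp_nonincreasing[OF assms(2)])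
  fix t assume t: "x \<le> t" "t \<le> y"
  with assms have t0: "t > 0" by simp
  define u where "u = t / 2"
  have u: "u > 0" "t = 2 * u" using t0 by (auto simp: u_def)
  have s: "sinh u > 0" using u by simp
  have "(csch_gap has_real_derivative (- 2 / t ^ 3 + cosh u / (4 * sinh u ^ 3))) (at t)"
    unfolding csch_gap_def using s t0 u_def
    by (auto intro!: derivative_eq_intros simp: power2_eq_square power3_eq_cube)
  moreover have "- 2 / t ^ 3 + cosh u / (4 * sinh u ^ 3) \<le> 0"
  proof -
    have "cosh u / sinh u ^ 3 \<le> 1 / u ^ 3"
      using lazarevic[of u] u s by (simp add: field_simps)
    thus ?thesis unfolding u(2) by (simp add: power_mult_distrib)
  qed
  ultimately show "\<exists>y. (csch_gap has_real_derivative y) (at t) \<and> y \<le> 0" by blast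
qed

lemma bose_gap_tendsto_0: "(bose_gap \<longlongrightarrow> - 1 / 2) (at_right 0)"
  unfolding bose_gap_def by real_asymp

lemma bose_gap_tendsto_infinity: "(bose_gap \<longlongrightarrow> 0) at_top"
  unfolding bose_gap_def by real_asymp

lemma bose_gap_diff_le:
  assumes "0 < a" "a \<le> b"
  shows "bose_gap b - bose_gap a \<le> (b - a) * csch_gap a"
    and "(b - a) * csch_gap b \<le> bose_gap b - bose_gap a"
proof -
  have "(b - a) * csch_gap b \<le> bose_gap b - bose_gap a \<and> bose_gap b - bose_gap a \<le> (b - a) * csch_gap a"
  proof (cases "a = b")
    case False
    with assms have "a < b" by simp
    then obtain z where z: "a < z" "z < b" "bose_gap b - bose_gap a = (b - a) * csch_gap z"
      using MVT2[of a b bose_gap csch_gap] bose_gap_has_derivative assms by force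
    show ?thesis unfolding z(3)
      using z assms \<open>a < b\<close> by (intro conjI mult_left_mono csch_gap_antimono) auto
  qed auto
  thus "bose_gap b - bose_gap a \<le> (b - a) * csch_gap a"
    and "(b - a) * csch_gap b \<le> bose_gap b - bose_gap a" by auto
qed

text \<open>The first interval, from 0 to t, of the telescoping comparison. \<open>bose_gap\<close>
  extends to 0 by the value -1/2, and this boundary value is the origin of the term
  \<open>1 / (2 * t)\<close> in \<open>wsum_1_bounds\<close>.\<close>

lemma csch_gap_head:
  assumes "t > 0"
  shows "t * csch_gap t \<le> bose_gap t + 1 / 2"
proof -
  have "((\<lambda>a. (t - a) * csch_gap t) \<longlongrightarrow> (t - 0) * csch_gap t) (at_right 0)"
    by (intro tendsto_intros)
  moreover have "((\<lambda>a. bose_gap t - bose_gap a) \<longlongrightarrow> bose_gap t - (- 1 / 2)) (at_right 0)"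
    by (intro tendsto_intros bose_gap_tendsto_0)
  moreover have "\<forall>\<^sub>F a in at_right 0. (t - a) * csch_gap t \<le> bose_gap t - bose_gap a"
    using eventually_at_right_less eventually_at_right_field[of "\<lambda>a. a < t" 0] assms
    by (auto simp: eventually_at_right_field intro!: exI[of _ t] bose_gap_diff_le)
  ultimately have "(t - 0) * csch_gap t \<le> bose_gap t - (- 1 / 2)"
    by (intro tendsto_le[of "at_right 0"]) auto
  thus ?thesis by simp
qed

lemma csch_gap_sum_bounds:
  assumes "t > 0"
  shows "(\<Sum>k<Suc n. t * csch_gap (real (Suc k) * t)) \<le> bose_gap (real (Suc n) * t) + 1 / 2"
    and "bose_gap (real (Suc n) * t) - bose_gap t \<le> (\<Sum>k<n. t * csch_gap (real (Suc k) * t))"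
proof -
  show "(\<Sum>k<Suc n. t * csch_gap (real (Suc k) * t)) \<le> bose_gap (real (Suc n) * t) + 1 / 2"
  proof (induction n)
    case 0
    show ?case using csch_gap_head[OF assms] by simp
  next
    case (Suc n)
    have pos: "0 < real (Suc n) * t" "real (Suc n) * t \<le> real (Suc (Suc n)) * t"
      using assms by (auto simp: mult_right_mono)
    have "real (Suc (Suc n)) * t - real (Suc n) * t = t" by (simp add: algebra_simps)
    hence "t * csch_gap (real (Suc (Suc n)) * t) \<le> bose_gap (real (Suc (Suc n)) * t) - bose_gap (real (Suc n) * t)"
      using bose_gap_diff_le(2)[OF pos] by (simp only:)
    thus ?case using Suc unfolding sum.lessThan_Suc[of _ "Suc n"] by linarith
  qed
  show "bose_gap (real (Suc n) * t) - bose_gap t \<le> (\<Sum>k<n. t * csch_gap (real (Suc k) * t))"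
  proof (induction n)
    case (Suc n)
    have "bose_gap (real (Suc (Suc n)) * t) - bose_gap (real (Suc n) * t) \<le> t * csch_gap (real (Suc n) * t)"
    proof -
      have pos: "0 < real (Suc n) * t" "real (Suc n) * t \<le> real (Suc (Suc n)) * t"
        using assms by (auto simp: mult_right_mono)
      have "real (Suc (Suc n)) * t - real (Suc n) * t = t" by (simp add: algebra_simps)
      thus ?thesis using bose_gap_diff_le(1)[OF pos] by (simp only:)
    qed
    thus ?case using Suc by simp
  qed simp
qed

lemma exp_ge_Taylor:
  fixes t :: real
  assumes "t \<ge> 0"
  shows "(\<Sum>m<n. t ^ m / fact m) \<le> exp t"
proof -
  have "(\<lambda>m. t ^ m /\<^sub>R fact m) sums exp t" by (rule exp_converges)
  hence s: "(\<lambda>m. t ^ m / fact m) sums exp t" by (simp add: field_simps)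
  show ?thesis using sum_le_suminf[OF sums_summable[OF s], of "{..<n}"] assms sums_unique[OF s] by simp
qed

text \<open>The expansion at 0 starts with \<open>- 1 / 2 + t / 12\<close>. With 1/10 in place of
  1/12 the cubic Taylor polynomial of exp suffices for all t, because the product in
  \<open>PQ\<close> exceeds 1 by a multiple of a square. This 1/10 is the error constant of
  \<open>wsum_1_bounds\<close> and \<open>log_gf_error_bounds\<close>.\<close>

lemma bose_gap_le:
  assumes "t > 0"
  shows "bose_gap t \<le> - 1 / 2 + t / 10"
proof -
  have "1 + t + t\<^sup>2 / 2 + t ^ 3 / 6 \<le> exp t"
    using exp_ge_Taylor[of t 4] assms by (simp add: lessThan_nat_numeral fact_numeral)
  hence P: "t * (1 + t / 2 + t\<^sup>2 / 6) \<le> exp t - 1"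
    by (simp add: power2_eq_square power3_eq_cube algebra_simps)
  have PQ: "1 \<le> (1 + t / 2 + t\<^sup>2 / 6) * (1 - t / 2 + t\<^sup>2 / 10)"
  proof -
    have "(1 + t / 2 + t\<^sup>2 / 6) * (1 - t / 2 + t\<^sup>2 / 10) = 1 + (t * (1 - t))\<^sup>2 / 60"
      by (simp add: field_simps eval_nat_numeral)
    thus ?thesis by simp
  qed
  have "1 - t / 2 + t\<^sup>2 / 10 = (t - 5 / 2)\<^sup>2 / 10 + 3 / 8"
    by (simp add: power2_eq_square field_simps)
  hence Q: "1 - t / 2 + t\<^sup>2 / 10 \<ge> 0" by simp
  have "t * 1 \<le> t * ((1 + t / 2 + t\<^sup>2 / 6) * (1 - t / 2 + t\<^sup>2 / 10))"
    using PQ assms by (intro mult_left_mono) auto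
  also have "\<dots> = (t * (1 + t / 2 + t\<^sup>2 / 6)) * (1 - t / 2 + t\<^sup>2 / 10)"
    by (simp only: mult.assoc)
  also have "\<dots> \<le> (exp t - 1) * (1 - t / 2 + t\<^sup>2 / 10)"
    by (rule mult_right_mono[OF P Q])
  finally have "t \<le> (exp t - 1) * (1 - t / 2 + t\<^sup>2 / 10)" by simp
  hence "1 / (exp t - 1) \<le> (1 - t / 2 + t\<^sup>2 / 10) / t"
    using assms by (simp add: field_simps)
  also have "\<dots> = 1 / t - 1 / 2 + t / 10"
    using assms by (simp add: field_simps power2_eq_square)
  finally show ?thesis by (simp add: bose_gap_def)
qed

lemma sums_inverse_squares_scaled:
  assumes "t > 0"
  shows "(\<lambda>k. 1 / (real (Suc k) * t)\<^sup>2) sums (pi\<^sup>2 / (6 * t\<^sup>2))"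
  using sums_divide[OF inverse_squares_sums, of "t\<^sup>2"] by (simp add: power_mult_distrib)

text \<open>An Euler-Maclaurin estimate in which monotonicity replaces the remainder term. The
  modular relation would put 1/24, up to an exponentially small amount for small t, in place of the
  range from 0 to 1/10; a bounded error is all that is needed.\<close>

lemma wsum_1_bounds:
  assumes t: "t > 0"
  shows "pi\<^sup>2 / (6 * t\<^sup>2) - 1 / (2 * t) \<le> wsum 1 t"
    and "wsum 1 t \<le> pi\<^sup>2 / (6 * t\<^sup>2) - 1 / (2 * t) + 1 / 10"
proof -
  define G where "G = pi\<^sup>2 / (6 * t\<^sup>2) - wsum 1 t"
  have "(\<lambda>k. 1 / (real (Suc k) * t)\<^sup>2 - 1 / (4 * (sinh (real (Suc k) * t / 2))\<^sup>2)) sums G"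
    unfolding G_def by (intro sums_diff sums_inverse_squares_scaled wsum_1_sums t)
  hence "(\<lambda>k. t * csch_gap (real (Suc k) * t)) sums (t * G)"
    unfolding csch_gap_def by (intro sums_mult)
  hence lim: "(\<lambda>n. \<Sum>k<n. t * csch_gap (real (Suc k) * t)) \<longlonglongrightarrow> t * G"
    unfolding sums_def .
  have "filterlim (\<lambda>n. real n * t) at_top sequentially"
    using t by (intro filterlim_at_top_mult_tendsto_pos[OF tendsto_const] filterlim_real_sequentially) auto
  hence lim0: "(\<lambda>n. bose_gap (real n * t)) \<longlonglongrightarrow> 0"
    by (rule filterlim_compose[OF bose_gap_tendsto_infinity])
  have "t * G \<le> 0 + 1 / 2"
  proof (rule LIMSEQ_le[OF LIMSEQ_Suc[OF lim]])
    show "(\<lambda>n. bose_gap (real (Suc n) * t) + 1 / 2) \<longlonglongrightarrow> 0 + 1 / 2"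
      by (rule tendsto_add[OF LIMSEQ_Suc[OF lim0] tendsto_const])
    show "\<exists>N. \<forall>n\<ge>N. (\<Sum>k<Suc n. t * csch_gap (real (Suc k) * t)) \<le> bose_gap (real (Suc n) * t) + 1 / 2"
      using csch_gap_sum_bounds(1)[OF t] by blast
  qed
  hence "G * t \<le> 1 / 2" by (simp add: mult.commute)
  hence "G \<le> 1 / 2 / t" using t by (simp only: pos_le_divide_eq)
  thus "pi\<^sup>2 / (6 * t\<^sup>2) - 1 / (2 * t) \<le> wsum 1 t"
    unfolding G_def by simp
  have "0 - bose_gap t \<le> t * G"
  proof (rule LIMSEQ_le[OF _ lim])
    show "(\<lambda>n. bose_gap (real (Suc n) * t) - bose_gap t) \<longlonglongrightarrow> 0 - bose_gap t"
      by (rule tendsto_diff[OF LIMSEQ_Suc[OF lim0] tendsto_const])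
    show "\<exists>N. \<forall>n\<ge>N. bose_gap (real (Suc n) * t) - bose_gap t \<le> (\<Sum>k<n. t * csch_gap (real (Suc k) * t))"
      using csch_gap_sum_bounds(2)[OF t] by blast
  qed
  hence "1 / 2 - t / 10 \<le> G * t" using bose_gap_le[OF t] by (simp add: mult.commute)
  hence "(1 / 2 - t / 10) / t \<le> G" using t by (simp only: pos_divide_le_eq)
  moreover have "(1 / 2 - t / 10) / t = 1 / (2 * t) - 1 / 10" using t by (simp add: diff_divide_distrib)
  ultimately show "wsum 1 t \<le> pi\<^sup>2 / (6 * t\<^sup>2) - 1 / (2 * t) + 1 / 10"
    unfolding G_def by linarith
qed

section \<open>Higher derivatives of the logarithm\<close>

lemma pi_square_bounds: "98695 / 10000 \<le> pi\<^sup>2" "pi\<^sup>2 \<le> 98697 / 10000"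
proof -
  have "3.14159\<^sup>2 \<le> pi\<^sup>2" "pi\<^sup>2 \<le> 3.141593\<^sup>2"
    using pi_approx by (auto intro!: power_mono)
  thus "98695 / 10000 \<le> pi\<^sup>2" "pi\<^sup>2 \<le> 98697 / 10000" by (simp_all add: power2_eq_square)
qed

text \<open>The difference quotients of the decreasing convex function \<open>wsum 1\<close> with step \<open>y\<^sup>2 / 7\<close>:
  the step is chosen to balance the uncertainty \<open>1 / 10\<close> in \<open>wsum_1_bounds\<close> against the curvature.\<close>

lemma wsum_2_lower:
  assumes y: "y > 0"
  shows "pi\<^sup>2 / (3 * y ^ 3) - 2 / y\<^sup>2 \<le> wsum 2 y"
proof -
  define k where "k = y / 7"
  have k: "k > 0" and yk: "y = 7 * k" using y by (auto simp: k_def)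
  define P where "P = pi\<^sup>2"
  have P: "98695 / 10000 \<le> P" "P \<le> 98697 / 10000" using pi_square_bounds by (auto simp: P_def)
  have s: "wsum 1 y - wsum 1 (y + y * k) \<le> (y * k) * wsum 2 y"
    using wsum_diff_upper[of y "y * k" 1] y k by (simp add: numeral_2_eq_2)
  have e: "y + y * k = y * (1 + k)" by (simp add: algebra_simps)
  have l: "P / (6 * y\<^sup>2) - 1 / (2 * y) \<le> wsum 1 y" using wsum_1_bounds(1)[OF y] by (simp add: P_def)
  have u: "wsum 1 (y + y * k) \<le> P / (6 * y\<^sup>2) * (1 / (1 + k)\<^sup>2) - 1 / (2 * y) * (1 / (1 + k)) + 1 / 10"
    using wsum_1_bounds(2)[of "y * (1 + k)"] y k unfolding e by (simp add: P_def power_mult_distrib)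
  have "1 / (1 + k)\<^sup>2 \<le> 1 - 2 * k + 3 * k\<^sup>2"
  proof -
    have "1 \<le> 1 + k\<^sup>2 * k * (4 + 3 * k)" using k by simp
    also have "\<dots> = (1 - 2 * k + 3 * k\<^sup>2) * (1 + k)\<^sup>2"
      by (simp add: power2_eq_square algebra_simps)
    finally show ?thesis using k by (simp add: divide_le_eq)
  qed
  hence 1: "P / (6 * y\<^sup>2) * (1 / (1 + k)\<^sup>2) \<le> P / (6 * y\<^sup>2) * (1 - 2 * k + 3 * k\<^sup>2)"
    using P y by (intro mult_left_mono) auto
  have "1 - k \<le> 1 / (1 + k)"
  proof -
    have "(1 - k) * (1 + k) \<le> 1" by (simp add: algebra_simps)
    thus ?thesis using k by (simp add: le_divide_eq)
  qed
  hence 2: "1 / (2 * y) * (1 - k) \<le> 1 / (2 * y) * (1 / (1 + k))"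
    using y by (intro mult_left_mono) auto
  have "P / (6 * y\<^sup>2) - 1 / (2 * y) - (P / (6 * y\<^sup>2) * (1 - 2 * k + 3 * k\<^sup>2) - 1 / (2 * y) * (1 - k) + 1 / 10)
      \<le> (y * k) * wsum 2 y"
    using s l u 1 2 by linarith
  also have "P / (6 * y\<^sup>2) - 1 / (2 * y) - (P / (6 * y\<^sup>2) * (1 - 2 * k + 3 * k\<^sup>2) - 1 / (2 * y) * (1 - k) + 1 / 10)
     = P / (6 * y\<^sup>2) * (2 * k) - P / 98 - 1 / 14 - 1 / 10"
    using k unfolding yk by (simp add: field_simps power2_eq_square)
  \<comment> \<open>\<open>P / 98\<close> stems from the curvature, 1/14 from the term
    \<open>1 / (2 * y)\<close> and 1/10 from the uncertainty of \<open>wsum 1\<close>. Their sum is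
    below 2/7, which turns into \<open>2 / y\<^sup>2\<close> on division by the step
    \<open>y * k\<close>.\<close>
  finally have "P / (6 * y\<^sup>2) * (2 * k) - 2 / 7 \<le> (y * k) * wsum 2 y"
    using P by linarith
  moreover have "P / (6 * y\<^sup>2) * (2 * k) - 2 / 7 = (y * k) * (P / (3 * y ^ 3) - 2 / y\<^sup>2)"
    using k unfolding yk by (simp add: field_simps power2_eq_square power3_eq_cube)
  ultimately have "(y * k) * (P / (3 * y ^ 3) - 2 / y\<^sup>2) \<le> (y * k) * wsum 2 y" by simp
  thus ?thesis using y k by (simp add: P_def)
qed

lemma wsum_2_upper:
  assumes y: "y > 0" "y \<le> 1 / 4"
  shows "wsum 2 y \<le> pi\<^sup>2 / (3 * y ^ 3) + 1 / y\<^sup>2"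
proof -
  define k where "k = y / 7"
  have k: "k > 0" "k \<le> 1 / 28" and yk: "y = 7 * k" using y by (auto simp: k_def)
  define P where "P = pi\<^sup>2"
  have P: "98695 / 10000 \<le> P" "P \<le> 98697 / 10000" using pi_square_bounds by (auto simp: P_def)
  have e: "y - y * k = y * (1 - k)" by (simp add: algebra_simps)
  have pos: "y - y * k > 0" unfolding e using y k by (intro mult_pos_pos) auto
  have s: "(y * k) * wsum 2 y \<le> wsum 1 (y - y * k) - wsum 1 y"
    using wsum_diff_lower[OF pos, of "y * k" 1] y k by (simp add: numeral_2_eq_2)
  have l: "P / (6 * y\<^sup>2) - 1 / (2 * y) \<le> wsum 1 y" using wsum_1_bounds(1)[OF y(1)] by (simp add: P_def)
  have u: "wsum 1 (y - y * k) \<le> P / (6 * y\<^sup>2) * (1 / (1 - k)\<^sup>2) - 1 / (2 * y) * (1 / (1 - k)) + 1 / 10"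
    using wsum_1_bounds(2)[OF pos] unfolding e by (simp add: P_def power_mult_distrib)
  \<comment> \<open>16/5 exceeds the Taylor coefficient 3 in order to absorb the higher terms;
    \<open>k \<le> 1 / 28\<close> makes this sufficient.\<close>
  have "1 / (1 - k)\<^sup>2 \<le> 1 + 2 * k + 16 / 5 * k\<^sup>2"
  proof -
    have "0 \<le> k\<^sup>2 * (1 / 5 - 22 / 5 * k + 16 / 5 * k * k)" using k by (intro mult_nonneg_nonneg) auto
    hence "1 \<le> 1 + k\<^sup>2 * (1 / 5 - 22 / 5 * k + 16 / 5 * k * k)" by simp
    also have "\<dots> = (1 + 2 * k + 16 / 5 * k\<^sup>2) * (1 - k)\<^sup>2"
      by (simp add: power2_eq_square field_simps)
    finally show ?thesis using k by (simp add: divide_le_eq)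
  qed
  hence 1: "P / (6 * y\<^sup>2) * (1 / (1 - k)\<^sup>2) \<le> P / (6 * y\<^sup>2) * (1 + 2 * k + 16 / 5 * k\<^sup>2)"
    using P y by (intro mult_left_mono) auto
  have "1 + k \<le> 1 / (1 - k)"
  proof -
    have "(1 + k) * (1 - k) \<le> 1" by (simp add: algebra_simps)
    thus ?thesis using k by (simp add: le_divide_eq)
  qed
  hence 2: "1 / (2 * y) * (1 + k) \<le> 1 / (2 * y) * (1 / (1 - k))"
    using y by (intro mult_left_mono) auto
  have "(y * k) * wsum 2 y \<le> P / (6 * y\<^sup>2) * (1 + 2 * k + 16 / 5 * k\<^sup>2) - 1 / (2 * y) * (1 + k) + 1 / 10 - (P / (6 * y\<^sup>2) - 1 / (2 * y))"
    using s l u 1 2 by linarith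
  also have "\<dots> = P / (6 * y\<^sup>2) * (2 * k) + 16 / 1470 * P - 1 / 14 + 1 / 10"
    using k unfolding yk by (simp add: field_simps power2_eq_square)
  also have "\<dots> \<le> P / (6 * y\<^sup>2) * (2 * k) + 1 / 7" using P by linarith
  also have "\<dots> = (y * k) * (P / (3 * y ^ 3) + 1 / y\<^sup>2)"
    using k unfolding yk by (simp add: field_simps power2_eq_square power3_eq_cube)
  finally show ?thesis using y k by (simp add: P_def)
qed

text \<open>To leading order \<open>wsum 3 y\<close> is \<open>pi\<^sup>2 / y ^ 4\<close> and
  \<open>wsum 4 y\<close> is \<open>4 * pi\<^sup>2 / y ^ 5\<close>, with numerators about 9.87 and
  39.5. The slack up to 12 and 49 pays for the coarse step \<open>y / 5\<close>. A fixed fraction of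
  y will do, since the error of \<open>wsum 2\<close> is smaller than its main term by a factor of
  order y.\<close>

lemma wsum_3_upper:
  assumes y: "y > 0" "y \<le> 1 / 20"
  shows "wsum 3 y \<le> 12 / y ^ 4"
proof -
  define P where "P = pi\<^sup>2"
  have P: "98695 / 10000 \<le> P" "P \<le> 98697 / 10000" using pi_square_bounds by (auto simp: P_def)
  have s: "2 / 5 * y * wsum 3 y \<le> wsum 2 (4 / 5 * y) - wsum 2 (6 / 5 * y)"
    using wsum_central_diff[of "y / 5" y 2] y by (simp add: numeral_3_eq_3 numeral_2_eq_2)
  have "wsum 2 (4 / 5 * y) \<le> P / (3 * (4 / 5 * y) ^ 3) + 1 / (4 / 5 * y)\<^sup>2"
    unfolding P_def by (intro wsum_2_upper) (use y in auto)
  also have "\<dots> = 125 / 192 * P / y ^ 3 + 25 / 16 / y\<^sup>2"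
    by (simp add: power_mult_distrib power_divide)
  finally have u: "wsum 2 (4 / 5 * y) \<le> 125 / 192 * P / y ^ 3 + 25 / 16 / y\<^sup>2" .
  have "P / (3 * (6 / 5 * y) ^ 3) - 2 / (6 / 5 * y)\<^sup>2 \<le> wsum 2 (6 / 5 * y)"
    unfolding P_def by (intro wsum_2_lower) (use y in auto)
  moreover have "P / (3 * (6 / 5 * y) ^ 3) - 2 / (6 / 5 * y)\<^sup>2 = 125 / 648 * P / y ^ 3 - 50 / 36 / y\<^sup>2"
    by (simp add: power_mult_distrib power_divide)
  ultimately have l: "125 / 648 * P / y ^ 3 - 50 / 36 / y\<^sup>2 \<le> wsum 2 (6 / 5 * y)" by simp
  have "2 / 5 * y * wsum 3 y \<le> 2375 / 5184 * P / y ^ 3 + 425 / 144 / y\<^sup>2"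
    using s u l by linarith
  also have "\<dots> = (2375 / 5184 * P + 425 / 144 * y) / y ^ 3"
    using y by (simp add: field_simps power2_eq_square power3_eq_cube)
  also have "\<dots> \<le> (24 / 5) / y ^ 3"
    using y P by (intro divide_right_mono) auto
  finally have "2 / 5 * y * wsum 3 y \<le> 2 / 5 * y * (12 / y ^ 4)"
    using y by (simp add: eval_nat_numeral)
  thus ?thesis using y by (subst (asm) mult_le_cancel_left_pos) auto
qed

lemma wsum_4_upper:
  assumes y: "y > 0" "y \<le> 1 / 30"
  shows "wsum 4 y \<le> 49 / y ^ 5"
proof -
  define P where "P = pi\<^sup>2"
  have P: "98695 / 10000 \<le> P" "P \<le> 98697 / 10000" using pi_square_bounds by (auto simp: P_def)
  have s: "(y / 5)\<^sup>2 * wsum 4 y \<le> wsum 2 (4 / 5 * y) + wsum 2 (6 / 5 * y) - 2 * wsum 2 y"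
    using wsum_second_diff[of "y / 5" y 2] y by (simp add: eval_nat_numeral)
  have "wsum 2 (4 / 5 * y) \<le> P / (3 * (4 / 5 * y) ^ 3) + 1 / (4 / 5 * y)\<^sup>2"
    unfolding P_def by (intro wsum_2_upper) (use y in auto)
  also have "\<dots> = 125 / 192 * P / y ^ 3 + 25 / 16 / y\<^sup>2"
    by (simp add: power_mult_distrib power_divide)
  finally have u: "wsum 2 (4 / 5 * y) \<le> 125 / 192 * P / y ^ 3 + 25 / 16 / y\<^sup>2" .
  have "wsum 2 (6 / 5 * y) \<le> P / (3 * (6 / 5 * y) ^ 3) + 1 / (6 / 5 * y)\<^sup>2"
    unfolding P_def by (intro wsum_2_upper) (use y in auto)
  also have "\<dots> = 125 / 648 * P / y ^ 3 + 25 / 36 / y\<^sup>2"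
    by (simp add: power_mult_distrib power_divide)
  finally have u2: "wsum 2 (6 / 5 * y) \<le> 125 / 648 * P / y ^ 3 + 25 / 36 / y\<^sup>2" .
  have "P / (3 * y ^ 3) - 2 / y\<^sup>2 \<le> wsum 2 y"
    unfolding P_def by (intro wsum_2_lower) (use y in auto)
  hence l: "1 / 3 * P / y ^ 3 - 2 / y\<^sup>2 \<le> wsum 2 y" by simp
  have "(y / 5)\<^sup>2 * wsum 4 y \<le> 919 / 5184 * P / y ^ 3 + 901 / 144 / y\<^sup>2"
    using s u u2 l by linarith
  also have "\<dots> = (919 / 5184 * P + 901 / 144 * y) / y ^ 3"
    using y by (simp add: field_simps power2_eq_square power3_eq_cube)
  also have "\<dots> \<le> (49 / 25) / y ^ 3"
    using y P by (intro divide_right_mono) auto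
  also have "\<dots> = (y / 5)\<^sup>2 * (49 / y ^ 5)"
    using y by (simp add: eval_nat_numeral)
  finally show ?thesis using y by (subst (asm) mult_le_cancel_left_pos) auto
qed

section \<open>The logarithm near the singularity\<close>

definition log_gf_main :: "real \<Rightarrow> real" where
  "log_gf_main y = pi\<^sup>2 / (6 * y) + ln (y / (2 * pi)) / 2"

definition log_gf_error :: "real \<Rightarrow> real" where
  "log_gf_error y = wsum 0 y - log_gf_main y"

lemma log_gf_error_has_derivative:
  assumes "y > 0"
  shows "(log_gf_error has_real_derivative (pi\<^sup>2 / (6 * y\<^sup>2) - 1 / (2 * y) - wsum 1 y)) (at y)"
proof -
  have d: "(log_gf_main has_real_derivative (- pi\<^sup>2 / (6 * y\<^sup>2) + 1 / (2 * y))) (at y)"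
    unfolding log_gf_main_def using assms
    by (auto intro!: derivative_eq_intros simp: power2_eq_square)
  show ?thesis
    using DERIV_diff[OF wsum_has_derivative[OF assms, of 0] d]
    unfolding log_gf_error_def[abs_def] by (simp add: algebra_simps)
qed

lemma log_gf_error_diff:
  assumes "0 < a" "a \<le> b"
  shows "0 \<le> log_gf_error a - log_gf_error b" "log_gf_error a - log_gf_error b \<le> (b - a) / 10"
proof -
  have "0 \<le> log_gf_error a - log_gf_error b \<and> log_gf_error a - log_gf_error b \<le> (b - a) / 10"
  proof (cases "a = b")
    case False
    with assms have "a < b" by simp
    then obtain z where z: "a < z" "z < b" "log_gf_error b - log_gf_error a =
        (b - a) * (pi\<^sup>2 / (6 * z\<^sup>2) - 1 / (2 * z) - wsum 1 z)"
      using MVT2[of a b log_gf_error "\<lambda>z. pi\<^sup>2 / (6 * z\<^sup>2) - 1 / (2 * z) - wsum 1 z"]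
        log_gf_error_has_derivative assms by force
    have "z > 0" using z assms by simp
    hence b: "0 \<le> wsum 1 z - (pi\<^sup>2 / (6 * z\<^sup>2) - 1 / (2 * z))" "wsum 1 z - (pi\<^sup>2 / (6 * z\<^sup>2) - 1 / (2 * z)) \<le> 1 / 10"
      using wsum_1_bounds[of z] by linarith+
    have "log_gf_error a - log_gf_error b = (b - a) * (wsum 1 z - (pi\<^sup>2 / (6 * z\<^sup>2) - 1 / (2 * z)))"
      using z(3) by (simp add: right_diff_distrib)
    moreover have "(b - a) * (wsum 1 z - (pi\<^sup>2 / (6 * z\<^sup>2) - 1 / (2 * z))) \<le> (b - a) * (1 / 10)"
      using b \<open>a < b\<close> by (intro mult_left_mono) auto
    moreover have "(b - a) * (wsum 1 z - (pi\<^sup>2 / (6 * z\<^sup>2) - 1 / (2 * z))) \<ge> 0"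
      using b \<open>a < b\<close> by (intro mult_nonneg_nonneg) auto
    ultimately show ?thesis by simp
  qed auto
  thus "0 \<le> log_gf_error a - log_gf_error b" "log_gf_error a - log_gf_error b \<le> (b - a) / 10" by auto
qed

text \<open>The additive constant in the expansion of \<open>wsum 0\<close> comes from comparing \<open>wsum 0 y\<close> with
  \<open>wsum 0 (y / 2)\<close>: the combination \<open>2 * wsum 0 (y / 2) - 4 * wsum 0 y\<close> is a deformation of the logarithm
  of Wallis' product.\<close>

definition wallis_term :: "nat \<Rightarrow> real \<Rightarrow> real" where
  "wallis_term k y = - ln (1 - (sinh (y / 4) / sinh (real (Suc k) * y / 2))\<^sup>2)"

lemma sinh_mult_ge:
  fixes t :: real
  assumes "t \<ge> 0"
  shows "real n * sinh t \<le> sinh (real n * t)"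
proof (induction n)
  case (Suc n)
  have "real (Suc n) * sinh t = real n * sinh t + sinh t" by (simp add: algebra_simps)
  also have "\<dots> \<le> sinh (real n * t) * 1 + 1 * sinh t" using Suc by simp
  also have "\<dots> \<le> sinh (real n * t) * cosh t + cosh (real n * t) * sinh t"
    using assms by (intro add_mono mult_left_mono mult_right_mono) (auto simp: cosh_real_ge_1)
  also have "\<dots> = sinh (real (Suc n) * t)"
  proof -
    have "real (Suc n) * t = real n * t + t" by (simp add: algebra_simps)
    thus ?thesis by (simp only: sinh_add)
  qed
  finally show ?case .
qed simp

text \<open>Each ratio is at most its limit for y tending to 0, so Wallis' own factors serve as the
  majorant in Tannery's theorem.\<close>

lemma wallis_ratio_bounds:
  assumes "y > 0"
  shows "0 < sinh (y / 4) / sinh (real (Suc k) * y / 2)"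
    and "sinh (y / 4) / sinh (real (Suc k) * y / 2) \<le> 1 / (2 * real (Suc k))"
proof -
  have "real (2 * Suc k) * sinh (y / 4) \<le> sinh (real (2 * Suc k) * (y / 4))"
    using assms by (intro sinh_mult_ge) auto
  also have "real (2 * Suc k) * (y / 4) = real (Suc k) * y / 2" by simp
  finally have 1: "2 * real (Suc k) * sinh (y / 4) \<le> sinh (real (Suc k) * y / 2)" by simp
  have 2: "sinh (real (Suc k) * y / 2) > 0" "sinh (y / 4) > 0" using assms by auto
  thus "0 < sinh (y / 4) / sinh (real (Suc k) * y / 2)" by (intro divide_pos_pos)
  show "sinh (y / 4) / sinh (real (Suc k) * y / 2) \<le> 1 / (2 * real (Suc k))"
    using 1 2 by (simp add: divide_le_eq le_divide_eq mult_ac del: of_nat_Suc)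
qed

lemma wallis_ratio_square_le:
  assumes "y > 0"
  shows "(sinh (y / 4) / sinh (real (Suc k) * y / 2))\<^sup>2 \<le> 1 / (2 * real (Suc k))\<^sup>2"
    and "1 / (2 * real (Suc k))\<^sup>2 \<le> 1 / 4"
proof -
  show "(sinh (y / 4) / sinh (real (Suc k) * y / 2))\<^sup>2 \<le> 1 / (2 * real (Suc k))\<^sup>2"
    using power_mono[OF wallis_ratio_bounds(2)[OF assms, of k] less_imp_le[OF wallis_ratio_bounds(1)[OF assms]], of 2]
    by (simp only: power_one_over)
  have "(2 * 1)\<^sup>2 \<le> (2 * real (Suc k))\<^sup>2" by (intro power_mono) auto
  hence "1 / (2 * real (Suc k))\<^sup>2 \<le> 1 / (2 * 1)\<^sup>2" by (intro divide_left_mono) auto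
  thus "1 / (2 * real (Suc k))\<^sup>2 \<le> 1 / 4" by simp
qed

lemma wallis_sums: "(\<lambda>k. - ln (1 - 1 / (2 * real (Suc k))\<^sup>2)) sums ln (pi / 2)"
proof -
  have "(\<lambda>n. ln (\<Prod>k=1..n. (4 * real k ^ 2) / (4 * real k ^ 2 - 1))) \<longlonglongrightarrow> ln (pi / 2)"
    by (intro tendsto_ln wallis) auto
  moreover have "ln (\<Prod>k=1..n. (4 * real k ^ 2) / (4 * real k ^ 2 - 1)) = (\<Sum>k<n. - ln (1 - 1 / (2 * real (Suc k))\<^sup>2))" for n
  proof -
    have pos: "4 * (real (Suc k))\<^sup>2 - 1 > 0" for k
    proof -
      have "1 \<le> (real (Suc k))\<^sup>2" by (rule one_le_power) simp
      thus ?thesis by linarith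
    qed
    have eq: "ln ((4 * (real (Suc k))\<^sup>2) / (4 * (real (Suc k))\<^sup>2 - 1)) = - ln (1 - 1 / (2 * real (Suc k))\<^sup>2)" for k
    proof -
      have "1 - 1 / (2 * real (Suc k))\<^sup>2 = inverse ((4 * (real (Suc k))\<^sup>2) / (4 * (real (Suc k))\<^sup>2 - 1))"
        by (simp add: power_mult_distrib divide_simps del: of_nat_Suc)
      moreover have "4 * (real (Suc k))\<^sup>2 / (4 * (real (Suc k))\<^sup>2 - 1) > 0"
        using pos[of k] by (intro divide_pos_pos) auto
      ultimately show ?thesis by (simp only: ln_inverse minus_minus)
    qed
    have "(\<Prod>k=1..n. (4 * real k ^ 2) / (4 * real k ^ 2 - 1)) = (\<Prod>k<n. (4 * (real (Suc k))\<^sup>2) / (4 * (real (Suc k))\<^sup>2 - 1))"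
      by (rule prod.reindex_bij_witness[of _ Suc "\<lambda>k. k - 1"]) auto
    thus ?thesis
      using pos by (simp only:) (subst ln_prod, auto simp: eq simp del: of_nat_Suc; metis less_irrefl)
  qed
  ultimately show ?thesis by (simp add: sums_def)
qed

lemma wallis_term_tendsto:
  "((\<lambda>y. \<Sum>k. wallis_term k y) \<longlongrightarrow> ln (pi / 2)) (at_right 0)"
proof -
  have "((\<lambda>y. suminf (\<lambda>k. wallis_term k y)) \<longlongrightarrow> suminf (\<lambda>k. - ln (1 - 1 / (2 * real (Suc k))\<^sup>2))) (at_right 0)"
  proof (rule tannerys_theorem[THEN conjunct2, THEN conjunct2])
    fix k
    define c where "c = real (Suc k)"
    have c: "c \<ge> 1" by (simp add: c_def)
    have l: "((\<lambda>y. sinh (y / 4) / sinh (c * y / 2)) \<longlongrightarrow> 1 / (2 * c)) (at_right 0)"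
      using c by real_asymp
    have "1 - (1 / (2 * c))\<^sup>2 > 0"
      using wallis_ratio_square_le(2)[of 1 k] unfolding c_def[symmetric] power_one_over by simp
    hence "((\<lambda>y. - ln (1 - (sinh (y / 4) / sinh (c * y / 2))\<^sup>2)) \<longlongrightarrow> - ln (1 - (1 / (2 * c))\<^sup>2)) (at_right 0)"
      by (intro tendsto_intros l) auto
    thus "((\<lambda>y. wallis_term k y) \<longlongrightarrow> - ln (1 - 1 / (2 * real (Suc k))\<^sup>2)) (at_right 0)"
      unfolding wallis_term_def c_def power_one_over .
  next
    have "norm (wallis_term k y) \<le> - ln (1 - 1 / (2 * real (Suc k))\<^sup>2)" if "y > 0" for k y
    proof -
      define s where "s = (sinh (y / 4) / sinh (real (Suc k) * y / 2))\<^sup>2"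
      have s: "0 \<le> s" "s \<le> 1 / (2 * real (Suc k))\<^sup>2" "1 / (2 * real (Suc k))\<^sup>2 \<le> 1 / 4"
        using wallis_ratio_square_le[OF that, of k] by (auto simp: s_def)
      have "ln (1 - 1 / (2 * real (Suc k))\<^sup>2) \<le> ln (1 - s)" "ln (1 - s) \<le> 0"
        using s by (simp_all only: ln_le_cancel_iff ln_le_zero_iff)
      thus ?thesis unfolding wallis_term_def s_def[symmetric] by simp
    qed
    hence "\<forall>\<^sub>F y in at_right 0. \<forall>k. norm (wallis_term k y) \<le> - ln (1 - 1 / (2 * real (Suc k))\<^sup>2)"
      by (intro eventually_mono[OF eventually_at_right_less]) auto
    thus "\<forall>\<^sub>F (k, y) in at_top \<times>\<^sub>F at_right 0. norm (wallis_term k y) \<le> - ln (1 - 1 / (2 * real (Suc k))\<^sup>2)"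
      unfolding eventually_prod_filter
      by (intro exI[of _ "\<lambda>_. True"] exI[of _ "\<lambda>y. \<forall>k. norm (wallis_term k y) \<le> - ln (1 - 1 / (2 * real (Suc k))\<^sup>2)"]) auto
  next
    show "summable (\<lambda>k. - ln (1 - 1 / (2 * real (Suc k))\<^sup>2))"
      using wallis_sums by (rule sums_summable)
  qed auto
  thus ?thesis using sums_unique[OF wallis_sums] by simp
qed

lemma one_minus_exp_sinh: "1 - exp (- x) = 2 * exp (- x / 2) * sinh (x / 2)" for x :: real
proof -
  have "2 * exp (- x / 2) * sinh (x / 2) = exp (- x / 2) * exp (x / 2) - exp (- x / 2) * exp (- x / 2)"
    by (simp add: sinh_field_def right_diff_distrib)
  also have "\<dots> = 1 - exp (- x)" by (simp add: mult_exp_exp)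
  finally show ?thesis by simp
qed

text \<open>In this second difference the exponential prefactors cancel, and \<open>sinh (A - d) *
  sinh (A + d) = (sinh A)\<^sup>2 - (sinh d)\<^sup>2\<close> does the rest.\<close>

lemma wallis_term_eq:
  assumes y: "y > 0"
  shows "- ln (1 - exp (- ((real k + 1 / 2) * y))) - ln (1 - exp (- ((real k + 3 / 2) * y)))
          + 2 * ln (1 - exp (- (real (Suc k) * y))) = wallis_term k y"
proof -
  define A d where "A = real (Suc k) * y / 2" and "d = y / 4"
  have Ad: "0 < d" "d < A" using y by (auto simp: A_def d_def)
  have s: "sinh (A - d) > 0" "sinh (A + d) > 0" "sinh A > 0" using Ad by auto
  have e1: "1 - exp (- ((real k + 1 / 2) * y)) = 2 * exp (- (A - d)) * sinh (A - d)"
  proof -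
    have "- ((real k + 1 / 2) * y) / 2 = - (A - d)" "(real k + 1 / 2) * y / 2 = A - d"
      by (simp_all add: A_def d_def field_simps)
    thus ?thesis using one_minus_exp_sinh[of "(real k + 1 / 2) * y"] by (simp only:)
  qed
  have e2: "1 - exp (- ((real k + 3 / 2) * y)) = 2 * exp (- (A + d)) * sinh (A + d)"
  proof -
    have "- ((real k + 3 / 2) * y) / 2 = - (A + d)" "(real k + 3 / 2) * y / 2 = A + d"
      by (simp_all add: A_def d_def field_simps)
    thus ?thesis using one_minus_exp_sinh[of "(real k + 3 / 2) * y"] by (simp only:)
  qed
  have e3: "1 - exp (- (real (Suc k) * y)) = 2 * exp (- A) * sinh A"
    using one_minus_exp_sinh[of "real (Suc k) * y"] unfolding A_def minus_divide_left .
  have "1 - (sinh d / sinh A)\<^sup>2 = sinh (A - d) * sinh (A + d) / (sinh A)\<^sup>2"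
  proof -
    have "sinh (A - d) * sinh (A + d) = (sinh A)\<^sup>2 * (cosh d)\<^sup>2 - (cosh A)\<^sup>2 * (sinh d)\<^sup>2"
      by (simp add: sinh_add sinh_diff power2_eq_square algebra_simps)
    also have "\<dots> = (sinh A)\<^sup>2 - (sinh d)\<^sup>2"
      by (simp add: cosh_square_eq algebra_simps)
    finally show ?thesis using s by (simp add: power_divide diff_divide_distrib)
  qed
  hence "wallis_term k y = - (ln (sinh (A - d)) + ln (sinh (A + d)) - 2 * ln (sinh A))"
    unfolding wallis_term_def A_def[symmetric] d_def[symmetric] using s
    by (simp add: ln_div ln_mult ln_realpow)
  thus ?thesis
    unfolding e1 e2 e3 using s by (simp add: ln_mult)
qed

text \<open>\<open>wsum 0 (y / 2) - wsum 0 y\<close> is the sum of \<open>l\<close> over the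
  positive half-odd integers. Counting it twice, once shifted, gives both neighbours of every
  positive integer; the unpaired \<open>l (1 / 2)\<close> carries the logarithmic
  singularity.\<close>

lemma wsum_0_duplication:
  assumes y: "y > 0"
  shows "2 * wsum 0 (y / 2) - 4 * wsum 0 y = (\<Sum>k. wallis_term k y) - ln (1 - exp (- y / 2))"
proof -
  define l where "l t = - ln (1 - exp (- (t * y)))" for t
  have s1: "(\<lambda>m. l (real (Suc m))) sums wsum 0 y"
    using wsum_0_sums[OF y] by (simp add: l_def)
  have "(\<lambda>m. l (real (Suc m) / 2)) sums wsum 0 (y / 2)"
    using wsum_0_sums[of "y / 2"] y by (simp add: l_def)
  hence "(\<lambda>n. sum (\<lambda>m. l (real (Suc m) / 2)) {n * 2..<n * 2 + 2}) sums wsum 0 (y / 2)"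
    by (rule sums_group) simp
  moreover have "sum (\<lambda>m. l (real (Suc m) / 2)) {n * 2..<n * 2 + 2} = l (real n + 1 / 2) + l (real (Suc n))" for n
  proof -
    have "{n * 2..<n * 2 + 2} = {n * 2, Suc (n * 2)}" by auto
    moreover have "real (Suc (n * 2)) / 2 = real n + 1 / 2" "real (Suc (Suc (n * 2))) / 2 = real (Suc n)"
      by (simp_all add: field_simps)
    moreover have "sum f {n * 2, Suc (n * 2)} = f (n * 2) + f (Suc (n * 2))" for f :: "nat \<Rightarrow> real"
      by simp
    ultimately show ?thesis by (simp only:)
  qed
  ultimately have "(\<lambda>n. l (real n + 1 / 2) + l (real (Suc n))) sums wsum 0 (y / 2)" by simp
  from sums_diff[OF this s1] have s2: "(\<lambda>n. l (real n + 1 / 2)) sums (wsum 0 (y / 2) - wsum 0 y)" by simp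
  hence s3: "(\<lambda>n. l (real (Suc n) + 1 / 2)) sums (wsum 0 (y / 2) - wsum 0 y - l (1 / 2))"
    by (subst sums_Suc_iff) simp
  have "(\<lambda>n. l (real n + 1 / 2) + l (real (Suc n) + 1 / 2) - 2 * l (real (Suc n))) sums
      ((wsum 0 (y / 2) - wsum 0 y) + (wsum 0 (y / 2) - wsum 0 y - l (1 / 2)) - 2 * wsum 0 y)"
    by (intro sums_add sums_diff sums_mult s1 s2 s3)
  moreover have "l (real n + 1 / 2) + l (real (Suc n) + 1 / 2) - 2 * l (real (Suc n)) = wallis_term n y" for n
    using wallis_term_eq[OF y, of n] by (simp add: l_def algebra_simps)
  ultimately have "(\<lambda>n. wallis_term n y) sums (2 * wsum 0 (y / 2) - 4 * wsum 0 y - l (1 / 2))"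
    by (simp add: algebra_simps)
  hence "(\<Sum>k. wallis_term k y) = 2 * wsum 0 (y / 2) - 4 * wsum 0 y - l (1 / 2)"
    using sums_unique by metis
  thus ?thesis by (simp add: l_def)
qed

text \<open>Write e for the error. Duplication and Wallis' product show that
  \<open>2 * e (y / 2) - 4 * e y\<close> tends to 0. The Lipschitz bound
  \<open>log_gf_error_diff\<close> shows the same for \<open>e (y / 2) - e y\<close>, and e itself
  is a linear combination of the two.\<close>

lemma log_gf_error_tendsto_0: "(log_gf_error \<longlongrightarrow> 0) (at_right 0)"
proof -
  \<comment> \<open>The weights 2 and 4 cancel the pole \<open>pi\<^sup>2 / (6 * y)\<close>.\<close>
  have main: "2 * log_gf_main (y / 2) - 4 * log_gf_main y = ln pi - ln y" if "y > 0" for y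
  proof -
    have "ln (y / 2 / (2 * pi)) = ln (y / 2) - ln (2 * pi)"
      using that by (intro ln_divide_pos) auto
    hence 1: "ln (y / 2 / (2 * pi)) = ln y - ln 2 - (ln 2 + ln pi)"
      using that by (simp add: ln_divide_pos ln_mult_pos)
    have 2: "ln (y / (2 * pi)) = ln y - (ln 2 + ln pi)"
      using that by (simp add: ln_divide_pos ln_mult_pos)
    show ?thesis unfolding log_gf_main_def 1 2 using that by (simp add: field_simps)
  qed
  have "((\<lambda>y. (\<Sum>k. wallis_term k y) + (- ln (1 - exp (- y / 2)) - ln pi + ln y)) \<longlongrightarrow> ln (pi / 2) + (ln 2 - ln pi)) (at_right 0)"
  proof (intro tendsto_add wallis_term_tendsto)
    have "((\<lambda>y::real. - ln (1 - exp (- y / 2)) + ln y) \<longlongrightarrow> - ln (1 / 2)) (at_right 0)"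
      by real_asymp
    hence "((\<lambda>y::real. - ln (1 - exp (- y / 2)) + ln y) \<longlongrightarrow> ln 2) (at_right 0)"
      by (simp add: ln_div)
    from tendsto_diff[OF this tendsto_const[of "ln pi"]]
    show "((\<lambda>y. - ln (1 - exp (- y / 2)) - ln pi + ln y) \<longlongrightarrow> ln 2 - ln pi) (at_right 0)"
      by (simp add: algebra_simps)
  qed
  hence "((\<lambda>y. (\<Sum>k. wallis_term k y) + (- ln (1 - exp (- y / 2)) - ln pi + ln y)) \<longlongrightarrow> 0) (at_right 0)"
    by (simp add: ln_div)
  moreover have "\<forall>\<^sub>F y in at_right 0. (\<Sum>k. wallis_term k y) + (- ln (1 - exp (- y / 2)) - ln pi + ln y)
      = 2 * log_gf_error (y / 2) - 4 * log_gf_error y"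
  proof (rule eventually_mono[OF eventually_at_right_less])
    fix y :: real assume "0 < y"
    thus "(\<Sum>k. wallis_term k y) + (- ln (1 - exp (- y / 2)) - ln pi + ln y) = 2 * log_gf_error (y / 2) - 4 * log_gf_error y"
      using wsum_0_duplication[of y] main[of y] by (simp add: log_gf_error_def)
  qed
  ultimately have 1: "((\<lambda>y. 2 * log_gf_error (y / 2) - 4 * log_gf_error y) \<longlongrightarrow> 0) (at_right 0)"
    by (rule Lim_transform_eventually)
  have 2: "((\<lambda>y. log_gf_error (y / 2) - log_gf_error y) \<longlongrightarrow> 0) (at_right 0)"
  proof (rule tendsto_sandwich)
    show "\<forall>\<^sub>F y in at_right 0. 0 \<le> log_gf_error (y / 2) - log_gf_error y"
      by (rule eventually_mono[OF eventually_at_right_less], rule log_gf_error_diff) auto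
    show "\<forall>\<^sub>F y in at_right 0. log_gf_error (y / 2) - log_gf_error y \<le> (y - y / 2) / 10"
      by (rule eventually_mono[OF eventually_at_right_less], rule log_gf_error_diff) auto
    show "((\<lambda>y::real. (y - y / 2) / 10) \<longlongrightarrow> 0) (at_right 0)" by real_asymp
  qed auto
  have "((\<lambda>y. (log_gf_error (y / 2) - log_gf_error y) - (2 * log_gf_error (y / 2) - 4 * log_gf_error y) / 2) \<longlongrightarrow> 0 - 0 / 2) (at_right 0)"
    by (intro tendsto_intros 1 2) auto
  thus ?thesis by (simp add: field_simps)
qed

lemma log_gf_error_bounds:
  assumes "y > 0"
  shows "- y / 10 \<le> log_gf_error y" "log_gf_error y \<le> 0"
proof -
  have ev: "\<forall>\<^sub>F a in at_right 0. 0 \<le> log_gf_error a - log_gf_error y \<and> log_gf_error a - log_gf_error y \<le> (y - a) / 10"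
    unfolding eventually_at_right_field using assms log_gf_error_diff
    by (intro exI[of _ y]) (meson less_imp_le)
  have lim: "((\<lambda>a. log_gf_error a - log_gf_error y) \<longlongrightarrow> 0 - log_gf_error y) (at_right 0)"
    by (intro tendsto_intros log_gf_error_tendsto_0)
  have "((\<lambda>a. (y - a) / 10) \<longlongrightarrow> (y - 0) / 10) (at_right 0)"
    by (intro tendsto_intros) auto
  from tendsto_le[OF _ this lim] eventually_mono[OF ev]
  have "0 - log_gf_error y \<le> (y - 0) / 10" by force
  thus "- y / 10 \<le> log_gf_error y" by simp
  from tendsto_le[OF _ lim tendsto_const[of 0]] eventually_mono[OF ev]
  have "0 \<le> 0 - log_gf_error y" by force
  thus "log_gf_error y \<le> 0" by simp
qed

section \<open>Coefficients as integrals\<close>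

lemma has_integral_cis:
  "((\<lambda>\<theta>. cis (of_int k * \<theta>)) has_integral (if k = 0 then of_real (2 * pi) else 0)) {- pi..pi}"
proof (cases "k = 0")
  case True
  thus ?thesis using has_integral_const_real[of "1::complex" "- pi" pi] by (simp add: scaleR_conv_of_real)
next
  case False
  define c where "c = \<i> * complex_of_int k"
  have c: "c \<noteq> 0" using False by (simp add: c_def)
  have cis: "cis (of_int k * \<theta>) = exp (c * of_real \<theta>)" for \<theta>
    unfolding cis_conv_exp c_def by (simp only: of_real_mult of_real_of_int_eq mult.assoc)
  have "((\<lambda>\<theta>. exp (c * of_real \<theta>)) has_integral (exp (c * of_real pi) / c - exp (c * of_real (- pi)) / c)) {- pi..pi}"
  proof (rule fundamental_theorem_of_calculus)
    fix \<theta> :: real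
    have "((\<lambda>z. exp (c * z) / c) has_field_derivative exp (c * of_real \<theta>)) (at (of_real \<theta>))"
      using c by (auto intro!: derivative_eq_intros)
    thus "((\<lambda>\<theta>. exp (c * of_real \<theta>) / c) has_vector_derivative exp (c * of_real \<theta>)) (at \<theta> within {- pi..pi})"
      by (rule has_vector_derivative_real_field)
  qed auto
  moreover have "exp (c * of_real pi) = exp (c * of_real (- pi))"
    unfolding exp_eq by (intro exI[of _ k]) (simp add: c_def algebra_simps)
  ultimately show ?thesis using False unfolding cis by simp
qed

lemma summable_frac_partition:
  assumes "0 < r" "r < 1"
  shows "summable (\<lambda>k. \<bar>frac_partition \<alpha> k\<bar> * r ^ k)"
proof -
  define x where "x = (1 + r) / 2"
  have x: "r < x" "x < 1" "x > 0" using assms by (auto simp: x_def)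
  have "summable (\<lambda>k. complex_of_real (frac_partition \<alpha> k) * of_real x ^ k)"
    by (rule sums_summable[OF frac_partition_sums]) (use x in simp)
  hence "summable (\<lambda>k. norm (complex_of_real (frac_partition \<alpha> k) * of_real r ^ k))"
    by (rule powser_insidea) (use x assms in simp)
  thus ?thesis using assms by (simp add: norm_mult norm_power)
qed

lemma frac_partition_gf_sums: 
  assumes "norm q < 1"
  shows "(\<lambda>n. complex_of_real (frac_partition \<alpha> n) * q ^ n) sums frac_partition_gf \<alpha> q"
  using frac_partition_sums[OF assms] unfolding frac_partition_gf_def .

lemma frac_partition_has_integral:
  assumes y: "y > 0"
  shows "((\<lambda>\<theta>. frac_partition_gf \<alpha> (exp (- Complex y \<theta>)) * exp (of_nat n * Complex y \<theta>)) has_integral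
           of_real (2 * pi * frac_partition \<alpha> n)) {- pi..pi}"
proof -
  define t where "t k \<theta> = complex_of_real (frac_partition \<alpha> k) * exp (- Complex y \<theta>) ^ k * exp (of_nat n * Complex y \<theta>)" for k \<theta>
  define g where "g \<theta> = frac_partition_gf \<alpha> (exp (- Complex y \<theta>)) * exp (of_nat n * Complex y \<theta>)" for \<theta>
  have q: "norm (exp (- Complex y \<theta>)) < 1" for \<theta> using y by simp
  have sums: "(\<lambda>k. t k \<theta>) sums g \<theta>" for \<theta>
    unfolding t_def g_def by (intro sums_mult2 frac_partition_gf_sums q)
  have ul: "uniform_limit {- pi..pi} (\<lambda>N \<theta>. \<Sum>k<N. t k \<theta>) (\<lambda>\<theta>. \<Sum>k. t k \<theta>) sequentially"
  proof (rule Weierstrass_m_test)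
    show "norm (t k \<theta>) \<le> \<bar>frac_partition \<alpha> k\<bar> * exp (- y) ^ k * exp (of_nat n * y)" for k \<theta>
      by (simp add: t_def norm_mult norm_power)
    show "summable (\<lambda>k. \<bar>frac_partition \<alpha> k\<bar> * exp (- y) ^ k * exp (of_nat n * y))"
      using y by (intro summable_mult2 summable_frac_partition) auto
  qed
  have t_eq: "t k \<theta> = of_real (frac_partition \<alpha> k * exp ((real n - real k) * y)) * cis (of_int (int n - int k) * \<theta>)" for k \<theta>
  proof -
    have "exp (- Complex y \<theta>) ^ k * exp (of_nat n * Complex y \<theta>) = exp ((of_nat n - of_nat k) * Complex y \<theta>)"
      unfolding exp_of_nat_mult[symmetric] exp_add[symmetric] by (simp add: algebra_simps)
    also have "(of_nat n - of_nat k) * Complex y \<theta> = Complex ((real n - real k) * y) ((real n - real k) * \<theta>)"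
      by (simp add: complex_eq_iff)
    finally show ?thesis unfolding t_def by (simp add: exp_eq_polar mult.assoc)
  qed
  have ti: "(t k has_integral (if k = n then of_real (2 * pi * frac_partition \<alpha> n) else 0)) {- pi..pi}" for k
  proof -
    have "((\<lambda>\<theta>. of_real (frac_partition \<alpha> k * exp ((real n - real k) * y)) * cis (of_int (int n - int k) * \<theta>)) has_integral
        of_real (frac_partition \<alpha> k * exp ((real n - real k) * y)) * (if int n - int k = 0 then of_real (2 * pi) else 0)) {- pi..pi}"
      by (intro has_integral_mult_right has_integral_cis)
    thus ?thesis unfolding t_eq[symmetric] by (auto split: if_splits simp: mult_ac)
  qed
  obtain I K where IK: "\<And>N. ((\<lambda>\<theta>. \<Sum>k<N. t k \<theta>) has_integral I N) {- pi..pi}"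
      "((\<lambda>\<theta>. \<Sum>k. t k \<theta>) has_integral K) {- pi..pi}" "I \<longlonglongrightarrow> K"
  proof (rule uniform_limit_integral[OF ul])
    show "continuous_on {- pi..pi} (\<lambda>\<theta>. \<Sum>k<N. t k \<theta>)" for N
      unfolding t_eq by (intro continuous_intros)
  qed auto
  have "I N = of_real (2 * pi * frac_partition \<alpha> n)" if "N \<ge> Suc n" for N
  proof -
    have "((\<lambda>\<theta>. \<Sum>k<N. t k \<theta>) has_integral (\<Sum>k<N. if k = n then of_real (2 * pi * frac_partition \<alpha> n) else 0)) {- pi..pi}"
      by (intro has_integral_sum ti) auto
    also have "(\<Sum>k<N. if k = n then complex_of_real (2 * pi * frac_partition \<alpha> n) else 0) = of_real (2 * pi * frac_partition \<alpha> n)"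
      using that by simp
    finally show ?thesis by (rule has_integral_unique[OF IK(1)])
  qed
  hence "I \<longlonglongrightarrow> of_real (2 * pi * frac_partition \<alpha> n)"
    by (intro tendsto_eventually eventually_sequentiallyI[of "Suc n"])
  hence "K = of_real (2 * pi * frac_partition \<alpha> n)" by (rule LIMSEQ_unique[OF IK(3)])
  moreover have "(\<lambda>\<theta>. \<Sum>k. t k \<theta>) = g"
    by (rule ext) (rule sums_unique[OF sums, symmetric])
  ultimately have "(g has_integral of_real (2 * pi * frac_partition \<alpha> n)) {- pi..pi}"
    using IK(2) by (simp only:)
  thus ?thesis unfolding g_def[abs_def] .
qed

section \<open>Polar form of the Cauchy integrand\<close>

definition amp :: "real \<Rightarrow> real \<Rightarrow> real \<Rightarrow> real" where
  "amp \<alpha> y \<theta> = exp (- \<alpha> * rho y \<theta>)"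

text \<open>The argument of the integrand for the coefficient of index J; \<open>amp\<close> is its
  norm relative to \<theta> = 0. J is independent of y so that three consecutive coefficients can be
  read off the same circle: changing J by 1 only adds or subtracts \<theta>.\<close>

definition phase :: "real \<Rightarrow> real \<Rightarrow> real \<Rightarrow> real \<Rightarrow> real" where
  "phase \<alpha> y J \<theta> = J * \<theta> - \<alpha> * psi y \<theta>"

lemma gf_polar:
  assumes "y > 0"
  shows "frac_partition_gf \<alpha> (exp (- Complex y \<theta>)) * exp (of_nat n * Complex y \<theta>) =
    of_real (exp (\<alpha> * wsum 0 y + real n * y)) * (of_real (amp \<alpha> y \<theta>) * cis (phase \<alpha> y (real n) \<theta>))"
proof -
  have "frac_partition_gf \<alpha> (exp (- Complex y \<theta>)) * exp (of_nat n * Complex y \<theta>) =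
        exp (of_real \<alpha> * Complex (wsum 0 y - rho y \<theta>) (- psi y \<theta>) + of_nat n * Complex y \<theta>)"
    using assms by (subst frac_partition_gf_eq_exp_csum) (auto simp: csum_Complex exp_add)
  also have "of_real \<alpha> * Complex (wsum 0 y - rho y \<theta>) (- psi y \<theta>) + of_nat n * Complex y \<theta> =
     Complex (\<alpha> * wsum 0 y + real n * y + - \<alpha> * rho y \<theta>) (phase \<alpha> y (real n) \<theta>)"
    by (simp add: complex_eq_iff phase_def algebra_simps)
  also have "exp \<dots> = of_real (exp (\<alpha> * wsum 0 y + real n * y + - \<alpha> * rho y \<theta>)) * cis (phase \<alpha> y (real n) \<theta>)"
    by (simp only: exp_eq_polar complex.sel)
  also have "exp (\<alpha> * wsum 0 y + real n * y + - \<alpha> * rho y \<theta>) = exp (\<alpha> * wsum 0 y + real n * y) * amp \<alpha> y \<theta>"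
    unfolding amp_def by (rule exp_add)
  finally show ?thesis by (simp only: of_real_mult mult.assoc)
qed

text \<open>Continuity is inherited from the holomorphic F by dividing out a constant, which avoids
  a uniformity argument for the series of \<open>rho\<close> and \<open>psi\<close>.\<close>

lemma continuous_amp_cis:
  assumes y: "y > 0"
  shows "continuous_on UNIV (\<lambda>\<theta>. of_real (amp \<alpha> y \<theta>) * cis (phase \<alpha> y (real n) \<theta>))"
proof -
  define C where "C = exp (\<alpha> * wsum 0 y + real n * y)"
  have cC: "continuous_on UNIV (\<lambda>\<theta>. Complex y \<theta>)"
    unfolding Complex_eq by (intro continuous_intros)
  have c1: "continuous_on UNIV (\<lambda>\<theta>. exp (- Complex y \<theta>))" "continuous_on UNIV (\<lambda>\<theta>. exp (of_nat n * Complex y \<theta>))"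
    by (intro continuous_intros cC)+
  have "continuous_on (ball 0 1) (frac_partition_gf \<alpha>)"
    by (rule holomorphic_on_imp_continuous_on[OF frac_partition_gf_holomorphic])
  hence "continuous_on UNIV (\<lambda>\<theta>. frac_partition_gf \<alpha> (exp (- Complex y \<theta>)))"
    by (rule continuous_on_compose2[OF _ c1(1)]) (use y in auto)
  hence "continuous_on UNIV (\<lambda>\<theta>. frac_partition_gf \<alpha> (exp (- Complex y \<theta>)) * exp (of_nat n * Complex y \<theta>))"
    by (rule continuous_on_mult[OF _ c1(2)])
  hence "continuous_on UNIV (\<lambda>\<theta>. frac_partition_gf \<alpha> (exp (- Complex y \<theta>)) * exp (of_nat n * Complex y \<theta>) / of_real C)"
    by (rule continuous_on_divide[OF _ continuous_on_const]) (simp add: C_def)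
  moreover have "frac_partition_gf \<alpha> (exp (- Complex y \<theta>)) * exp (of_nat n * Complex y \<theta>) / of_real C =
      of_real (amp \<alpha> y \<theta>) * cis (phase \<alpha> y (real n) \<theta>)" for \<theta>
    unfolding gf_polar[OF y] C_def by simp
  ultimately show ?thesis by (simp only:)
qed

lemma continuous_amp_cos:
  assumes y: "y > 0"
  shows "continuous_on UNIV (\<lambda>\<theta>. amp \<alpha> y \<theta> * cos (phase \<alpha> y (real n) \<theta>))"
  using continuous_on_Re[OF continuous_amp_cis[OF y, of \<alpha> n]] by simp

lemma continuous_amp_sin:
  assumes y: "y > 0"
  shows "continuous_on UNIV (\<lambda>\<theta>. amp \<alpha> y \<theta> * sin (phase \<alpha> y (real n) \<theta>))"
  using continuous_on_Im[OF continuous_amp_cis[OF y, of \<alpha> n]] by simp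

lemma continuous_amp:
  assumes y: "y > 0"
  shows "continuous_on UNIV (amp \<alpha> y)"
proof -
  have eq: "amp \<alpha> y = (\<lambda>\<theta>. norm (of_real (amp \<alpha> y \<theta>) * cis (phase \<alpha> y (real 0) \<theta>)))"
    by (rule ext) (simp add: norm_mult amp_def)
  show ?thesis by (subst eq) (rule continuous_on_norm[OF continuous_amp_cis[OF y]])
qed

lemma frac_partition_integral:
  assumes y: "y > 0"
  shows "((\<lambda>\<theta>. amp \<alpha> y \<theta> * cos (phase \<alpha> y (real n) \<theta>)) has_integral
           (2 * pi * frac_partition \<alpha> n / exp (\<alpha> * wsum 0 y + real n * y))) {- pi..pi}"
proof -
  define C where "C = exp (\<alpha> * wsum 0 y + real n * y)"
  have "((\<lambda>\<theta>. Re (of_real C * (of_real (amp \<alpha> y \<theta>) * cis (phase \<alpha> y (real n) \<theta>)))) has_integral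
           Re (of_real (2 * pi * frac_partition \<alpha> n))) {- pi..pi}"
    using has_integral_linear[OF frac_partition_has_integral[OF y, of \<alpha> n] bounded_linear_Re]
    unfolding gf_polar[OF y] C_def o_def .
  from has_integral_divide[OF this, of C]
  have "((\<lambda>\<theta>. C * (amp \<alpha> y \<theta> * cos (phase \<alpha> y (real n) \<theta>)) / C) has_integral (2 * pi * frac_partition \<alpha> n / C)) {- pi..pi}"
    by simp
  thus ?thesis unfolding C_def by simp
qed

section \<open>The integrand near and away from the saddle point\<close>

lemma has_bochner_integral_lborel_has_integral:
  fixes f :: "real \<Rightarrow> real"
  assumes "has_bochner_integral lborel f x"
  shows "(f has_integral x) UNIV"
proof -
  have "integrable lborel f" "integral\<^sup>L lborel f = x"
    using assms by (auto simp only: has_bochner_integral_iff)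
  thus ?thesis using has_integral_integral_real[of f] by simp
qed

lemma gaussian_moment:
  fixes a y :: real
  assumes a: "a > 0" and y: "y > 0"
  shows "((\<lambda>\<theta>. (\<theta> / y) ^ (2 * k) * exp (- a * (\<theta> / y)\<^sup>2)) has_integral
           (y * sqrt (pi / a) * (fact (2 * k) / (4 ^ k * fact k)) / a ^ k)) UNIV"
proof -
  define \<sigma> where "\<sigma> = y / sqrt (2 * a)"
  have \<sigma>: "\<sigma> > 0" using a y by (simp add: \<sigma>_def)
  have \<sigma>2: "\<sigma>\<^sup>2 = y\<^sup>2 / (2 * a)" using a by (simp add: \<sigma>_def power_divide)
  define C where "C = y * sqrt (pi / a) / y ^ (2 * k)"
  have s: "sqrt (2 * pi * \<sigma>\<^sup>2) = y * sqrt (pi / a)"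
    using a y by (simp add: \<sigma>2 real_sqrt_mult real_sqrt_divide)
  have "has_bochner_integral lborel (\<lambda>x. C * (normal_density 0 \<sigma> x * (x - 0) ^ (2 * k)))
      (C * (fact (2 * k) / ((2 / \<sigma>\<^sup>2) ^ k * fact k)))"
    by (intro has_bochner_integral_mult_right normal_moment_even \<sigma>)
  moreover have "C * (normal_density 0 \<sigma> x * (x - 0) ^ (2 * k)) = (x / y) ^ (2 * k) * exp (- a * (x / y)\<^sup>2)" for x
  proof -
    have "- (x - 0)\<^sup>2 / (2 * \<sigma>\<^sup>2) = - a * (x / y)\<^sup>2"
      using a y by (simp add: \<sigma>2 power_divide)
    thus ?thesis
      unfolding normal_density_def s C_def using a y by (simp add: power_divide)
  qed
  moreover have "C * (fact (2 * k) / ((2 / \<sigma>\<^sup>2) ^ k * fact k)) = y * sqrt (pi / a) * (fact (2 * k) / (4 ^ k * fact k)) / a ^ k"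
  proof -
    have "2 / \<sigma>\<^sup>2 = 4 * a / y\<^sup>2" using a y by (simp add: \<sigma>2 field_simps)
    hence "(2 / \<sigma>\<^sup>2) ^ k = 4 ^ k * a ^ k / y ^ (2 * k)"
      by (simp add: power_divide power_mult_distrib power_mult)
    thus ?thesis unfolding C_def using a y by (simp add: mult_ac)
  qed
  ultimately have "has_bochner_integral lborel (\<lambda>x. (x / y) ^ (2 * k) * exp (- a * (x / y)\<^sup>2))
      (y * sqrt (pi / a) * (fact (2 * k) / (4 ^ k * fact k)) / a ^ k)" by (simp only:)
  thus ?thesis by (rule has_bochner_integral_lborel_has_integral)
qed

text \<open>The large parameter is \<open>u = \<alpha> / y\<close>. All integrals below run over the angle \<open>\<theta>\<close>, but the natural
  variable is \<open>\<theta> / y\<close>, in which the integrand looks like \<open>exp (- g * (\<theta> / y)\<^sup>2)\<close>. The numerical constants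
  are tuned to the extreme case \<open>\<alpha> = 2\<close>, \<open>\<lambda> = 4096\<close>, where \<open>u\<close> is about \<open>70.6\<close>.\<close>

locale saddle =
  fixes \<alpha> y u :: real
  assumes alpha: "\<alpha> \<ge> 2" and y_pos: "y > 0" and alpha_y: "\<alpha> * y \<le> 57 / 1000"
    and u_def: "u = \<alpha> / y" and u_ge: "u \<ge> 70"
begin

text \<open>The leading Gaussian coefficient: \<open>\<alpha> * (pi\<^sup>2 / (3 * y ^ 3)) *
  \<theta>\<^sup>2 / 2 = g * (\<theta> / y)\<^sup>2\<close>. The errors \<open>1 / y\<^sup>2\<close>
  and \<open>2 / y\<^sup>2\<close> in the bounds for \<open>wsum 2\<close> become the shifts by
  \<open>\<alpha> / 2\<close> and \<alpha> below.\<close>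

definition g where "g = pi\<^sup>2 * u / 6"

lemma alpha_eq: "\<alpha> = u * y" using y_pos by (simp add: u_def)

lemma y_le: "y \<le> 57 / 2000"
proof -
  have "2 * y \<le> \<alpha> * y" using alpha y_pos by (intro mult_right_mono) auto
  thus ?thesis using alpha_y by linarith
qed

lemma y_square_le: "y\<^sup>2 \<le> 1 / 1000"
proof -
  have "y\<^sup>2 \<le> (57 / 2000)\<^sup>2" using y_le y_pos by (intro power_mono) auto
  also have "\<dots> \<le> 1 / 1000" by (simp add: power2_eq_square)
  finally show ?thesis .
qed

lemma y_power_4_le: "y ^ 4 \<le> 1 / 1000 * y\<^sup>2"
proof -
  have "y\<^sup>2 * y\<^sup>2 \<le> 1 / 1000 * y\<^sup>2" using y_square_le by (intro mult_right_mono) auto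
  thus ?thesis by (simp add: eval_nat_numeral)
qed

lemma u_pos: "u > 0" using u_ge by simp

lemma alpha_le: "\<alpha> \<le> 57 / 2000 * u"
  unfolding alpha_eq using y_le u_pos by (simp add: mult.commute)

lemma g_bounds: "16449 / 10000 * u \<le> g" "g \<le> 16450 / 10000 * u"
proof -
  have "16449 * 6 / 10000 \<le> pi\<^sup>2" "pi\<^sup>2 \<le> 16450 * 6 / 10000"
    using pi_square_bounds by linarith+
  hence "16449 * 6 / 10000 * u \<le> pi\<^sup>2 * u" "pi\<^sup>2 * u \<le> 16450 * 6 / 10000 * u"
    using u_pos by (auto intro!: mult_right_mono)
  thus "16449 / 10000 * u \<le> g" "g \<le> 16450 / 10000 * u" unfolding g_def by linarith+
qed

lemma amp_nonneg: "amp \<alpha> y \<theta> > 0" by (simp add: amp_def)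

lemma amp_ge: "exp (- (g + \<alpha> / 2) * (\<theta> / y)\<^sup>2) \<le> amp \<alpha> y \<theta>"
proof -
  have "\<alpha> * rho y \<theta> \<le> \<alpha> * (wsum 2 y * \<theta>\<^sup>2 / 2)"
    using rho_le[OF y_pos, of \<theta>] alpha by (intro mult_left_mono) auto
  also have "\<dots> \<le> \<alpha> * ((pi\<^sup>2 / (3 * y ^ 3) + 1 / y\<^sup>2) * \<theta>\<^sup>2 / 2)"
    using wsum_2_upper[OF y_pos] y_le alpha
    by (intro mult_left_mono divide_right_mono mult_right_mono) auto
  also have "\<dots> = (g + \<alpha> / 2) * (\<theta> / y)\<^sup>2"
    using y_pos unfolding g_def alpha_eq by (simp add: field_simps power2_eq_square power3_eq_cube)
  finally show ?thesis unfolding amp_def mult_minus_left exp_le_cancel_iff by linarith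
qed

lemma amp_le: "amp \<alpha> y \<theta> \<le> exp (- (g - \<alpha>) * (\<theta> / y)\<^sup>2 + 49 / 24 * u * (\<theta> / y) ^ 4)"
proof -
  have "(g - \<alpha>) * (\<theta> / y)\<^sup>2 - 49 / 24 * u * (\<theta> / y) ^ 4 =
      \<alpha> * ((pi\<^sup>2 / (3 * y ^ 3) - 2 / y\<^sup>2) * \<theta>\<^sup>2 / 2 - (49 / y ^ 5) * \<theta> ^ 4 / 24)"
    using y_pos unfolding g_def alpha_eq by (simp add: field_simps eval_nat_numeral)
  also have "\<dots> \<le> \<alpha> * (wsum 2 y * \<theta>\<^sup>2 / 2 - wsum 4 y * \<theta> ^ 4 / 24)"
    using wsum_2_lower[OF y_pos] wsum_4_upper[OF y_pos] y_le alpha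
    by (intro mult_left_mono diff_mono divide_right_mono mult_right_mono) auto
  also have "\<dots> \<le> \<alpha> * rho y \<theta>"
    using rho_ge[OF y_pos, of \<theta>] alpha by (intro mult_left_mono) auto
  finally show ?thesis unfolding amp_def mult_minus_left exp_le_cancel_iff by linarith
qed

text \<open>The choice of y removes only the leading part of the linear phase. The term
  \<open>1 / (2 * y)\<close> in \<open>wsum 1\<close> leaves a drift of about half of
  \<open>\<alpha> * \<bar>\<theta> / y\<bar>\<close>; the extra 1/100 covers the bounded errors.
  Where the Gaussian lives, \<open>\<bar>\<theta> / y\<bar>\<close> is of order
  \<open>1 / sqrt u\<close>.\<close>

lemma phase_le:
  assumes J: "J = \<alpha> * pi\<^sup>2 / (6 * y\<^sup>2) + \<alpha> / 24"
  shows "\<bar>phase \<alpha> y J \<theta>\<bar> \<le> 51 / 100 * \<alpha> * \<bar>\<theta> / y\<bar> + 2 * u * \<bar>\<theta> / y\<bar> ^ 3"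
proof -
  have "\<bar>\<alpha> * (psi y \<theta> - wsum 1 y * \<theta>)\<bar> \<le> \<alpha> * (wsum 3 y * \<bar>\<theta>\<bar> ^ 3 / 6)"
    unfolding abs_mult using psi_approx[OF y_pos, of \<theta>] alpha by (intro mult_mono) auto
  also have "\<dots> \<le> \<alpha> * ((12 / y ^ 4) * \<bar>\<theta>\<bar> ^ 3 / 6)"
    using wsum_3_upper[OF y_pos] y_le alpha
    by (intro mult_left_mono divide_right_mono mult_right_mono) auto
  also have "\<dots> = 2 * u * \<bar>\<theta> / y\<bar> ^ 3"
    using y_pos unfolding alpha_eq by (simp add: field_simps eval_nat_numeral)
  finally have 1: "\<bar>\<alpha> * (psi y \<theta> - wsum 1 y * \<theta>)\<bar> \<le> 2 * u * \<bar>\<theta> / y\<bar> ^ 3" .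
  define d where "d = pi\<^sup>2 / (6 * y\<^sup>2) - 1 / (2 * y) + 1 / 10 - wsum 1 y"
  have d: "0 \<le> d" "d \<le> 1 / 10" using wsum_1_bounds[OF y_pos] by (auto simp: d_def)
  have "J - \<alpha> * wsum 1 y = \<alpha> * (1 / (2 * y) + 1 / 24 - 1 / 10 + d)"
    unfolding J d_def by (simp add: algebra_simps)
  also have "\<bar>\<dots>\<bar> \<le> \<alpha> * (51 / 100 / y)"
  proof -
    have "1 / 24 \<le> 1 / 100 / y" "(0::real) \<le> 1 / (2 * y) - 1 / 10" using y_pos y_le by (auto simp: field_simps)
    moreover have "51 / 100 / y = 1 / (2 * y) + 1 / 100 / y" by (simp add: field_simps)
    ultimately have "\<bar>1 / (2 * y) + 1 / 24 - 1 / 10 + d\<bar> \<le> 51 / 100 / y" using d by linarith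
    thus ?thesis unfolding abs_mult using alpha by (intro mult_mono) auto
  qed
  finally have "\<bar>(J - \<alpha> * wsum 1 y) * \<theta>\<bar> \<le> \<alpha> * (51 / 100 / y) * \<bar>\<theta>\<bar>"
    unfolding abs_mult by (intro mult_right_mono) auto
  also have "\<dots> = 51 / 100 * \<alpha> * \<bar>\<theta> / y\<bar>" using y_pos by (simp add: abs_divide)
  finally have 2: "\<bar>(J - \<alpha> * wsum 1 y) * \<theta>\<bar> \<le> 51 / 100 * \<alpha> * \<bar>\<theta> / y\<bar>" .
  have "phase \<alpha> y J \<theta> = (J - \<alpha> * wsum 1 y) * \<theta> - \<alpha> * (psi y \<theta> - wsum 1 y * \<theta>)"
    unfolding phase_def by (simp add: algebra_simps)
  thus ?thesis using 1 2 by linarith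
qed

text \<open>Away from the saddle point it suffices to keep the summands with \<open>k = 1\<close> in \<open>rho\<close>.\<close>

lemma amp_le_tail:
  assumes t: "0 < t" "t \<le> \<bar>\<theta>\<bar>" "\<bar>\<theta>\<bar> \<le> pi" and c: "c * y\<^sup>2 \<le> t\<^sup>2 / 2 - t ^ 4 / 24" "c \<ge> 0"
  shows "amp \<alpha> y \<theta> \<le> exp (- (1914 / 1000 * u * (c / (1 + 2 * c))))"
proof -
  define x where "x = exp (- y)"
  define v where "v = 1 - cos \<theta>"
  have "cos \<bar>\<theta>\<bar> \<le> cos t" by (rule cos_monotone_0_pi_le) (use t in auto)
  hence "v \<ge> 1 - cos t" by (simp add: v_def)
  hence v: "v \<ge> c * y\<^sup>2" using one_minus_cos_ge[of t] c by linarith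
  have v0: "v \<ge> 0" by (simp add: v_def)
  have x: "x \<ge> 1 - y" using exp_ge_add_one_self[of "-y"] by (simp add: x_def)
  have "(1 - y) * (1 + (1 - y)) \<le> x * (1 + x)"
    using x y_le y_pos by (intro mult_mono) auto
  moreover have "(1 - y) * (1 + (1 - y)) = 2 - 3 * y + y * y" by (simp add: algebra_simps)
  \<comment> \<open>\<open>2 - 3 * y\<close> at the largest admissible \<open>y = 57 / 2000\<close>
    equals 1.9145.\<close>
  ultimately have xx: "1914 / 1000 \<le> x * (1 + x)" using y_le zero_le_square[of y] by linarith
  have "c / (1 + 2 * c) \<le> v / (y\<^sup>2 + 2 * v)"
  proof -
    have "c * (y\<^sup>2 + 2 * v) \<le> v * (1 + 2 * c)" using v by (simp add: algebra_simps)
    moreover have "y\<^sup>2 + 2 * v > 0" using y_pos v0 by (intro add_pos_nonneg) auto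
    ultimately show ?thesis using c by (simp add: divide_le_eq le_divide_eq mult.commute)
  qed
  hence "1914 / 1000 * u * (c / (1 + 2 * c)) \<le> (x * (1 + x) * u) * (v / (y\<^sup>2 + 2 * v))"
    using xx u_pos c by (intro mult_mono) auto
  also have "\<dots> = \<alpha> * (x * (1 + x) * v / (y * (y\<^sup>2 + 2 * v)))"
    using y_pos by (simp add: u_def)
  also have "\<dots> \<le> \<alpha> * rho y \<theta>"
    using rho_ge_geometric[OF y_pos, of \<theta>] alpha unfolding x_def v_def by (intro mult_left_mono) auto
  finally show ?thesis by (simp add: amp_def)
qed

lemma amp_le_middle:
  assumes "1 / 2 * y \<le> \<bar>\<theta>\<bar>" "\<bar>\<theta>\<bar> \<le> pi"
  shows "amp \<alpha> y \<theta> \<le> exp (- (19 / 100 * u))"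
proof -
  have "(1 / 2 * y)\<^sup>2 / 2 - (1 / 2 * y) ^ 4 / 24 = y\<^sup>2 / 8 - y ^ 4 / 384"
    by (simp add: power_mult_distrib power_divide)
  hence "1249 / 10000 * y\<^sup>2 \<le> (1 / 2 * y)\<^sup>2 / 2 - (1 / 2 * y) ^ 4 / 24"
    using y_power_4_le zero_le_power2[of y] by linarith
  from amp_le_tail[OF _ assms this] y_pos
  have "amp \<alpha> y \<theta> \<le> exp (- (1914 / 1000 * u * (1249 / 10000 / (1 + 2 * (1249 / 10000)))))" by simp
  also have "\<dots> \<le> exp (- (19 / 100 * u))" using u_pos by simp
  finally show ?thesis .
qed

text \<open>A second, stronger level of decay: beyond \<open>2 * y\<close> the range of integration
  has length of order 1 instead of y, and the weights grow up to powers of \<open>pi / y\<close>.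
  Since \<open>1 / y \<le> u / 2\<close>, all of this is polynomial in u.\<close>

lemma amp_le_far:
  assumes "2 * y \<le> \<bar>\<theta>\<bar>" "\<bar>\<theta>\<bar> \<le> pi"
  shows "amp \<alpha> y \<theta> \<le> exp (- (3 / 4 * u))"
proof -
  have "(2 * y)\<^sup>2 / 2 - (2 * y) ^ 4 / 24 = 2 * y\<^sup>2 - 2 / 3 * y ^ 4"
    by (simp add: power_mult_distrib)
  hence "199 / 100 * y\<^sup>2 \<le> (2 * y)\<^sup>2 / 2 - (2 * y) ^ 4 / 24"
    using y_power_4_le zero_le_power2[of y] by linarith
  from amp_le_tail[OF _ assms this] y_pos
  have "amp \<alpha> y \<theta> \<le> exp (- (1914 / 1000 * u * (199 / 100 / (1 + 2 * (199 / 100)))))" by simp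
  also have "\<dots> \<le> exp (- (3 / 4 * u))" using u_pos by simp
  finally show ?thesis .
qed

text \<open>Up to 2/5 the quartic term costs at most \<open>49 / 24 * (4 / 25) * u\<close>, which
  leaves the exponent 128/100. Used alone, that weaker Gaussian would lose a factor of about 1.13;
  the second bound keeps the sharp Gaussian as main term and charges the weak one only to the
  quartic correction, by \<open>exp b \<le> 1 + b * exp b\<close>.\<close>

lemma amp_le_near:
  assumes "\<bar>\<theta> / y\<bar> \<le> 2 / 5"
  shows "amp \<alpha> y \<theta> \<le> exp (- (128 / 100 * u) * (\<theta> / y)\<^sup>2)"
    and "amp \<alpha> y \<theta> \<le> exp (- (g - \<alpha>) * (\<theta> / y)\<^sup>2) +
           49 / 24 * u * ((\<theta> / y) ^ 4 * exp (- (128 / 100 * u) * (\<theta> / y)\<^sup>2))"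
proof -
  define t where "t = (\<theta> / y)\<^sup>2"
  have "t \<le> (2 / 5)\<^sup>2" unfolding t_def using power_mono[OF assms, of 2] by (simp only: power2_abs abs_ge_zero)
  hence t: "0 \<le> t" "t \<le> 4 / 25" by (auto simp: t_def power2_eq_square)
  have t2: "(\<theta> / y) ^ 4 = t * t" by (simp add: t_def eval_nat_numeral)
  have "49 / 24 * u * t \<le> 49 / 24 * u * (4 / 25)" using t u_pos by (intro mult_left_mono) auto
  hence "(128 / 100 * u) \<le> (g - \<alpha>) - 49 / 24 * u * t"
    using g_bounds alpha_le by linarith
  hence "(128 / 100 * u) * t \<le> ((g - \<alpha>) - 49 / 24 * u * t) * t"
    using t by (intro mult_right_mono) auto
  hence key: "- (g - \<alpha>) * t + 49 / 24 * u * (t * t) \<le> - (128 / 100 * u) * t"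
    by (simp add: algebra_simps)
  have a: "amp \<alpha> y \<theta> \<le> exp (- (g - \<alpha>) * t + 49 / 24 * u * (t * t))"
    using amp_le[of \<theta>] unfolding t2 t_def .
  also have "\<dots> \<le> exp (- (128 / 100 * u) * t)" using key by simp
  finally show "amp \<alpha> y \<theta> \<le> exp (- (128 / 100 * u) * (\<theta> / y)\<^sup>2)" unfolding t_def .
  define b where "b = 49 / 24 * u * (t * t)"
  define A where "A = - (g - \<alpha>) * t"
  have "1 - b \<le> exp (- b)" using exp_ge_add_one_self[of "-b"] by simp
  hence "(1 - b) * exp b \<le> exp (- b) * exp b" by (intro mult_right_mono) auto
  hence "exp b \<le> 1 + b * exp b" by (simp add: algebra_simps exp_minus)
  hence "exp A * exp b \<le> exp A * (1 + b * exp b)" by (intro mult_left_mono) auto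
  also have "\<dots> = exp A + b * exp (A + b)" by (simp add: algebra_simps exp_add)
  also have "\<dots> \<le> exp A + b * exp (- (128 / 100 * u) * t)"
    using key u_pos t unfolding A_def b_def by (intro add_left_mono mult_left_mono) auto
  finally have "exp (A + b) \<le> exp A + b * exp (- (128 / 100 * u) * t)" by (simp add: exp_add)
  thus "amp \<alpha> y \<theta> \<le> exp (- (g - \<alpha>) * (\<theta> / y)\<^sup>2) +
           49 / 24 * u * ((\<theta> / y) ^ 4 * exp (- (128 / 100 * u) * (\<theta> / y)\<^sup>2))"
    using a unfolding A_def b_def t2 t_def[symmetric] by (simp only: mult.assoc)
qed

text \<open>Between 2/5 and 1/2 the bound of \<open>amp_le_tail\<close> has not yet reached 19/100,
  and the quartic bound \<open>amp_le\<close> fills the gap.\<close>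

lemma amp_le_inner_middle:
  assumes "2 / 5 \<le> \<bar>\<theta> / y\<bar>" "\<bar>\<theta>\<bar> \<le> pi"
  shows "amp \<alpha> y \<theta> \<le> exp (- (19 / 100 * u))"
proof (cases "1 / 2 * y \<le> \<bar>\<theta>\<bar>")
  case True
  thus ?thesis using assms(2) by (rule amp_le_middle)
next
  case False
  define t where "t = (\<theta> / y)\<^sup>2"
  have "\<bar>\<theta> / y\<bar> \<le> 1 / 2" using False y_pos by (simp add: abs_divide field_simps)
  hence "t \<le> (1 / 2)\<^sup>2" "(2 / 5)\<^sup>2 \<le> t"
    unfolding t_def using power_mono[of "\<bar>\<theta> / y\<bar>" "1 / 2" 2] power_mono[OF assms(1), of 2]
    by (simp_all only: power2_abs abs_ge_zero)
  hence t: "4 / 25 \<le> t" "t \<le> 1 / 4" by (auto simp: power2_eq_square)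
  \<comment> \<open>The chord of t^2 over this interval makes the exponent linear in t.\<close>
  have "0 \<le> (t - 4 / 25) * (1 / 4 - t)" using t by (intro mult_nonneg_nonneg) auto
  moreover have "(t - 4 / 25) * (1 / 4 - t) = 41 / 100 * t - 1 / 25 - t * t" by (simp add: field_simps)
  ultimately have "t * t \<le> 41 / 100 * t - 1 / 25" by linarith
  hence "u * (t * t) \<le> u * (41 / 100 * t - 1 / 25)" using u_pos by (intro mult_left_mono) auto
  moreover have "u * (41 / 100 * t - 1 / 25) = 41 / 100 * (u * t) - 1 / 25 * u" by (simp add: algebra_simps)
  moreover have "(16164 / 10000 * u) * t \<le> (g - \<alpha>) * t"
    using g_bounds alpha_le t by (intro mult_right_mono) linarith+
  moreover have "49 / 24 * u * (t * t) = 49 / 24 * (u * (t * t))" "(16164 / 10000 * u) * t = 16164 / 10000 * (u * t)"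
    by simp_all
  moreover have "u * (4 / 25) \<le> u * t" using t u_pos by (intro mult_left_mono) auto
  ultimately have "19 / 100 * u \<le> (g - \<alpha>) * t - 49 / 24 * u * (t * t)"
    using u_pos by linarith
  moreover have "(\<theta> / y) ^ 4 = t * t" by (simp add: t_def eval_nat_numeral)
  ultimately show ?thesis
  proof -
    have "amp \<alpha> y \<theta> \<le> exp (- (g - \<alpha>) * t + 49 / 24 * u * (t * t))"
      using amp_le[of \<theta>] unfolding \<open>(\<theta> / y) ^ 4 = t * t\<close> t_def[symmetric] .
    also have "- (g - \<alpha>) * t + 49 / 24 * u * (t * t) \<le> - (19 / 100 * u)"
      using \<open>19 / 100 * u \<le> (g - \<alpha>) * t - 49 / 24 * u * (t * t)\<close> unfolding mult_minus_left by linarith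
    finally show ?thesis by simp
  qed
qed

end

section \<open>Gaussian envelopes\<close>

text \<open>Reduction to u = 70, where the exponent is 133/10 and the claim reads 490000 = 100 *
  70^2 \<le> exp (133/10). For larger u the exponential outgrows the square, by
  \<open>w \<le> exp (w - 1)\<close> with \<open>w = u / 70\<close>.\<close>

lemma exp_minus_le_inverse_square:
  fixes u :: real
  assumes "u \<ge> 70"
  shows "exp (- (19 / 100 * u)) \<le> 1 / 100 / u\<^sup>2"
proof -
  have "490000 \<le> (27 / 10 :: real) ^ 13 * (13 / 10)" by (simp add: eval_nat_numeral)
  also have "\<dots> \<le> exp 1 ^ 13 * exp (3 / 10)"
  proof (intro mult_mono power_mono)
    show "(27 / 10 :: real) \<le> exp 1" using exp_ge_Taylor[of 1 6] by (simp add: lessThan_nat_numeral fact_numeral)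
    show "(13 / 10 :: real) \<le> exp (3 / 10)" using exp_ge_add_one_self[of "3 / 10 :: real"] by simp
  qed auto
  also have "\<dots> = exp (133 / 10)"
    unfolding exp_of_nat_mult[symmetric] exp_add[symmetric] by simp
  finally have 1: "490000 \<le> exp (133 / 10 :: real)" .
  define w where "w = u / 70"
  have w: "w \<ge> 1" using assms by (simp add: w_def)
  have "w \<le> exp (w - 1)" using exp_ge_add_one_self[of "w - 1"] by simp
  also have "\<dots> \<le> exp (133 / 20 * (w - 1))" using w by simp
  finally have "w\<^sup>2 \<le> (exp (133 / 20 * (w - 1)))\<^sup>2" using w by (intro power_mono) auto
  also have "\<dots> = exp (133 / 10 * (w - 1))" unfolding exp_double[symmetric] by simp
  finally have "490000 * w\<^sup>2 \<le> exp (133 / 10) * exp (133 / 10 * (w - 1))"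
    using 1 by (intro mult_mono) auto
  also have "\<dots> = exp (19 / 100 * u)" unfolding exp_add[symmetric] w_def by (simp add: field_simps)
  also have "490000 * w\<^sup>2 = 100 * u\<^sup>2" by (simp add: w_def power_divide)
  finally show ?thesis using assms by (simp add: exp_minus field_simps)
qed

context saddle
begin

definition gm :: "nat \<Rightarrow> real \<Rightarrow> real" where
  "gm k a = integral {- pi..pi} (\<lambda>\<theta>. (\<theta> / y) ^ (2 * k) * exp (- a * (\<theta> / y)\<^sup>2))"

lemma gm_has_integral:
  "((\<lambda>\<theta>. (\<theta> / y) ^ (2 * k) * exp (- a * (\<theta> / y)\<^sup>2)) has_integral gm k a) {- pi..pi}"
  unfolding gm_def
  by (intro integrable_integral integrable_continuous_interval continuous_intros) (use y_pos in auto)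

lemma gm_nonneg: "gm k a \<ge> 0"
  by (rule has_integral_nonneg[OF gm_has_integral]) (simp add: power_mult)

lemma gm_le:
  assumes "a > 0"
  shows "gm k a \<le> y * sqrt (pi / a) * (fact (2 * k) / (4 ^ k * fact k)) / a ^ k"
  by (rule has_integral_subset_le[OF _ gm_has_integral gaussian_moment[OF assms y_pos]]) (auto simp: power_mult)

text \<open>Outside the interval \<open>(\<theta> / pi)\<^sup>2 \<ge> 1\<close>, so subtracting that
  multiple of the integrand makes it nonpositive there. Cutting the Gaussian off thus costs at most
  \<open>(y / pi)\<^sup>2\<close> times the next full moment.\<close>

lemma gm_ge:
  assumes "a > 0"
  shows "y * sqrt (pi / a) * (fact (2 * k) / (4 ^ k * fact k)) / a ^ k -
         (y / pi)\<^sup>2 * (y * sqrt (pi / a) * (fact (2 * Suc k) / (4 ^ Suc k * fact (Suc k))) / a ^ Suc k) \<le> gm k a"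
proof (rule has_integral_le)
  show "((\<lambda>\<theta>. (\<theta> / y) ^ (2 * k) * exp (- a * (\<theta> / y)\<^sup>2) - (y / pi)\<^sup>2 * ((\<theta> / y) ^ (2 * Suc k) * exp (- a * (\<theta> / y)\<^sup>2)))
     has_integral (y * sqrt (pi / a) * (fact (2 * k) / (4 ^ k * fact k)) / a ^ k -
         (y / pi)\<^sup>2 * (y * sqrt (pi / a) * (fact (2 * Suc k) / (4 ^ Suc k * fact (Suc k))) / a ^ Suc k))) UNIV"
    by (intro has_integral_diff has_integral_mult_right gaussian_moment assms y_pos)
  show "((\<lambda>\<theta>. if \<theta> \<in> {- pi..pi} then (\<theta> / y) ^ (2 * k) * exp (- a * (\<theta> / y)\<^sup>2) else 0) has_integral gm k a) UNIV"
    unfolding has_integral_restrict_UNIV by (rule gm_has_integral)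
  fix \<theta> :: real
  define E where "E = (\<theta> / y) ^ (2 * k) * exp (- a * (\<theta> / y)\<^sup>2)"
  have E: "E \<ge> 0" by (simp add: E_def power_mult)
  have "(y / pi)\<^sup>2 * ((\<theta> / y) ^ (2 * Suc k) * exp (- a * (\<theta> / y)\<^sup>2)) = (\<theta> / pi)\<^sup>2 * E"
    using y_pos by (simp add: E_def power_divide power2_eq_square)
  moreover have "E \<le> (\<theta> / pi)\<^sup>2 * E" if "\<theta> \<notin> {- pi..pi}"
  proof -
    have "1 \<le> \<bar>\<theta> / pi\<bar>" using that by (auto simp: abs_if field_simps)
    hence "1 \<le> \<bar>\<theta> / pi\<bar>\<^sup>2" by (rule one_le_power)
    hence "1 * E \<le> (\<theta> / pi)\<^sup>2 * E" using E by (intro mult_right_mono) (simp_all only: power2_abs)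
    thus ?thesis by simp
  qed
  moreover have "0 \<le> (\<theta> / pi)\<^sup>2 * E" using E by simp
  ultimately show "(\<theta> / y) ^ (2 * k) * exp (- a * (\<theta> / y)\<^sup>2) - (y / pi)\<^sup>2 * ((\<theta> / y) ^ (2 * Suc k) * exp (- a * (\<theta> / y)\<^sup>2))
      \<le> (if \<theta> \<in> {- pi..pi} then (\<theta> / y) ^ (2 * k) * exp (- a * (\<theta> / y)\<^sup>2) else 0)"
    unfolding E_def[symmetric] by auto
qed

section \<open>Tails of the integrals\<close>

definition tau2 where "tau2 = exp (- (19 / 100 * u))"
definition tau3 where "tau3 = exp (- (3 / 4 * u))"
text \<open>Confines the weaker level \<open>tau2\<close> to
  \<open>\<bar>\<theta>\<bar> \<le> 2 * y\<close>, so that its integral carries the factor y of the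
  main term.\<close>

definition window :: "real \<Rightarrow> real" where "window \<theta> = (if \<theta> \<in> {- (2 * y)..2 * y} then 1 else 0)"

lemma two_y_le_pi: "2 * y \<le> pi" using y_le pi_gt3 by linarith

lemma window_has_integral: "(window has_integral 4 * y) {- pi..pi}"
proof -
  have "((\<lambda>\<theta>. 1::real) has_integral (4 * y)) {- (2 * y)..2 * y}"
    using has_integral_const_real[of "1::real" "- (2 * y)" "2 * y"] y_pos by simp
  thus ?thesis unfolding window_def[abs_def]
    by (subst has_integral_restrict) (use two_y_le_pi in auto)
qed

lemma window_nonneg: "window \<theta> \<ge> 0" by (simp add: window_def)

lemma tau_nonneg: "tau2 \<ge> 0" "tau3 \<ge> 0" by (simp_all add: tau2_def tau3_def)

lemma amp_power_le_outer:
  assumes "\<theta> \<in> {- pi..pi}" "\<bar>\<theta> / y\<bar> \<ge> 2 / 5"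
  shows "amp \<alpha> y \<theta> * \<bar>\<theta> / y\<bar> ^ i \<le> 2 ^ i * tau2 * window \<theta> + (pi / y) ^ i * tau3"
proof (cases "\<bar>\<theta> / y\<bar> \<le> 2")
  case True
  hence "\<bar>\<theta>\<bar> \<le> 2 * y" using y_pos by (simp add: abs_divide field_simps)
  hence i: "window \<theta> = 1" by (auto simp: window_def)
  have "amp \<alpha> y \<theta> * \<bar>\<theta> / y\<bar> ^ i \<le> tau2 * 2 ^ i"
    using amp_le_inner_middle[OF assms(2)] assms(1) True unfolding tau2_def
    by (intro mult_mono power_mono) auto
  moreover have "0 \<le> (pi / y) ^ i * tau3" using y_pos tau_nonneg by simp
  ultimately show ?thesis unfolding i by (simp add: mult.commute)
next
  case False
  hence "2 * y \<le> \<bar>\<theta>\<bar>" using y_pos by (simp add: abs_divide field_simps)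
  moreover have "\<bar>\<theta>\<bar> \<le> pi" using assms(1) by auto
  ultimately have "amp \<alpha> y \<theta> \<le> tau3" unfolding tau3_def by (rule amp_le_far)
  moreover have "\<bar>\<theta> / y\<bar> \<le> pi / y"
    using \<open>\<bar>\<theta>\<bar> \<le> pi\<close> y_pos by (simp add: abs_divide divide_right_mono)
  ultimately have "amp \<alpha> y \<theta> * \<bar>\<theta> / y\<bar> ^ i \<le> tau3 * (pi / y) ^ i"
    by (intro mult_mono power_mono) (auto simp: tau_nonneg)
  moreover have "0 \<le> 2 ^ i * tau2 * window \<theta>" using tau_nonneg window_nonneg by simp
  ultimately show ?thesis by (simp add: mult.commute)
qed

abbreviation c3 where "c3 \<equiv> 128 / 100 * u"

lemma amp_power_le:
  assumes "\<theta> \<in> {- pi..pi}"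
  shows "amp \<alpha> y \<theta> * (\<theta> / y) ^ (2 * i) \<le>
     (\<theta> / y) ^ (2 * i) * exp (- (g - \<alpha>) * (\<theta> / y)\<^sup>2) +
     49 / 24 * u * ((\<theta> / y) ^ (2 * (i + 2)) * exp (- c3 * (\<theta> / y)\<^sup>2)) +
     (2 ^ (2 * i) * tau2 * window \<theta> + (pi / y) ^ (2 * i) * tau3)"
proof (cases "\<bar>\<theta> / y\<bar> \<le> 2 / 5")
  case True
  have "amp \<alpha> y \<theta> * (\<theta> / y) ^ (2 * i) \<le> (exp (- (g - \<alpha>) * (\<theta> / y)\<^sup>2) +
           49 / 24 * u * ((\<theta> / y) ^ 4 * exp (- c3 * (\<theta> / y)\<^sup>2))) * (\<theta> / y) ^ (2 * i)"
    using amp_le_near(2)[OF True] by (intro mult_right_mono) (auto simp: power_mult)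
  also have "\<dots> = (\<theta> / y) ^ (2 * i) * exp (- (g - \<alpha>) * (\<theta> / y)\<^sup>2) +
     49 / 24 * u * ((\<theta> / y) ^ (2 * (i + 2)) * exp (- c3 * (\<theta> / y)\<^sup>2))"
  proof -
    have "2 * (i + 2) = 2 * i + 4" by simp
    hence 1: "(\<theta> / y) ^ (2 * (i + 2)) = (\<theta> / y) ^ (2 * i) * (\<theta> / y) ^ 4"
      by (simp only: power_add)
    have "(A + c * (q * B)) * p = p * A + c * ((p * q) * B)" for A B c p q :: real
      by (simp add: algebra_simps)
    thus ?thesis unfolding 1 .
  qed
  moreover have "0 \<le> 2 ^ (2 * i) * tau2 * window \<theta> + (pi / y) ^ (2 * i) * tau3"
    using tau_nonneg window_nonneg y_pos by simp
  ultimately show ?thesis by linarith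
next
  case False
  hence "amp \<alpha> y \<theta> * \<bar>\<theta> / y\<bar> ^ (2 * i) \<le> 2 ^ (2 * i) * tau2 * window \<theta> + (pi / y) ^ (2 * i) * tau3"
    using assms by (intro amp_power_le_outer) auto
  moreover have "\<bar>\<theta> / y\<bar> ^ (2 * i) = (\<theta> / y) ^ (2 * i)" by (rule power_even_abs) simp
  moreover have "0 \<le> (\<theta> / y) ^ (2 * i) * exp (- (g - \<alpha>) * (\<theta> / y)\<^sup>2)" by (simp add: power_mult)
  moreover have "0 \<le> 49 / 24 * u * ((\<theta> / y) ^ (2 * (i + 2)) * exp (- c3 * (\<theta> / y)\<^sup>2))"
    using u_pos zero_le_power[of "(\<theta> / y)\<^sup>2" "i + 2"] unfolding power_mult by (intro mult_nonneg_nonneg) auto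
  ultimately show ?thesis unfolding \<open>\<bar>\<theta> / y\<bar> ^ (2 * i) = (\<theta> / y) ^ (2 * i)\<close> by linarith
qed

definition tail where "tail i = 2 ^ i * tau2 * (4 * y) + (pi / y) ^ i * tau3 * (2 * pi)"

lemma const_has_integral: "((\<lambda>\<theta>. c) has_integral c * (2 * pi)) {- pi..pi}" for c :: real
  using has_integral_const_real[of c "- pi" pi] by (simp add: mult.commute)

lemma tail_has_integral:
  "((\<lambda>\<theta>. 2 ^ i * tau2 * window \<theta> + (pi / y) ^ i * tau3) has_integral tail i) {- pi..pi}"
  unfolding tail_def by (intro has_integral_add has_integral_mult_right window_has_integral const_has_integral)

lemma amp_integrable: "(\<lambda>\<theta>. amp \<alpha> y \<theta> * (\<theta> / y) ^ i) integrable_on {- pi..pi}"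
  by (intro integrable_continuous_interval continuous_on_mult continuous_on_subset[OF continuous_amp[OF y_pos]] continuous_intros)
     (use y_pos in auto)

lemma integral_amp_power_le:
  "integral {- pi..pi} (\<lambda>\<theta>. amp \<alpha> y \<theta> * (\<theta> / y) ^ (2 * i)) \<le>
     gm i (g - \<alpha>) + 49 / 24 * u * gm (i + 2) c3 + tail (2 * i)"
  by (rule has_integral_le[OF integrable_integral[OF amp_integrable]
        has_integral_add[OF has_integral_add[OF gm_has_integral has_integral_mult_right[OF gm_has_integral]] tail_has_integral]])
     (rule amp_power_le)

definition m where "m = sqrt (pi / g)"

lemma g_pos: "g > 0" using g_bounds u_pos by linarith

lemma m_pos: "m > 0" using g_pos by (simp add: m_def)

lemma sqrt_pi_le:
  assumes "a > 0" "g \<le> r\<^sup>2 * a" "r \<ge> 0"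
  shows "sqrt (pi / a) \<le> r * m"
proof -
  have "pi / a \<le> r\<^sup>2 * (pi / g)"
    using assms g_pos by (simp add: field_simps)
  hence "sqrt (pi / a) \<le> sqrt (r\<^sup>2 * (pi / g))" by (rule real_sqrt_le_mono)
  also have "\<dots> = r * m" unfolding m_def using assms by (simp only: real_sqrt_mult real_sqrt_abs abs_of_nonneg)
  finally show ?thesis .
qed

lemma sqrt_pi_ge:
  assumes "a > 0" "r\<^sup>2 * a \<le> g" "r \<ge> 0"
  shows "r * m \<le> sqrt (pi / a)"
proof -
  have "r\<^sup>2 * (pi / g) \<le> pi / a"
    using assms g_pos by (simp add: field_simps)
  hence le: "sqrt (r\<^sup>2 * (pi / g)) \<le> sqrt (pi / a)" by (rule real_sqrt_le_mono)
  have "r * m = sqrt (r\<^sup>2 * (pi / g))"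
    unfolding m_def using assms by (simp only: real_sqrt_mult real_sqrt_abs abs_of_nonneg)
  also note le
  finally show ?thesis .
qed

text \<open>m is of order \<open>1 / sqrt u\<close>. The bound trades one factor
  \<open>1 / u\<close> of the tails for m, so that they are measured in the unit of the main
  term.\<close>

lemma inverse_u_le: "1 / u \<le> m / 11"
proof -
  have "(11 / u)\<^sup>2 \<le> pi / g"
  proof -
    have "g * 121 \<le> 3 * (u * 70)" using g_bounds u_pos by linarith
    also have "\<dots> \<le> pi * (u * u)" using pi_gt3 u_pos u_ge by (intro mult_mono) auto
    finally show ?thesis using g_pos u_pos by (simp add: power_divide power2_eq_square field_simps)
  qed
  hence "11 / u \<le> m" unfolding m_def using u_pos by (intro real_le_rsqrt) auto
  thus ?thesis by simp
qed

lemma tau3_le: "tau3 \<le> 1 / 1000000 / u ^ 6"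
proof -
  have "tau3 \<le> tau2 ^ 3"
    unfolding tau3_def tau2_def exp_of_nat_mult[symmetric] using u_pos by simp
  also have "\<dots> \<le> (1 / 100 / u\<^sup>2) ^ 3"
    using exp_minus_le_inverse_square[OF u_ge] unfolding tau2_def by (intro power_mono) auto
  also have "\<dots> = 1 / 1000000 / u ^ 6" by (simp add: power_divide eval_nat_numeral)
  finally show ?thesis .
qed

lemma inverse_y_le: "1 / y \<le> u / 2"
proof -
  have "1 / y \<le> (\<alpha> / 2) / y" using alpha y_pos by (intro divide_right_mono) auto
  thus ?thesis by (simp add: u_def)
qed

lemma tail_le:
  assumes "i \<le> 2"
  shows "tail i \<le> y * (2 ^ i * (41 / 1000)) * (m / 11) / u"
proof -
  have "pi * (1 / y) \<le> 4 * (u / 2)"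
    using inverse_y_le pi_less_4 y_pos u_pos by (intro mult_mono) auto
  hence "pi / y \<le> 2 * u" by simp
  moreover have "0 \<le> pi / y" using y_pos by simp
  \<comment> \<open>The additional power pays for the factor y that is missing in the length
    \<open>2 * pi\<close> of the far range.\<close>
  ultimately have "(pi / y) ^ Suc i \<le> (2 * u) ^ Suc i" by (intro power_mono)
  hence "(pi / y) ^ Suc i * tau3 \<le> (2 * u) ^ Suc i * (1 / 1000000 / u ^ 6)"
    using tau3_le u_pos tau_nonneg by (intro mult_mono) auto
  also have "\<dots> = 2 ^ i * (1 / 500000) * (u ^ Suc i / u ^ 6)"
    by (simp add: power_mult_distrib)
  also have "\<dots> \<le> 2 ^ i * (1 / 500000) * (1 / u\<^sup>2)"
  proof (intro mult_left_mono)
    have "u ^ Suc i * u\<^sup>2 = u ^ (i + 3)" by (simp add: power_add eval_nat_numeral)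
    also have "\<dots> \<le> u ^ 6" using u_ge assms by (intro power_increasing) auto
    finally show "u ^ Suc i / u ^ 6 \<le> 1 / u\<^sup>2" using u_pos by (simp add: field_simps)
  qed auto
  finally have 1: "(pi / y) ^ Suc i * tau3 \<le> 2 ^ i * (1 / 500000) * (1 / u\<^sup>2)" .
  have 2: "tau2 \<le> 1 / 100 * (1 / u\<^sup>2)" using exp_minus_le_inverse_square[OF u_ge] by (simp add: tau2_def)
  have "tail i = y * (2 ^ i * 4 * tau2 + 2 * ((pi / y) ^ Suc i * tau3))"
    using y_pos unfolding tail_def by (simp add: field_simps)
  also have "\<dots> \<le> y * (2 ^ i * 4 * (1 / 100 * (1 / u\<^sup>2)) + 2 * (2 ^ i * (1 / 500000) * (1 / u\<^sup>2)))"
    using 1 2 y_pos by (intro mult_left_mono add_mono) auto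
  also have "\<dots> = y * (2 ^ i * (40004 / 1000000)) * (1 / u) / u"
    by (simp add: power2_eq_square algebra_simps)
  also have "\<dots> \<le> y * (2 ^ i * (41 / 1000)) * (m / 11) / u"
    using y_pos u_pos inverse_u_le by (intro divide_right_mono mult_mono) auto
  finally show ?thesis .
qed

end

section \<open>The three integrals at the saddle point\<close>

locale saddle_point = saddle +
  fixes n :: nat
  assumes n_eq: "real n = \<alpha> * pi\<^sup>2 / (6 * y\<^sup>2) + \<alpha> / 24"
begin

text \<open>Up to a common factor, \<open>p n\<close>, \<open>p (n + 1)\<close> and \<open>p (n - 1)\<close> are \<open>ca\<close>, \<open>exp y * (cb - sg)\<close> and
  \<open>exp (- y) * (cb + sg)\<close>, so that \<open>p n ^ 2 - p (n - 1) * p (n + 1)\<close> becomes \<open>(ca - cb) * (ca + cb) + sg\<^sup>2\<close>,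
  where \<open>ca - cb\<close> is an integral against \<open>1 - cos \<theta>\<close>.\<close>

definition ca where "ca = integral {- pi..pi} (\<lambda>\<theta>. amp \<alpha> y \<theta> * cos (phase \<alpha> y (real n) \<theta>))"
definition cb where "cb = integral {- pi..pi} (\<lambda>\<theta>. amp \<alpha> y \<theta> * cos (phase \<alpha> y (real n) \<theta>) * cos \<theta>)"
definition sg where "sg = integral {- pi..pi} (\<lambda>\<theta>. amp \<alpha> y \<theta> * sin (phase \<alpha> y (real n) \<theta>) * sin \<theta>)"

lemma ca_has_integral: "((\<lambda>\<theta>. amp \<alpha> y \<theta> * cos (phase \<alpha> y (real n) \<theta>)) has_integral ca) {- pi..pi}"
  unfolding ca_def
  by (intro integrable_integral integrable_continuous_interval continuous_on_subset[OF continuous_amp_cos[OF y_pos]]) auto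

lemma cb_has_integral: "((\<lambda>\<theta>. amp \<alpha> y \<theta> * cos (phase \<alpha> y (real n) \<theta>) * cos \<theta>) has_integral cb) {- pi..pi}"
  unfolding cb_def
  by (intro integrable_integral integrable_continuous_interval continuous_on_mult[OF continuous_on_subset[OF continuous_amp_cos[OF y_pos]]]
        continuous_intros) auto

lemma sg_has_integral: "((\<lambda>\<theta>. amp \<alpha> y \<theta> * sin (phase \<alpha> y (real n) \<theta>) * sin \<theta>) has_integral sg) {- pi..pi}"
  unfolding sg_def
  by (intro integrable_integral integrable_continuous_interval continuous_on_mult[OF continuous_on_subset[OF continuous_amp_sin[OF y_pos]]]
        continuous_intros) auto

lemma frac_partition_eq_ca: "frac_partition \<alpha> n = exp (\<alpha> * wsum 0 y + real n * y) / (2 * pi) * ca"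
  using has_integral_unique[OF frac_partition_integral[OF y_pos, of \<alpha> n] ca_has_integral] by (simp add: field_simps)

lemma frac_partition_Suc_eq:
  "frac_partition \<alpha> (Suc n) = exp (\<alpha> * wsum 0 y + real n * y) / (2 * pi) * (exp y * (cb - sg))"
proof -
  have "((\<lambda>\<theta>. amp \<alpha> y \<theta> * cos (phase \<alpha> y (real (Suc n)) \<theta>)) has_integral (cb - sg)) {- pi..pi}"
  proof -
    have "phase \<alpha> y (real (Suc n)) \<theta> = phase \<alpha> y (real n) \<theta> + \<theta>" for \<theta>
      by (simp add: phase_def algebra_simps)
    thus ?thesis
      using has_integral_diff[OF cb_has_integral sg_has_integral] by (simp add: cos_add algebra_simps)
  qed
  from has_integral_unique[OF frac_partition_integral[OF y_pos, of \<alpha> "Suc n"] this]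
  have "2 * pi * frac_partition \<alpha> (Suc n) / exp (\<alpha> * wsum 0 y + real (Suc n) * y) = cb - sg" .
  moreover have "exp (\<alpha> * wsum 0 y + real (Suc n) * y) = exp (\<alpha> * wsum 0 y + real n * y) * exp y"
    by (simp add: exp_add[symmetric] algebra_simps)
  ultimately show ?thesis by (simp add: field_simps)
qed

lemma frac_partition_pred_eq:
  assumes "n \<ge> 1"
  shows "frac_partition \<alpha> (n - 1) = exp (\<alpha> * wsum 0 y + real n * y) / (2 * pi) * (exp (- y) * (cb + sg))"
proof -
  have "((\<lambda>\<theta>. amp \<alpha> y \<theta> * cos (phase \<alpha> y (real (n - 1)) \<theta>)) has_integral (cb + sg)) {- pi..pi}"
  proof -
    have "phase \<alpha> y (real (n - 1)) \<theta> = phase \<alpha> y (real n) \<theta> - \<theta>" for \<theta>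
      using assms by (simp add: phase_def algebra_simps of_nat_diff)
    hence "amp \<alpha> y \<theta> * cos (phase \<alpha> y (real (n - 1)) \<theta>) =
        amp \<alpha> y \<theta> * cos (phase \<alpha> y (real n) \<theta>) * cos \<theta> + amp \<alpha> y \<theta> * sin (phase \<alpha> y (real n) \<theta>) * sin \<theta>" for \<theta>
      by (simp only: cos_diff distrib_left mult.assoc)
    thus ?thesis
      using has_integral_add[OF cb_has_integral sg_has_integral] by (simp only:)
  qed
  from has_integral_unique[OF frac_partition_integral[OF y_pos, of \<alpha> "n - 1"] this]
  have "2 * pi * frac_partition \<alpha> (n - 1) / exp (\<alpha> * wsum 0 y + real (n - 1) * y) = cb + sg" .
  moreover have "exp (\<alpha> * wsum 0 y + real (n - 1) * y) = exp (\<alpha> * wsum 0 y + real n * y) * exp (- y)"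
    using assms by (simp add: exp_add[symmetric] algebra_simps of_nat_diff)
  ultimately show ?thesis by (simp add: field_simps)
qed

abbreviation phase_poly where "phase_poly s \<equiv> 2601 / 10000 * \<alpha>\<^sup>2 * s\<^sup>2 + 4 * u\<^sup>2 * s ^ 6"

text \<open>The factor 2 in \<open>(A + B)\<^sup>2 \<le> 2 * A\<^sup>2 + 2 * B\<^sup>2\<close>
  cancels the 1/2 in the bound for \<open>1 - cos\<close>; 2601/10000 is the square of
  51/100.\<close>

lemma one_minus_cos_phase_le: "1 - cos (phase \<alpha> y (real n) \<theta>) \<le> phase_poly (\<theta> / y)"
proof -
  define A B where "A = 51 / 100 * \<alpha> * \<bar>\<theta> / y\<bar>" and "B = 2 * u * \<bar>\<theta> / y\<bar> ^ 3"
  have "\<bar>phase \<alpha> y (real n) \<theta>\<bar>\<^sup>2 \<le> (A + B)\<^sup>2"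
    using phase_le[OF n_eq, of \<theta>] unfolding A_def B_def by (intro power_mono) auto
  hence "(phase \<alpha> y (real n) \<theta>)\<^sup>2 \<le> (A + B)\<^sup>2" by (simp only: power2_abs)
  moreover have "(A + B)\<^sup>2 \<le> 2 * A\<^sup>2 + 2 * B\<^sup>2"
    using zero_le_power2[of "A - B"] by (simp add: power2_eq_square algebra_simps)
  ultimately have "1 - cos (phase \<alpha> y (real n) \<theta>) \<le> A\<^sup>2 + B\<^sup>2"
    using one_minus_cos_le[of "phase \<alpha> y (real n) \<theta>"] by linarith
  also have "A\<^sup>2 + B\<^sup>2 = phase_poly (\<theta> / y)"
  proof -
    have "(\<bar>\<theta> / y\<bar> ^ 3)\<^sup>2 = \<bar>\<theta> / y\<bar> ^ 6" unfolding power_mult[symmetric] by simp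
    also have "\<dots> = (\<theta> / y) ^ 6" by (rule power_even_abs) simp
    finally have "(\<bar>\<theta> / y\<bar> ^ 3)\<^sup>2 = (\<theta> / y) ^ 6" .
    thus ?thesis unfolding A_def B_def power_mult_distrib power2_abs by (simp add: power2_eq_square)
  qed
  finally show ?thesis .
qed

text \<open>The weight v is 1 for \<open>ca\<close> and \<open>1 - cos \<theta>\<close> for
  \<open>ca - cb\<close>. In the outer range the cosine may be -1; charging twice the amplitude
  there allows the Gaussian minorant to be kept, and integrated, over the whole interval.\<close>

lemma amp_cos_ge:
  assumes "\<theta> \<in> {- pi..pi}" "v \<ge> 0"
  shows "v * (amp \<alpha> y \<theta> * cos (phase \<alpha> y (real n) \<theta>)) \<ge>
    v * exp (- (g + \<alpha> / 2) * (\<theta> / y)\<^sup>2) - v * (phase_poly (\<theta> / y) * exp (- c3 * (\<theta> / y)\<^sup>2))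
     - 2 * (if \<bar>\<theta> / y\<bar> \<le> 2 / 5 then 0 else v * amp \<alpha> y \<theta>)"
proof -
  define E where "E = exp (- (g + \<alpha> / 2) * (\<theta> / y)\<^sup>2)"
  define A where "A = amp \<alpha> y \<theta>"
  define c where "c = cos (phase \<alpha> y (real n) \<theta>)"
  have EA: "E \<le> A" unfolding E_def A_def by (rule amp_ge)
  have A0: "A \<ge> 0" unfolding A_def using amp_nonneg[of \<theta>] by simp
  have P0: "phase_poly (\<theta> / y) * exp (- c3 * (\<theta> / y)\<^sup>2) \<ge> 0" by simp
  have "E - phase_poly (\<theta> / y) * exp (- c3 * (\<theta> / y)\<^sup>2) - 2 * (if \<bar>\<theta> / y\<bar> \<le> 2 / 5 then 0 else A) \<le> A * c"
  proof (cases "\<bar>\<theta> / y\<bar> \<le> 2 / 5")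
    case True
    have "A * (1 - c) \<le> exp (- c3 * (\<theta> / y)\<^sup>2) * phase_poly (\<theta> / y)"
      using amp_le_near(1)[OF True] one_minus_cos_phase_le[of \<theta>] A0
      unfolding A_def c_def by (intro mult_mono) auto
    hence "A - A * c \<le> phase_poly (\<theta> / y) * exp (- c3 * (\<theta> / y)\<^sup>2)" by (simp add: algebra_simps)
    with EA have "E - phase_poly (\<theta> / y) * exp (- c3 * (\<theta> / y)\<^sup>2) \<le> A * c" by linarith
    thus ?thesis using True by simp
  next
    case False
    have "A * (- 1) \<le> A * c" using A0 by (intro mult_left_mono) (auto simp: c_def)
    moreover have "(if \<bar>\<theta> / y\<bar> \<le> 2 / 5 then 0 else A) = A" using False by (simp only: if_False)
    ultimately show ?thesis using EA P0 by linarith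
  qed
  from mult_left_mono[OF this assms(2)] show ?thesis
    unfolding E_def A_def c_def by (auto simp: algebra_simps split: if_splits)
qed

text \<open>The integral of \<open>exp (- g * (\<theta> / y)\<^sup>2)\<close> over the line, the
  unit for all that follows. Its quotients \<open>D1\<close> to \<open>D4\<close> by powers of u
  turn the final comparisons into linear arithmetic.\<close>

definition M where "M = y * m"

lemma M_pos: "M > 0" using m_pos y_pos by (simp add: M_def)

definition D1 where "D1 = M / u"
definition D2 where "D2 = D1 / u"
definition D3 where "D3 = D2 / u"
definition D4 where "D4 = D3 / u"

lemma D_eqs: "M = u * D1" "D1 = u * D2" "D2 = u * D3" "D3 = u * D4"
  using u_pos by (simp_all add: D1_def D2_def D3_def D4_def)

lemma D_pos: "D1 > 0" "D2 > 0" "D3 > 0" "D4 > 0"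
  using u_pos M_pos by (simp_all add: D1_def D2_def D3_def D4_def)

lemma M_u: "D1 \<le> M / 70" "D1 > 0"
  using mult_right_mono[OF u_ge less_imp_le[OF D_pos(1)]] D_eqs(1) D_pos(1) by simp_all

lemma M_uu: "D2 \<le> D1 / 70"
  using mult_right_mono[OF u_ge less_imp_le[OF D_pos(2)]] D_eqs(2) by simp

text \<open>This makes the linear phase drift harmless: its square on the Gaussian scale is a
  multiple of \<open>\<alpha>\<^sup>2 / u = \<alpha> * y\<close>.\<close>

lemma alpha_square_le: "\<alpha>\<^sup>2 \<le> 57 / 1000 * u"
proof -
  have "\<alpha>\<^sup>2 = u * (\<alpha> * y)" unfolding power2_eq_square by (subst (1) alpha_eq) simp
  also have "\<dots> \<le> u * (57 / 1000)" using alpha_y u_pos by (intro mult_left_mono) auto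
  finally show ?thesis by simp
qed

text \<open>1134/1000 bounds \<open>sqrt (g / c3)\<close>, the price of the weaker exponent.\<close>

lemma gm_c3_le: "gm k c3 \<le> 1134 / 1000 * (fact (2 * k) / (4 ^ k * fact k)) / (128 / 100) ^ k * (M / u ^ k)"
proof -
  have "sqrt (pi / c3) \<le> 1134 / 1000 * m"
    using g_bounds u_pos by (intro sqrt_pi_le) (auto simp: power2_eq_square)
  hence "y * sqrt (pi / c3) * (fact (2 * k) / (4 ^ k * fact k)) / c3 ^ k \<le>
         y * (1134 / 1000 * m) * (fact (2 * k) / (4 ^ k * fact k)) / c3 ^ k"
    using y_pos u_pos by (intro divide_right_mono mult_right_mono mult_left_mono) auto
  also have "\<dots> = 1134 / 1000 * (fact (2 * k) / (4 ^ k * fact k)) / (128 / 100) ^ k * (M / u ^ k)"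
    unfolding power_mult_distrib M_def by (simp add: mult_ac)
  finally show ?thesis using gm_le[of c3 k] u_pos by simp
qed

lemma gm_c3_numeral_le:
  "gm 1 c3 \<le> 443 / 1000 * D1"
  "gm 2 c3 \<le> 5192 / 10000 * D2"
  "gm 3 c3 \<le> 1014 / 1000 * D3"
  "gm 4 c3 \<le> 2773 / 1000 * D4"
proof -
  have *: "x \<le> q * t" if "x \<le> r * t" "r \<le> q" "t \<ge> 0" for x q r t :: real
    using that mult_right_mono[of r q t] by linarith
  have p: "D1 \<ge> 0" "D2 \<ge> 0" "D3 \<ge> 0" "D4 \<ge> 0"
    using D_pos by auto
  have e: "M / u ^ 1 = D1" "M / u ^ 2 = D2" "M / u ^ 3 = D3" "M / u ^ 4 = D4"
    by (simp_all add: D1_def D2_def D3_def D4_def eval_nat_numeral)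
  show "gm 1 c3 \<le> 443 / 1000 * D1"
    by (rule *[OF gm_c3_le[of 1, unfolded e]]) (use p in \<open>simp_all add: eval_nat_numeral\<close>)
  show "gm 2 c3 \<le> 5192 / 10000 * D2"
    by (rule *[OF gm_c3_le[of 2, unfolded e]]) (use p in \<open>simp_all add: eval_nat_numeral\<close>)
  show "gm 3 c3 \<le> 1014 / 1000 * D3"
    by (rule *[OF gm_c3_le[of 3, unfolded e]]) (use p in \<open>simp_all add: eval_nat_numeral\<close>)
  show "gm 4 c3 \<le> 2773 / 1000 * D4"
    by (rule *[OF gm_c3_le[of 4, unfolded e]]) (use p in \<open>simp_all add: eval_nat_numeral\<close>)
qed

lemma tail_numeral_le:
  "tail 0 \<le> 4 / 1000 * D1" "tail 1 \<le> 75 / 10000 * D1" "tail 2 \<le> 1491 / 100000 * D1"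
proof -
  have "tail 0 \<le> 41 / 11000 * D1" "tail 1 \<le> 82 / 11000 * D1" "tail 2 \<le> 164 / 11000 * D1"
    using tail_le[of 0] tail_le[of 1] tail_le[of 2] by (simp_all add: D1_def M_def mult_ac)
  thus "tail 0 \<le> 4 / 1000 * D1" "tail 1 \<le> 75 / 10000 * D1" "tail 2 \<le> 1491 / 100000 * D1"
    using M_u(2) by linarith+
qed

lemma g_alpha_ge: "16164 / 10000 * u \<le> g - \<alpha>" using g_bounds alpha_le by linarith

lemma sqrt_pi_g_alpha: "sqrt (pi / (g - \<alpha>)) \<le> 1009 / 1000 * m"
  using g_bounds alpha_le u_pos by (intro sqrt_pi_le) (auto simp: power2_eq_square)

lemma integral_amp_le: "integral {- pi..pi} (amp \<alpha> y) \<le> 103 / 100 * M"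
proof -
  have "gm 0 (g - \<alpha>) \<le> y * sqrt (pi / (g - \<alpha>))"
    using gm_le[of "g - \<alpha>" 0] g_alpha_ge u_pos by simp
  also have "\<dots> \<le> y * (1009 / 1000 * m)" using sqrt_pi_g_alpha y_pos by (intro mult_left_mono) auto
  finally have 1: "gm 0 (g - \<alpha>) \<le> 1009 / 1000 * M" by (simp add: M_def)
  have "49 / 24 * u * gm 2 c3 \<le> 49 / 24 * u * (5192 / 10000 * D2)"
    using gm_c3_numeral_le(2) u_pos by (intro mult_left_mono) auto
  also have "\<dots> = 49 / 24 * (5192 / 10000) * D1" by (simp add: D_eqs(2))
  finally have 2: "49 / 24 * u * gm 2 c3 \<le> 49 / 24 * (5192 / 10000) * D1" .
  have "integral {- pi..pi} (amp \<alpha> y) \<le> gm 0 (g - \<alpha>) + 49 / 24 * u * gm 2 c3 + tail 0"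
    using integral_amp_power_le[of 0] by (simp only: mult_0_right add_0_left power_0 mult_1_right)
  thus ?thesis
    using 1 2 tail_numeral_le(1) M_u by linarith
qed

lemma ca_le: "ca \<le> 103 / 100 * M"
proof -
  have "ca \<le> integral {- pi..pi} (amp \<alpha> y)"
  proof (rule has_integral_le[OF ca_has_integral])
    show "(amp \<alpha> y has_integral integral {- pi..pi} (amp \<alpha> y)) {- pi..pi}"
      by (intro integrable_integral integrable_continuous_interval continuous_on_subset[OF continuous_amp[OF y_pos]]) auto
    show "amp \<alpha> y \<theta> * cos (phase \<alpha> y (real n) \<theta>) \<le> amp \<alpha> y \<theta>" for \<theta>
      using mult_left_mono[OF cos_le_one less_imp_le[OF amp_nonneg[of \<theta>]]] by simp
  qed
  thus ?thesis using integral_amp_le by linarith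
qed

lemma integral_amp_square_le: "integral {- pi..pi} (\<lambda>\<theta>. amp \<alpha> y \<theta> * (\<theta> / y)\<^sup>2) \<le> 357 / 1000 * D1"
proof -
  have "gm 1 (g - \<alpha>) \<le> y * sqrt (pi / (g - \<alpha>)) * (1 / 2) / (g - \<alpha>)"
    using gm_le[of "g - \<alpha>" 1] g_alpha_ge u_pos by simp
  also have "\<dots> \<le> y * (1009 / 1000 * m) * (1 / 2) / (16164 / 10000 * u)"
    using sqrt_pi_g_alpha y_pos g_alpha_ge u_pos m_pos
    by (intro frac_le mult_right_mono mult_left_mono) auto
  also have "\<dots> = 1009 / 1000 / 2 / (16164 / 10000) * D1" by (simp add: D1_def M_def)
  also have "\<dots> \<le> 3122 / 10000 * D1" using D_pos(1) by (intro mult_right_mono) auto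
  finally have 1: "gm 1 (g - \<alpha>) \<le> 3122 / 10000 * D1" .
  have "49 / 24 * u * gm 3 c3 \<le> 49 / 24 * u * (1014 / 1000 * D3)"
    using gm_c3_numeral_le(3) u_pos by (intro mult_left_mono) auto
  also have "\<dots> = 49 / 24 * (1014 / 1000) * D2" by (simp add: D_eqs(3))
  finally have 2: "49 / 24 * u * gm 3 c3 \<le> 49 / 24 * (1014 / 1000) * D2" .
  have "integral {- pi..pi} (\<lambda>\<theta>. amp \<alpha> y \<theta> * (\<theta> / y)\<^sup>2) \<le> gm 1 (g - \<alpha>) + 49 / 24 * u * gm 3 c3 + tail 2"
    using integral_amp_power_le[of 1] by (simp add: numeral_eq_Suc)
  moreover have "gm 1 (g - \<alpha>) + 49 / 24 * u * gm 3 c3 + tail 2 \<le> 357 / 1000 * D1"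
    \<comment> \<open>At u = 70 the three parts add up to about 0.3567; the leading value is
      \<open>3 / pi\<^sup>2\<close>, about 0.304.\<close>
    using 1 2 tail_numeral_le(3) M_u M_uu by linarith
  ultimately show ?thesis by (rule order_trans)
qed

lemma ca_cb_has_integral:
  "((\<lambda>\<theta>. (1 - cos \<theta>) * (amp \<alpha> y \<theta> * cos (phase \<alpha> y (real n) \<theta>))) has_integral (ca - cb)) {- pi..pi}"
  using has_integral_diff[OF ca_has_integral cb_has_integral] by (simp add: algebra_simps)

lemma one_minus_cos_le_scaled: "1 - cos \<theta> \<le> y\<^sup>2 / 2 * (\<theta> / y)\<^sup>2"
  using one_minus_cos_le[of \<theta>] y_pos by (simp add: power_divide)

lemma ca_minus_cb_le: "ca - cb \<le> y\<^sup>2 / 2 * (357 / 1000 * D1)"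
proof -
  have "ca - cb \<le> y\<^sup>2 / 2 * integral {- pi..pi} (\<lambda>\<theta>. amp \<alpha> y \<theta> * (\<theta> / y)\<^sup>2)"
  proof (rule has_integral_le[OF ca_cb_has_integral has_integral_mult_right[OF integrable_integral[OF amp_integrable]]])
    fix \<theta>
    have "(1 - cos \<theta>) * (amp \<alpha> y \<theta> * cos (phase \<alpha> y (real n) \<theta>)) \<le> (1 - cos \<theta>) * (amp \<alpha> y \<theta> * 1)"
      using amp_nonneg[of \<theta>] by (intro mult_left_mono) auto
    also have "\<dots> \<le> (y\<^sup>2 / 2 * (\<theta> / y)\<^sup>2) * (amp \<alpha> y \<theta> * 1)"
      using amp_nonneg[of \<theta>] by (intro mult_right_mono one_minus_cos_le_scaled) auto
    finally show "(1 - cos \<theta>) * (amp \<alpha> y \<theta> * cos (phase \<alpha> y (real n) \<theta>)) \<le> y\<^sup>2 / 2 * (amp \<alpha> y \<theta> * (\<theta> / y)\<^sup>2)"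
      by (simp add: mult_ac)
  qed
  also have "\<dots> \<le> y\<^sup>2 / 2 * (357 / 1000 * D1)"
    by (intro mult_left_mono integral_amp_square_le) auto
  finally show ?thesis .
qed

lemma g2_bounds: "g + \<alpha> / 2 \<ge> 16449 / 10000 * u" "g + \<alpha> / 2 \<le> 16593 / 10000 * u" "g + \<alpha> / 2 \<ge> 115"
  using g_bounds alpha_le alpha u_ge by linarith+

lemma sqrt_pi_g2: "995 / 1000 * m \<le> sqrt (pi / (g + \<alpha> / 2))" "sqrt (pi / (g + \<alpha> / 2)) \<le> m"
proof -
  show "995 / 1000 * m \<le> sqrt (pi / (g + \<alpha> / 2))"
    using g_bounds alpha_le u_pos alpha by (intro sqrt_pi_ge) (auto simp: power2_eq_square)
  show "sqrt (pi / (g + \<alpha> / 2)) \<le> m"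
    using sqrt_pi_le[of "g + \<alpha> / 2" 1] g_pos alpha by simp
qed

lemma y_pi_square_le: "(y / pi)\<^sup>2 \<le> 1 / 1000"
proof -
  have "y / pi \<le> y / 1" using y_pos pi_gt3 by (intro divide_left_mono) auto
  hence "(y / pi)\<^sup>2 \<le> y\<^sup>2" using y_pos by (intro power_mono) auto
  thus ?thesis using y_square_le by linarith
qed

lemma gm_0_g2_ge: "99 / 100 * M \<le> gm 0 (g + \<alpha> / 2)"
proof -
  define s where "s = sqrt (pi / (g + \<alpha> / 2))"
  have s: "995 / 1000 * m \<le> s" "s \<ge> 0" using sqrt_pi_g2(1) g2_bounds u_pos by (auto simp: s_def)
  have "(y / pi)\<^sup>2 * (y * s * (1 / 2) / (g + \<alpha> / 2)) \<le> 1 / 1000 * (y * s * (1 / 2) / 1)"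
    using y_pi_square_le y_pos s g2_bounds by (intro mult_mono divide_left_mono) auto
  hence "y * s - 1 / 2000 * (y * s) \<le> gm 0 (g + \<alpha> / 2)"
    using gm_ge[of "g + \<alpha> / 2" 0] g2_bounds unfolding s_def by simp
  moreover have "y * (995 / 1000 * m) \<le> y * s" using s y_pos by (intro mult_left_mono) auto
  ultimately show ?thesis using M_pos unfolding M_def by linarith
qed

lemma gm_1_g2_ge: "297 / 1000 * D1 \<le> gm 1 (g + \<alpha> / 2)"
proof -
  define s where "s = sqrt (pi / (g + \<alpha> / 2))"
  define G where "G = g + \<alpha> / 2"
  have G: "G \<ge> 115" "G \<le> 16593 / 10000 * u" using g2_bounds by (auto simp: G_def)
  have s: "995 / 1000 * m \<le> s" "s \<ge> 0" using sqrt_pi_g2(1) g2_bounds u_pos by (auto simp: s_def)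
  have ys: "y * s / G \<ge> 0" using y_pos s G by simp
  have "(y / pi)\<^sup>2 * (y * s * (3 / 4) / G\<^sup>2) = (y / pi)\<^sup>2 * (3 / 4 / G * (y * s / G))"
    by (simp add: power2_eq_square)
  also have "\<dots> \<le> 1 / 1000 * (1 * (y * s / G))"
    using y_pi_square_le ys G by (intro mult_mono mult_nonneg_nonneg) simp_all
  finally have "(y * s / G) * (1 / 2) - 1 / 1000 * (y * s / G) \<le> gm 1 G"
    using gm_ge[of G 1] G unfolding s_def G_def[symmetric] by (simp add: eval_nat_numeral)
  hence J: "499 / 1000 * (y * s / G) \<le> gm 1 G" by (simp only: left_diff_distrib[symmetric] mult.commute[of _ "1 / 2"]) simp
  have "y * (995 / 1000 * m) / (16593 / 10000 * u) \<le> y * s / G"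
    using s y_pos G m_pos by (intro frac_le mult_left_mono) auto
  moreover have "y * (995 / 1000 * m) / (16593 / 10000 * u) = 9950 / 16593 * D1" by (simp add: D1_def M_def)
  ultimately have "9950 / 16593 * D1 \<le> y * s / G" by (simp only:)
  hence "499 / 1000 * (9950 / 16593 * D1) \<le> 499 / 1000 * (y * s / G)" by (intro mult_left_mono) auto
  also note J
  finally have "499 / 1000 * (9950 / 16593 * D1) \<le> gm 1 G" .
  moreover have "297 / 1000 * D1 \<le> 499 / 1000 * (9950 / 16593 * D1)" using D_pos(1) by simp
  ultimately show ?thesis unfolding G_def by (rule order_trans[rotated])
qed

lemma gm_2_g2_le: "gm 2 (g + \<alpha> / 2) \<le> D1"
proof -
  define G where "G = g + \<alpha> / 2"
  have G: "G \<ge> 115" "16449 / 10000 * u \<le> G" using g2_bounds by (auto simp: G_def)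
  have "gm 2 G \<le> y * sqrt (pi / G) * (3 / 4) / G\<^sup>2"
    using gm_le[of G 2] G by (simp add: eval_nat_numeral)
  also have "\<dots> \<le> y * m * 1 / (1 * u)"
    unfolding power2_eq_square
    using sqrt_pi_g2(2) y_pos G m_pos u_pos unfolding G_def[symmetric]
    by (intro frac_le mult_mono mult_left_mono) auto
  finally show ?thesis by (simp add: D1_def M_def G_def)
qed

lemma ca_ge: "92 / 100 * M \<le> ca"
proof -
  have "gm 0 (g + \<alpha> / 2) - (2601 / 10000 * \<alpha>\<^sup>2 * gm 1 c3 + 4 * u\<^sup>2 * gm 3 c3) - 2 * tail 0 \<le> ca"
  proof (rule has_integral_le[OF _ ca_has_integral])
    show "((\<lambda>\<theta>. (\<theta> / y) ^ (2 * 0) * exp (- (g + \<alpha> / 2) * (\<theta> / y)\<^sup>2) -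
        (2601 / 10000 * \<alpha>\<^sup>2 * ((\<theta> / y) ^ (2 * 1) * exp (- c3 * (\<theta> / y)\<^sup>2)) + 4 * u\<^sup>2 * ((\<theta> / y) ^ (2 * 3) * exp (- c3 * (\<theta> / y)\<^sup>2)))
        - 2 * (2 ^ 0 * tau2 * window \<theta> + (pi / y) ^ 0 * tau3)) has_integral
       (gm 0 (g + \<alpha> / 2) - (2601 / 10000 * \<alpha>\<^sup>2 * gm 1 c3 + 4 * u\<^sup>2 * gm 3 c3) - 2 * tail 0)) {- pi..pi}"
      by (intro has_integral_diff has_integral_add has_integral_mult_right gm_has_integral tail_has_integral)
    fix \<theta> assume \<theta>: "\<theta> \<in> {- pi..pi}"
    have "(if \<bar>\<theta> / y\<bar> \<le> 2 / 5 then 0 else 1 * amp \<alpha> y \<theta>) \<le> 2 ^ 0 * tau2 * window \<theta> + (pi / y) ^ 0 * tau3"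
      using amp_power_le_outer[OF \<theta>, of 0] tau_nonneg window_nonneg[of \<theta>] by auto
    with amp_cos_ge[OF \<theta>, of 1]
    show "(\<theta> / y) ^ (2 * 0) * exp (- (g + \<alpha> / 2) * (\<theta> / y)\<^sup>2) -
        (2601 / 10000 * \<alpha>\<^sup>2 * ((\<theta> / y) ^ (2 * 1) * exp (- c3 * (\<theta> / y)\<^sup>2)) + 4 * u\<^sup>2 * ((\<theta> / y) ^ (2 * 3) * exp (- c3 * (\<theta> / y)\<^sup>2)))
        - 2 * (2 ^ 0 * tau2 * window \<theta> + (pi / y) ^ 0 * tau3) \<le> amp \<alpha> y \<theta> * cos (phase \<alpha> y (real n) \<theta>)"
      by (simp add: distrib_right mult.assoc)
  qed
  moreover have "2601 / 10000 * \<alpha>\<^sup>2 * gm 1 c3 \<le> 2601 / 10000 * (57 / 1000 * u) * (443 / 1000 * D1)"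
    using alpha_square_le gm_c3_numeral_le(1) M_u(2) u_pos by (intro mult_mono' mult_left_mono) (auto simp: gm_nonneg)
  moreover have "2601 / 10000 * (57 / 1000 * u) * (443 / 1000 * D1) = 2601 / 10000 * (57 / 1000) * (443 / 1000) * M"
    by (simp add: D_eqs(1))
  moreover have "4 * u\<^sup>2 * gm 3 c3 \<le> 4 * u\<^sup>2 * (1014 / 1000 * D3)"
    using gm_c3_numeral_le(3) by (intro mult_left_mono) auto
  moreover have "4 * u\<^sup>2 * (1014 / 1000 * D3) = 4 * (1014 / 1000) * D1"
    unfolding D_eqs(2) D_eqs(3) by (simp add: power2_eq_square)
  \<comment> \<open>Most of the loss is due to the cubic phase:
    \<open>4 * (1014 / 1000) / 70\<close>, about 0.058.\<close>
  ultimately show ?thesis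
    using gm_0_g2_ge tail_numeral_le(1) M_u M_pos by linarith
qed

lemma ca_minus_cb_ge: "y\<^sup>2 / 2 * (1 / 10 * D1) \<le> ca - cb"
proof -
  have "y\<^sup>2 / 2 * (gm 1 (g + \<alpha> / 2) - y\<^sup>2 / 12 * gm 2 (g + \<alpha> / 2) -
      (2601 / 10000 * \<alpha>\<^sup>2 * gm 2 c3 + 4 * u\<^sup>2 * gm 4 c3) - 2 * tail 2) \<le> ca - cb"
  proof (rule has_integral_le[OF _ ca_cb_has_integral])
    show "((\<lambda>\<theta>. y\<^sup>2 / 2 * ((\<theta> / y) ^ (2 * 1) * exp (- (g + \<alpha> / 2) * (\<theta> / y)\<^sup>2) -
        y\<^sup>2 / 12 * ((\<theta> / y) ^ (2 * 2) * exp (- (g + \<alpha> / 2) * (\<theta> / y)\<^sup>2)) -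
        (2601 / 10000 * \<alpha>\<^sup>2 * ((\<theta> / y) ^ (2 * 2) * exp (- c3 * (\<theta> / y)\<^sup>2)) + 4 * u\<^sup>2 * ((\<theta> / y) ^ (2 * 4) * exp (- c3 * (\<theta> / y)\<^sup>2)))
        - 2 * (2\<^sup>2 * tau2 * window \<theta> + (pi / y)\<^sup>2 * tau3))) has_integral
       (y\<^sup>2 / 2 * (gm 1 (g + \<alpha> / 2) - y\<^sup>2 / 12 * gm 2 (g + \<alpha> / 2) -
      (2601 / 10000 * \<alpha>\<^sup>2 * gm 2 c3 + 4 * u\<^sup>2 * gm 4 c3) - 2 * tail 2))) {- pi..pi}"
      by (intro has_integral_diff has_integral_add has_integral_mult_right gm_has_integral tail_has_integral)
    fix \<theta> assume \<theta>: "\<theta> \<in> {- pi..pi}"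
    define s where "s = \<theta> / y"
    define v where "v = 1 - cos \<theta>"
    define E2 where "E2 = exp (- (g + \<alpha> / 2) * s\<^sup>2)"
    define E3 where "E3 = exp (- c3 * s\<^sup>2)"
    define T where "T = 2\<^sup>2 * tau2 * window \<theta> + (pi / y)\<^sup>2 * tau3"
    have T0: "T \<ge> 0" using tau_nonneg window_nonneg[of \<theta>] by (simp add: T_def)
    have v0: "v \<ge> 0" and vu: "v \<le> y\<^sup>2 / 2 * s\<^sup>2"
      using one_minus_cos_le_scaled[of \<theta>] by (auto simp: v_def s_def)
    have "\<theta>\<^sup>2 / 2 - \<theta> ^ 4 / 24 = y\<^sup>2 / 2 * (s\<^sup>2 - y\<^sup>2 / 12 * s ^ 4)"
      using y_pos by (simp add: s_def power_divide field_simps eval_nat_numeral)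
    hence vl: "y\<^sup>2 / 2 * (s\<^sup>2 - y\<^sup>2 / 12 * s ^ 4) \<le> v"
      using one_minus_cos_ge[of \<theta>] by (simp add: v_def)
    have t1: "y\<^sup>2 / 2 * (s\<^sup>2 - y\<^sup>2 / 12 * s ^ 4) * E2 \<le> v * E2"
      using vl by (intro mult_right_mono) (auto simp: E2_def)
    have t2: "v * (phase_poly s * E3) \<le> (y\<^sup>2 / 2 * s\<^sup>2) * (phase_poly s * E3)"
      using vu by (intro mult_right_mono) (auto simp: E3_def)
    have t3: "(if \<bar>s\<bar> \<le> 2 / 5 then 0 else v * amp \<alpha> y \<theta>) \<le> y\<^sup>2 / 2 * T"
    proof (cases "\<bar>s\<bar> \<le> 2 / 5")
      case False
      have "v * amp \<alpha> y \<theta> \<le> (y\<^sup>2 / 2 * s\<^sup>2) * amp \<alpha> y \<theta>"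
        using vu amp_nonneg[of \<theta>] by (intro mult_right_mono) auto
      also have "\<dots> = y\<^sup>2 / 2 * (amp \<alpha> y \<theta> * \<bar>\<theta> / y\<bar>\<^sup>2)" unfolding s_def power2_abs by simp
      also have "\<dots> \<le> y\<^sup>2 / 2 * T"
        unfolding T_def using amp_power_le_outer[OF \<theta>, of 2] False by (intro mult_left_mono) (auto simp: s_def)
      finally show ?thesis using False by simp
    qed (use T0 in simp)
    have "v * E2 - v * (phase_poly s * E3) - 2 * (if \<bar>s\<bar> \<le> 2 / 5 then 0 else v * amp \<alpha> y \<theta>) \<le> v * (amp \<alpha> y \<theta> * cos (phase \<alpha> y (real n) \<theta>))"
      using amp_cos_ge[OF \<theta> v0] unfolding s_def E2_def E3_def .
    hence "y\<^sup>2 / 2 * (s\<^sup>2 - y\<^sup>2 / 12 * s ^ 4) * E2 - (y\<^sup>2 / 2 * s\<^sup>2) * (phase_poly s * E3) - 2 * (y\<^sup>2 / 2 * T)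
      \<le> v * (amp \<alpha> y \<theta> * cos (phase \<alpha> y (real n) \<theta>))"
      using t1 t2 t3 by linarith
    also have "y\<^sup>2 / 2 * (s\<^sup>2 - y\<^sup>2 / 12 * s ^ 4) * E2 - (y\<^sup>2 / 2 * s\<^sup>2) * (phase_poly s * E3) - 2 * (y\<^sup>2 / 2 * T) =
      y\<^sup>2 / 2 * (s ^ (2 * 1) * E2 - y\<^sup>2 / 12 * (s ^ (2 * 2) * E2) -
        (2601 / 10000 * \<alpha>\<^sup>2 * (s ^ (2 * 2) * E3) + 4 * u\<^sup>2 * (s ^ (2 * 4) * E3)) - 2 * T)"
      by (simp add: algebra_simps eval_nat_numeral)
    finally show "y\<^sup>2 / 2 * ((\<theta> / y) ^ (2 * 1) * exp (- (g + \<alpha> / 2) * (\<theta> / y)\<^sup>2) -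
        y\<^sup>2 / 12 * ((\<theta> / y) ^ (2 * 2) * exp (- (g + \<alpha> / 2) * (\<theta> / y)\<^sup>2)) -
        (2601 / 10000 * \<alpha>\<^sup>2 * ((\<theta> / y) ^ (2 * 2) * exp (- c3 * (\<theta> / y)\<^sup>2)) + 4 * u\<^sup>2 * ((\<theta> / y) ^ (2 * 4) * exp (- c3 * (\<theta> / y)\<^sup>2)))
        - 2 * (2\<^sup>2 * tau2 * window \<theta> + (pi / y)\<^sup>2 * tau3)) \<le> (1 - cos \<theta>) * (amp \<alpha> y \<theta> * cos (phase \<alpha> y (real n) \<theta>))"
      unfolding s_def E2_def E3_def T_def v_def .
  qed
  moreover have "1 / 10 * D1 \<le> gm 1 (g + \<alpha> / 2) - y\<^sup>2 / 12 * gm 2 (g + \<alpha> / 2) -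
      (2601 / 10000 * \<alpha>\<^sup>2 * gm 2 c3 + 4 * u\<^sup>2 * gm 4 c3) - 2 * tail 2"
  proof -
    have "y\<^sup>2 / 12 * gm 2 (g + \<alpha> / 2) \<le> 1 / 1000 * D1"
      using y_square_le gm_2_g2_le M_u(2) by (intro mult_mono) (auto simp: gm_nonneg)
    moreover have "2601 / 10000 * \<alpha>\<^sup>2 * gm 2 c3 \<le> 2601 / 10000 * (57 / 1000 * u) * (5192 / 10000 * D2)"
      using alpha_square_le gm_c3_numeral_le(2) M_u(2) u_pos by (intro mult_mono' mult_left_mono) (auto simp: gm_nonneg)
    moreover have "2601 / 10000 * (57 / 1000 * u) * (5192 / 10000 * D2) = 2601 / 10000 * (57 / 1000) * (5192 / 10000) * D1"
      unfolding D_eqs(2) by simp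
    moreover have "4 * u\<^sup>2 * gm 4 c3 \<le> 4 * u\<^sup>2 * (2773 / 1000 * D4)"
      using gm_c3_numeral_le(4) by (intro mult_left_mono) auto
    moreover have "4 * u\<^sup>2 * (2773 / 1000 * D4) = 4 * (2773 / 1000) * D2"
      unfolding D_eqs(3) D_eqs(4) by (simp add: power2_eq_square)
    \<comment> \<open>At u = 70 the margin is below 0.0001: of 0.297 the cubic phase takes about
      0.158, the tails 0.030 and the linear phase 0.008.\<close>
    ultimately show ?thesis
      using gm_1_g2_ge tail_numeral_le(3) M_u M_uu by linarith
  qed
  hence "y\<^sup>2 / 2 * (1 / 10 * D1) \<le> y\<^sup>2 / 2 * (gm 1 (g + \<alpha> / 2) - y\<^sup>2 / 12 * gm 2 (g + \<alpha> / 2) -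
      (2601 / 10000 * \<alpha>\<^sup>2 * gm 2 c3 + 4 * u\<^sup>2 * gm 4 c3) - 2 * tail 2)"
    by (intro mult_left_mono) auto
  ultimately show ?thesis by linarith
qed

text \<open>Both sines are small near the saddle point: \<open>sin \<theta>\<close> gives the factor
  y, while the linear and the cubic part of the phase average to the orders
  \<open>\<alpha> / u\<close> and \<open>1 / u\<close>.\<close>

lemma abs_sg_le: "\<bar>sg\<bar> \<le> y * M * (226 / 1000 * (\<alpha> / u) + 1046 / 1000 / u)"
proof -
  define F where "F \<theta> = y * (51 / 100 * \<alpha> * ((\<theta> / y) ^ (2 * 1) * exp (- c3 * (\<theta> / y)\<^sup>2)) + 2 * u * ((\<theta> / y) ^ (2 * 2) * exp (- c3 * (\<theta> / y)\<^sup>2))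
     + (2 ^ 1 * tau2 * window \<theta> + (pi / y) ^ 1 * tau3))" for \<theta>
  define I where "I = y * (51 / 100 * \<alpha> * gm 1 c3 + 2 * u * gm 2 c3 + tail 1)"
  have FI: "(F has_integral I) {- pi..pi}"
    unfolding F_def[abs_def] I_def
    by (intro has_integral_add has_integral_mult_right gm_has_integral tail_has_integral)
  have FI': "((\<lambda>\<theta>. - F \<theta>) has_integral - I) {- pi..pi}" by (rule has_integral_neg[OF FI])
  have bound: "\<bar>amp \<alpha> y \<theta> * sin (phase \<alpha> y (real n) \<theta>) * sin \<theta>\<bar> \<le> F \<theta>" if \<theta>: "\<theta> \<in> {- pi..pi}" for \<theta>
  proof -
    define s where "s = \<bar>\<theta> / y\<bar>"
    have st: "\<bar>sin \<theta>\<bar> \<le> y * s"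
      using abs_sin_x_le_abs_x[of \<theta>] y_pos by (simp add: s_def abs_divide)
    have s0: "s \<ge> 0" by (simp add: s_def)
    have s24: "(\<theta> / y) ^ (2 * 1) = s ^ 2" "(\<theta> / y) ^ (2 * 2) = s ^ 4" "(\<theta> / y)\<^sup>2 = s\<^sup>2"
      unfolding s_def by (simp_all only: power_even_abs even_mult_iff even_numeral power2_abs mult_1_right) (simp_all add: power_even_abs)
    have G0: "0 \<le> 51 / 100 * \<alpha> * (s ^ 2 * exp (- c3 * s\<^sup>2)) + 2 * u * (s ^ 4 * exp (- c3 * s\<^sup>2))"
      using alpha u_pos by simp
    have "amp \<alpha> y \<theta> * \<bar>sin (phase \<alpha> y (real n) \<theta>)\<bar> * s \<le>
       51 / 100 * \<alpha> * (s ^ 2 * exp (- c3 * s\<^sup>2)) + 2 * u * (s ^ 4 * exp (- c3 * s\<^sup>2)) + (2 ^ 1 * tau2 * window \<theta> + (pi / y) ^ 1 * tau3)"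
    proof (cases "s \<le> 2 / 5")
      case True
      have "\<bar>sin (phase \<alpha> y (real n) \<theta>)\<bar> \<le> 51 / 100 * \<alpha> * s + 2 * u * s ^ 3"
        using abs_sin_x_le_abs_x[of "phase \<alpha> y (real n) \<theta>"] phase_le[OF n_eq, of \<theta>] unfolding s_def by linarith
      hence "amp \<alpha> y \<theta> * \<bar>sin (phase \<alpha> y (real n) \<theta>)\<bar> * s \<le> exp (- c3 * s\<^sup>2) * (51 / 100 * \<alpha> * s + 2 * u * s ^ 3) * s"
        using amp_le_near(1)[of \<theta>] True s0 amp_nonneg[of \<theta>] unfolding s24 s_def[symmetric] by (intro mult_right_mono mult_mono) auto
      also have "\<dots> = 51 / 100 * \<alpha> * (s ^ 2 * exp (- c3 * s\<^sup>2)) + 2 * u * (s ^ 4 * exp (- c3 * s\<^sup>2))"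
        by (simp add: algebra_simps eval_nat_numeral)
      moreover have "0 \<le> 2 ^ 1 * tau2 * window \<theta> + (pi / y) ^ 1 * tau3" using tau_nonneg window_nonneg y_pos by simp
      ultimately show ?thesis by linarith
    next
      case False
      have "amp \<alpha> y \<theta> * \<bar>sin (phase \<alpha> y (real n) \<theta>)\<bar> * s \<le> amp \<alpha> y \<theta> * 1 * s"
        using amp_nonneg[of \<theta>] s0 by (intro mult_right_mono mult_left_mono) auto
      also have "\<dots> \<le> 2 ^ 1 * tau2 * window \<theta> + (pi / y) ^ 1 * tau3"
        using amp_power_le_outer[OF \<theta>, of 1] False by (simp add: s_def)
      finally show ?thesis using G0 by linarith
    qed
    hence "y * (amp \<alpha> y \<theta> * \<bar>sin (phase \<alpha> y (real n) \<theta>)\<bar> * s) \<le> F \<theta>"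
      unfolding F_def s24 using y_pos by (intro mult_left_mono) auto
    moreover have "\<bar>amp \<alpha> y \<theta> * sin (phase \<alpha> y (real n) \<theta>) * sin \<theta>\<bar> \<le> amp \<alpha> y \<theta> * \<bar>sin (phase \<alpha> y (real n) \<theta>)\<bar> * (y * s)"
      unfolding abs_mult using st amp_nonneg[of \<theta>] by (intro mult_mono) auto
    ultimately show ?thesis by (simp add: mult_ac)
  qed
  have "sg \<le> I" by (rule has_integral_le[OF sg_has_integral FI]) (use bound in \<open>simp add: abs_le_iff\<close>)
  moreover have "- I \<le> sg" by (rule has_integral_le[OF FI' sg_has_integral]) (use bound in \<open>force simp: abs_le_iff\<close>)
  ultimately have "\<bar>sg\<bar> \<le> I" by simp
  also have "I \<le> y * (51 / 100 * \<alpha> * (443 / 1000 * D1) + 2 * u * (5192 / 10000 * D2) + 75 / 10000 * D1)"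
    unfolding I_def using gm_c3_numeral_le tail_numeral_le alpha u_pos y_pos
    by (intro mult_left_mono add_mono) auto
  also have "\<dots> = y * M * (51 / 100 * (443 / 1000) * (\<alpha> / u) + (2 * (5192 / 10000) + 75 / 10000) / u)"
    using u_pos unfolding D2_def D1_def by (simp add: field_simps)
  also have "\<dots> \<le> y * M * (226 / 1000 * (\<alpha> / u) + 1046 / 1000 / u)"
    using y_pos M_pos u_pos alpha by (intro mult_left_mono add_mono mult_right_mono divide_right_mono) auto
  finally show ?thesis .
qed

lemma sg_square_le: "sg\<^sup>2 \<le> 324 / 10000 * y\<^sup>2 * M\<^sup>2 / u"
proof -
  define A B where "A = 226 / 1000 * (\<alpha> / u)" and "B = 1046 / 1000 / u"
  have "A\<^sup>2 = (226 / 1000)\<^sup>2 * (\<alpha>\<^sup>2 / (u * u))" by (simp add: A_def power_mult_distrib power_divide power2_eq_square)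
  also have "\<alpha>\<^sup>2 / (u * u) \<le> (57 / 1000 * u) / (u * u)" using alpha_square_le u_pos by (intro divide_right_mono) auto
  also have "\<dots> = 57 / 1000 * (1 / u)" using u_pos by simp
  finally have A: "A\<^sup>2 \<le> (226 / 1000)\<^sup>2 * (57 / 1000 * (1 / u))" by simp
  have "1 / u * (1 / u) \<le> 1 / 70 * (1 / u)" using u_ge by (intro mult_right_mono) (auto simp: field_simps)
  hence B: "B\<^sup>2 \<le> (1046 / 1000)\<^sup>2 * (1 / 70 * (1 / u))" by (simp add: B_def power_divide power2_eq_square)
  \<comment> \<open>13/4 = 1 + 9/4 and 13/9 = 1 + 4/9; the weight 9/4 is close to the ratio of the
    bounds just found for B and A, where it is optimal.\<close>
  have "(A + B)\<^sup>2 \<le> 13 / 4 * A\<^sup>2 + 13 / 9 * B\<^sup>2"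
    using zero_le_power2[of "3 / 2 * A - 2 / 3 * B"] by (simp add: power2_eq_square algebra_simps)
  also have "\<dots> \<le> 324 / 10000 * (1 / u)"
  proof -
    have "(226 / 1000)\<^sup>2 * (57 / 1000 * (1 / u)) = 727833 / 250000000 * (1 / u)"
      "(1046 / 1000)\<^sup>2 * (1 / 70 * (1 / u)) = 273529 / 17500000 * (1 / u)"
      by (simp_all add: power2_eq_square)
    moreover have "1 / u > 0" using u_pos by simp
    ultimately show ?thesis using A B by linarith
  qed
  finally have AB: "(A + B)\<^sup>2 \<le> 324 / 10000 * (1 / u)" .
  have "sg\<^sup>2 = \<bar>sg\<bar>\<^sup>2" by simp
  also have "\<dots> \<le> (y * M * (A + B))\<^sup>2" using abs_sg_le unfolding A_def B_def by (intro power_mono) auto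
  also have "\<dots> = y\<^sup>2 * M\<^sup>2 * (A + B)\<^sup>2" by (simp only: power_mult_distrib)
  also have "\<dots> \<le> y\<^sup>2 * M\<^sup>2 * (324 / 10000 * (1 / u))" using AB by (intro mult_left_mono) auto
  finally show ?thesis by simp
qed

lemma abs_sg_small: "\<bar>sg\<bar> \<le> 7 / 10000 * M"
proof -
  have "\<alpha> / u = y" using alpha y_pos by (simp add: u_def)
  hence "226 / 1000 * (\<alpha> / u) + 1046 / 1000 / u \<le> 226 / 1000 * (57 / 2000) + 1046 / 1000 / 70"
    using y_le u_ge by (intro add_mono mult_left_mono divide_left_mono) auto
  also have "\<dots> \<le> 22 / 1000" by simp
  finally have "y * M * (226 / 1000 * (\<alpha> / u) + 1046 / 1000 / u) \<le> (57 / 2000) * M * (22 / 1000)"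
    using y_le M_pos y_pos alpha u_pos by (intro mult_mono) auto
  thus ?thesis using abs_sg_le M_pos by linarith
qed

lemma cb_bounds: "cb \<le> ca" "919 / 1000 * M \<le> cb + sg" "sg \<le> ca"
proof -
  have "0 \<le> y\<^sup>2 / 2 * (1 / 10 * D1)" using D_pos by simp
  thus "cb \<le> ca" using ca_minus_cb_ge by linarith
  have "y\<^sup>2 / 2 * (357 / 1000 * D1) \<le> (1 / 1000) / 2 * (357 / 1000 * (M / 70))"
    using y_square_le M_u M_pos by (intro mult_mono divide_right_mono) auto
  thus "919 / 1000 * M \<le> cb + sg" using ca_minus_cb_le ca_ge abs_sg_small M_pos by linarith
  show "sg \<le> ca" using abs_sg_small ca_ge M_pos by linarith
qed

text \<open>To leading order X is \<open>3 / pi\<^sup>2 * (y\<^sup>2 / u)\<close>, with constant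
  about 0.304. In the upper bound \<open>sg\<^sup>2\<close> is measured in the same unit; in the
  lower bound it is dropped as a square, and \<open>sg \<le> ca\<close> lets \<open>c\<close> cancel
  against \<open>ca + cb\<close>.\<close>

lemma ratio_diff_bounds:
  assumes "n \<ge> 1"
  defines "X \<equiv> frac_partition \<alpha> n / frac_partition \<alpha> (n - 1) - frac_partition \<alpha> (Suc n) / frac_partition \<alpha> n"
  shows "48 / 1000 * (y\<^sup>2 / u) \<le> X" "X \<le> 44 / 100 * (y\<^sup>2 / u)"
proof -
  define K where "K = exp (\<alpha> * wsum 0 y + real n * y) / (2 * pi)"
  have K: "K > 0" by (simp add: K_def)
  have ca: "ca > 0" "ca \<ge> 92 / 100 * M" "ca \<le> 103 / 100 * M" using ca_ge ca_le M_pos by auto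
  define c where "c = cb + sg"
  have d: "c > 0" "c \<ge> 919 / 1000 * M" using cb_bounds M_pos by (auto simp: c_def)
  define Q where "Q = ((ca - cb) * (ca + cb) + sg\<^sup>2) / (ca * c)"
  have cbca: "0 \<le> ca - cb" using cb_bounds by simp
  have "0 \<le> ca + cb" using cb_bounds(3) d(1) unfolding c_def by linarith
  hence "0 \<le> (ca - cb) * (ca + cb)" by (rule mult_nonneg_nonneg[OF cbca])
  hence Q0: "Q \<ge> 0"
    unfolding Q_def using ca d by (intro divide_nonneg_nonneg) auto
  have X: "X = exp y * Q"
  proof -
    have "K * ca / (K * (exp (- y) * c)) = exp y * (ca / c)"
      using K by (simp add: exp_minus divide_inverse)
    moreover have "K * (exp y * (cb - sg)) / (K * ca) = exp y * ((cb - sg) / ca)"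
      using K by simp
    moreover have "ca / c - (cb - sg) / ca = Q"
    proof -
      have "ca / c - (cb - sg) / ca = (ca * ca - (cb - sg) * c) / (ca * c)"
        using ca d by (simp add: diff_frac_eq mult.commute)
      also have "ca * ca - (cb - sg) * c = (ca - cb) * (ca + cb) + sg\<^sup>2"
        unfolding c_def by (simp add: power2_eq_square algebra_simps)
      finally show ?thesis unfolding Q_def .
    qed
    ultimately show ?thesis
      unfolding X_def frac_partition_eq_ca frac_partition_Suc_eq frac_partition_pred_eq[OF assms(1)] K_def[symmetric] c_def[symmetric]
      by (simp only: right_diff_distrib[symmetric])
  qed
  show "X \<le> 44 / 100 * (y\<^sup>2 / u)"
  proof -
    have "(ca - cb) * (ca + cb) \<le> (ca - cb) * (2 * ca)" using cb_bounds by (intro mult_left_mono) auto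
    hence "Q \<le> ((ca - cb) * (2 * ca) + sg\<^sup>2) / (ca * c)"
      unfolding Q_def using ca d by (intro divide_right_mono add_right_mono) auto
    also have "\<dots> = 2 * (ca - cb) / c + sg\<^sup>2 / (ca * c)"
      using ca d by (simp add: add_divide_distrib)
    also have "\<dots> \<le> 2 * (y\<^sup>2 / 2 * (357 / 1000 * D1)) / (919 / 1000 * M) +
        (324 / 10000 * y\<^sup>2 * M\<^sup>2 / u) / ((92 / 100 * M) * (919 / 1000 * M))"
      using ca_minus_cb_le sg_square_le ca d M_pos cbca u_pos D_pos
      by (intro add_mono frac_le mult_mono mult_left_mono) auto
    also have "\<dots> = (357 / 919 + 324 / 10000 / (92 / 100) / (919 / 1000)) * (y\<^sup>2 / u)"
      using M_pos u_pos unfolding D1_def by (simp add: field_simps power2_eq_square)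
    also have "\<dots> \<le> 427 / 1000 * (y\<^sup>2 / u)" using u_pos by (intro mult_right_mono) auto
    finally have 1: "Q \<le> 427 / 1000 * (y\<^sup>2 / u)" .
    have "1 - y \<le> exp (- y)" using exp_ge_add_one_self[of "- y"] by simp
    hence "exp y * (1 - y) \<le> exp y * exp (- y)" by (intro mult_left_mono) auto
    hence "exp y * (1 - y) \<le> 1" by (simp add: exp_minus)
    moreover have "exp y * (1943 / 2000) \<le> exp y * (1 - y)" using y_le by (intro mult_left_mono) auto
    ultimately have "exp y * (1943 / 2000) \<le> 1" by (rule order_trans[rotated])
    hence "exp y \<le> 2000 / 1943" by linarith
    hence "X \<le> 2000 / 1943 * (427 / 1000 * (y\<^sup>2 / u))"
      unfolding X using 1 Q0 by (intro mult_mono) auto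
    also have "\<dots> = 2000 / 1943 * (427 / 1000) * (y\<^sup>2 / u)" by (simp only: mult.assoc)
    also have "\<dots> \<le> 44 / 100 * (y\<^sup>2 / u)"
      using u_pos by (intro mult_right_mono) auto
    finally show ?thesis .
  qed
  show "48 / 1000 * (y\<^sup>2 / u) \<le> X"
  proof -
    have "48 / 1000 * (y\<^sup>2 / u) \<le> (1 / 20 / (103 / 100)) * (y\<^sup>2 / u)"
      using u_pos by (intro mult_right_mono) auto
    also have "\<dots> = (y\<^sup>2 / 2 * (1 / 10 * D1)) / (103 / 100 * M)"
      using M_pos u_pos unfolding D1_def by (simp add: field_simps)
    also have "\<dots> \<le> (ca - cb) / ca"
      using ca_minus_cb_ge ca cbca by (intro frac_le) auto
    also have "\<dots> = ((ca - cb) * c) / (ca * c)" using d by simp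
    also have "\<dots> \<le> Q"
      unfolding Q_def
    proof (intro divide_right_mono)
      have "(ca - cb) * c \<le> (ca - cb) * (ca + cb)"
        using cbca cb_bounds(3) unfolding c_def by (intro mult_left_mono) auto
      thus "(ca - cb) * c \<le> (ca - cb) * (ca + cb) + sg\<^sup>2" using zero_le_power2[of sg] by linarith
    qed (use ca d in auto)
    also have "1 * Q \<le> exp y * Q" using y_pos Q0 by (intro mult_right_mono) auto
    hence "Q \<le> exp y * Q" by simp
    finally show ?thesis unfolding X .
  qed
qed

end

section \<open>Asymptotics of the coefficients and of their ratios\<close>

text \<open>By the lower bound on \<mu>, \<open>(\<alpha> * y)\<^sup>2 \<le> pi\<^sup>2 / (12 *
  \<alpha> ^ 8)\<close> and
  \<open>(\<alpha> / y)\<^sup>2 \<ge> 12 * \<alpha> ^ 12 / pi\<^sup>2\<close>. Both are worst at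
  \<alpha> = 2, whence 57/1000, 70 and 4096.\<close>

lemma saddle_parameters:
  fixes \<alpha> \<mu> y :: real
  assumes \<alpha>: "\<alpha> \<ge> 2" and \<mu>: "\<mu> \<ge> 2 * \<alpha> ^ 11" and y_def: "y = pi * sqrt (\<alpha> / (6 * \<mu>))"
  shows "saddle \<alpha> y (\<alpha> / y)" "\<alpha> * pi\<^sup>2 / (6 * y\<^sup>2) = \<mu>" "\<mu> \<ge> 4096"
proof -
  have "(2::real) ^ 11 \<le> \<alpha> ^ 11" using \<alpha> by (intro power_mono) auto
  thus l: "\<mu> \<ge> 4096" using \<mu> by simp
  have y: "y > 0" using \<alpha> l by (simp add: y_def)
  have y2: "y\<^sup>2 = pi\<^sup>2 * \<alpha> / (6 * \<mu>)" using \<alpha> l by (simp add: y_def power_mult_distrib)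
  show "\<alpha> * pi\<^sup>2 / (6 * y\<^sup>2) = \<mu>" unfolding y2 using \<alpha> l by simp
  have a8: "256 \<le> \<alpha> ^ 8" using power_mono[of 2 \<alpha> 8] \<alpha> by simp
  have "\<alpha> * y \<le> 57 / 1000"
  proof (rule power2_le_imp_le)
    have "(\<alpha> * y)\<^sup>2 = pi\<^sup>2 * \<alpha> ^ 3 / (6 * \<mu>)"
      unfolding power_mult_distrib y2 by (simp add: eval_nat_numeral)
    also have "\<dots> \<le> pi\<^sup>2 * \<alpha> ^ 3 / (6 * (2 * \<alpha> ^ 11))"
      using \<mu> \<alpha> l by (intro divide_left_mono mult_left_mono) auto
    also have "\<dots> = pi\<^sup>2 / (12 * \<alpha> ^ 8)" using \<alpha> by (simp add: eval_nat_numeral)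
    also have "\<dots> \<le> (98697 / 10000) / (12 * 256)"
      using pi_square_bounds a8 by (intro frac_le) auto
    also have "\<dots> \<le> (57 / 1000)\<^sup>2" by (simp add: power2_eq_square)
    finally show "(\<alpha> * y)\<^sup>2 \<le> (57 / 1000)\<^sup>2" .
  qed simp
  moreover have "\<alpha> / y \<ge> 70"
  proof (rule power2_le_imp_le)
    have "(2::real) ^ 12 \<le> \<alpha> ^ 12" using \<alpha> by (intro power_mono) auto
    hence "70\<^sup>2 * (98697 / 10000) \<le> 12 * \<alpha> ^ 12" by simp
    hence "70\<^sup>2 * pi\<^sup>2 \<le> 12 * \<alpha> ^ 12" using pi_square_bounds(2) by (simp add: power2_eq_square)
    also have "\<dots> = 6 * \<alpha> * (2 * \<alpha> ^ 11)" by (simp add: eval_nat_numeral)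
    also have "\<dots> \<le> 6 * \<alpha> * \<mu>" using \<mu> \<alpha> by (intro mult_left_mono) auto
    finally have "70\<^sup>2 \<le> 6 * \<alpha> * \<mu> / pi\<^sup>2" by (simp add: pos_le_divide_eq)
    also have "\<dots> = (\<alpha> / y)\<^sup>2" unfolding power_divide y2 using \<alpha> l by (simp add: power2_eq_square)
    finally show "70\<^sup>2 \<le> (\<alpha> / y)\<^sup>2" .
    show "0 \<le> \<alpha> / y" using \<alpha> y by simp
  qed
  ultimately show "saddle \<alpha> y (\<alpha> / y)" using \<alpha> y by unfold_locales auto
qed

lemma saddle_point_parameters:
  fixes \<alpha> \<mu> y :: real
  assumes "\<alpha> \<ge> 2" "\<mu> \<ge> 2 * \<alpha> ^ 11" "y = pi * sqrt (\<alpha> / (6 * \<mu>))" "\<mu> = real n - \<alpha> / 24"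
  shows "saddle_point \<alpha> y (\<alpha> / y) n"
  using saddle_parameters[OF assms(1-3)] assms(4)
  by (simp add: saddle_point_def saddle_point_axioms_def)

text \<open>For \<alpha> = 1 this is the leading Hardy-Ramanujan term
  \<open>exp (pi * sqrt (2 * \<mu> / 3)) / (4 * sqrt 3 * \<mu>)\<close> with
  \<open>\<mu> = n - 1 / 24\<close>.\<close>

definition main_term :: "real \<Rightarrow> real \<Rightarrow> real" where
  "main_term \<alpha> \<mu> = sqrt (12 / \<alpha>) * (\<alpha> / 24 / \<mu>) powr (\<alpha> / 4 + 3 / 4) * exp (pi * sqrt (2 * \<alpha> / 3) * sqrt \<mu>)"

lemma main_term_pos: "\<alpha> > 0 \<Longrightarrow> \<mu> > 0 \<Longrightarrow> main_term \<alpha> \<mu> > 0"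
  by (simp add: main_term_def)

lemma frac_partition_bounds:
  fixes \<alpha> \<mu> :: real
  assumes \<alpha>: "\<alpha> \<ge> 2" and \<mu>: "\<mu> \<ge> 2 * \<alpha> ^ 11" and n: "\<mu> = real n - \<alpha> / 24"
  shows "91 / 100 * main_term \<alpha> \<mu> \<le> frac_partition \<alpha> n" "frac_partition \<alpha> n \<le> 104 / 100 * main_term \<alpha> \<mu>"
proof -
  define y where "y = pi * sqrt (\<alpha> / (6 * \<mu>))"
  note par = saddle_parameters[OF \<alpha> \<mu> y_def]
  interpret saddle_point \<alpha> y "\<alpha> / y" n
    by (rule saddle_point_parameters[OF \<alpha> \<mu> y_def n])
  have l: "\<mu> > 0" using par(3) by simp
  define b where "b = \<alpha> / 24 / \<mu>"
  have b: "b > 0" using \<alpha> l by (simp add: b_def)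
  have yb: "y = 2 * pi * sqrt b"
  proof -
    have "\<alpha> / (6 * \<mu>) = 4 * b" by (simp add: b_def)
    thus ?thesis unfolding y_def by (simp add: real_sqrt_mult)
  qed
  \<comment> \<open>What \<open>main_term\<close> leaves out of the exponent: the error of the
    logarithm, and the contribution of the part \<open>\<alpha> / 24\<close> of n beyond \<mu>. Each
    is bounded by a small multiple of \<open>\<alpha> * y\<close>.\<close>
  define \<epsilon> where "\<epsilon> = \<alpha> * log_gf_error y + \<alpha> * y / 24"
  have "\<alpha> * (- y / 10) \<le> \<alpha> * log_gf_error y" "\<alpha> * log_gf_error y \<le> \<alpha> * 0"
    using log_gf_error_bounds[OF y_pos] \<alpha> by (intro mult_left_mono; simp)+
  hence e: "- 4 / 1000 \<le> \<epsilon>" "\<epsilon> \<le> 3 / 1000"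
    using alpha_y mult_pos_pos[of \<alpha> y] \<alpha> y_pos unfolding \<epsilon>_def by auto
  have sq: "\<mu> * y = \<alpha> * pi\<^sup>2 / (6 * y)"
    using par(2) y_pos by (simp add: field_simps power2_eq_square)
  have ly: "2 * (\<mu> * y) = pi * sqrt (2 * \<alpha> / 3) * sqrt \<mu>"
  proof -
    have "2 * (\<mu> * y) = pi * (2 * \<mu> * sqrt (\<alpha> / (6 * \<mu>)))" by (simp add: y_def)
    also have "2 * \<mu> * sqrt (\<alpha> / (6 * \<mu>)) = sqrt ((2 * \<mu>)\<^sup>2 * (\<alpha> / (6 * \<mu>)))"
    proof -
      have "\<bar>2 * \<mu>\<bar> = 2 * \<mu>" using l by simp
      thus ?thesis by (simp only: real_sqrt_mult real_sqrt_abs)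
    qed
    also have "(2 * \<mu>)\<^sup>2 * (\<alpha> / (6 * \<mu>)) = 2 * \<alpha> / 3 * \<mu>" using l by (simp add: power2_eq_square)
    finally show ?thesis by (simp only: real_sqrt_mult mult.assoc)
  qed
  have ln_b: "ln (y / (2 * pi)) = ln b / 2" unfolding yb using b by (simp add: ln_sqrt)
  have "\<alpha> * wsum 0 y + real n * y = \<alpha> * pi\<^sup>2 / (6 * y) + \<alpha> * ln (y / (2 * pi)) / 2 + \<alpha> * log_gf_error y + (\<mu> + \<alpha> / 24) * y"
    unfolding log_gf_error_def log_gf_main_def using n by (simp add: algebra_simps)
  also have "\<dots> = pi * sqrt (2 * \<alpha> / 3) * sqrt \<mu> + \<alpha> / 4 * ln b + \<epsilon>"
    unfolding sq[symmetric] ln_b \<epsilon>_def ly[symmetric] by (simp add: algebra_simps)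
  finally have ex: "exp (\<alpha> * wsum 0 y + real n * y) = exp (pi * sqrt (2 * \<alpha> / 3) * sqrt \<mu>) * b powr (\<alpha> / 4) * exp \<epsilon>"
    using b by (simp add: exp_add powr_def)
  have M: "M / (2 * pi) = sqrt (12 / \<alpha>) * b powr (3 / 4)"
  proof -
    have "pi / g = 12 / \<alpha> * sqrt b"
      unfolding g_def using yb y_pos \<alpha> by (simp add: field_simps power2_eq_square)
    hence "m = sqrt (12 / \<alpha>) * sqrt (sqrt b)" unfolding m_def by (simp only: real_sqrt_mult)
    hence "M / (2 * pi) = sqrt (12 / \<alpha>) * (sqrt b * sqrt (sqrt b))" unfolding M_def by (simp add: yb)
    also have "sqrt b * sqrt (sqrt b) = b powr (3 / 4)"
      using b by (simp add: powr_half_sqrt[symmetric] powr_powr powr_add[symmetric])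
    finally show ?thesis .
  qed
  have main: "main_term \<alpha> \<mu> = exp (pi * sqrt (2 * \<alpha> / 3) * sqrt \<mu>) * b powr (\<alpha> / 4) * (M / (2 * pi))"
    unfolding main_term_def M b_def[symmetric] powr_add by simp
  define r where "r = ca / M"
  have r: "92 / 100 \<le> r" "r \<le> 103 / 100" "ca = r * M"
    using ca_ge ca_le M_pos by (auto simp: r_def field_simps)
  have p: "frac_partition \<alpha> n = main_term \<alpha> \<mu> * (exp \<epsilon> * r)"
    unfolding frac_partition_eq_ca ex r(3) main by simp
  have mp: "main_term \<alpha> \<mu> > 0" using main_term_pos \<alpha> l by simp
  have "996 / 1000 \<le> exp \<epsilon>" using exp_ge_add_one_self[of \<epsilon>] e by linarith
  hence lo: "996 / 1000 * (92 / 100) \<le> exp \<epsilon> * r" using r by (intro mult_mono) auto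
  have "exp \<epsilon> * (1 - \<epsilon>) \<le> exp \<epsilon> * exp (- \<epsilon>)"
    using exp_ge_add_one_self[of "- \<epsilon>"] by (intro mult_left_mono) auto
  hence "exp \<epsilon> * (1 - \<epsilon>) \<le> 1" by (simp add: exp_minus)
  moreover have "exp \<epsilon> * (997 / 1000) \<le> exp \<epsilon> * (1 - \<epsilon>)" using e by (intro mult_left_mono) auto
  ultimately have "exp \<epsilon> * (997 / 1000) \<le> 1" by (rule order_trans[rotated])
  hence "exp \<epsilon> \<le> 1000 / 997" by linarith
  hence hi: "exp \<epsilon> * r \<le> 1000 / 997 * (103 / 100)" using r by (intro mult_mono) auto
  have "main_term \<alpha> \<mu> * (91 / 100) \<le> main_term \<alpha> \<mu> * (exp \<epsilon> * r)" using lo mp by (intro mult_left_mono) auto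
  thus "91 / 100 * main_term \<alpha> \<mu> \<le> frac_partition \<alpha> n" unfolding p by simp
  have "main_term \<alpha> \<mu> * (exp \<epsilon> * r) \<le> main_term \<alpha> \<mu> * (104 / 100)" using hi mp by (intro mult_left_mono) auto
  thus "frac_partition \<alpha> n \<le> 104 / 100 * main_term \<alpha> \<mu>" unfolding p by simp
qed

text \<open>Steps proportional to \<open>\<mu> powr (- 3 / 2)\<close> are replaced by differences of
  \<open>1 / sqrt \<mu>\<close>. In this form they telescope exactly, so the sum has the factor
  \<open>sqrt N - sqrt L\<close> however close or distant N and L are.\<close>

lemma inverse_sqrt_diff_bounds:
  fixes \<mu> :: real
  assumes "\<mu> \<ge> 4096"
  shows "1 / (2 * (\<mu> * sqrt \<mu>)) \<le> 1 / sqrt (\<mu> - 1) - 1 / sqrt \<mu>"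
    "1 / sqrt (\<mu> - 1) - 1 / sqrt \<mu> \<le> 102 / 100 * (1 / (2 * (\<mu> * sqrt \<mu>)))"
proof -
  define a b where "a = sqrt \<mu>" and "b = sqrt (\<mu> - 1)"
  have a: "a > 0" "\<mu> = a * a" using assms by (auto simp: a_def)
  have b: "b > 0" "b * b = a * a - 1" using assms by (auto simp: b_def a_def)
  have ba: "b \<le> a" using assms by (simp add: a_def b_def)
  have "99 / 100 * a \<le> b"
    unfolding a_def b_def
  proof (rule real_le_rsqrt)
    show "(99 / 100 * sqrt \<mu>)\<^sup>2 \<le> \<mu> - 1" using assms by (simp add: power_mult_distrib power2_eq_square)
  qed
  have eq: "1 / b - 1 / a = 1 / (a * b * (a + b))"
  proof -
    have "1 / b - 1 / a = (a - b) / (a * b)" using a b by (simp add: diff_frac_eq mult.commute)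
    also have "\<dots> = ((a - b) * (a + b)) / (a * b * (a + b))" using a b by simp
    also have "(a - b) * (a + b) = 1" using b(2) by (simp add: algebra_simps)
    finally show ?thesis .
  qed
  have "1 / (2 * (a * a * a)) \<le> 1 / (a * b * (a + b))"
  proof (rule divide_left_mono)
    have "a * b * (a + b) \<le> a * a * (a + a)" using a ba b by (intro mult_mono) auto
    thus "a * b * (a + b) \<le> 2 * (a * a * a)" by simp
  qed (use a b in auto)
  thus "1 / (2 * (\<mu> * sqrt \<mu>)) \<le> 1 / sqrt (\<mu> - 1) - 1 / sqrt \<mu>"
    unfolding a_def[symmetric] b_def[symmetric] eq by (simp add: a(2))
  have "1 / (a * b * (a + b)) \<le> 1 / (a * (99 / 100 * a) * (a + 99 / 100 * a))"
    using \<open>99 / 100 * a \<le> b\<close> a b by (intro divide_left_mono mult_mono add_mono mult_pos_pos) auto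
  also have "\<dots> = (100 / 99) * (200 / 199) * (1 / (2 * (a * a * a)))" using a by (simp add: field_simps)
  also have "\<dots> \<le> 102 / 100 * (1 / (2 * (a * a * a)))" using a by (intro mult_right_mono) auto
  finally show "1 / sqrt (\<mu> - 1) - 1 / sqrt \<mu> \<le> 102 / 100 * (1 / (2 * (\<mu> * sqrt \<mu>)))"
    unfolding a_def[symmetric] b_def[symmetric] eq by (simp add: a(2))
qed

lemma ratio_step_bounds:
  fixes \<alpha> \<mu> :: real
  assumes \<alpha>: "\<alpha> \<ge> 2" and \<mu>: "\<mu> \<ge> 2 * \<alpha> ^ 11" and n: "\<mu> = real n - \<alpha> / 24" "n \<ge> 1"
  defines "X \<equiv> frac_partition \<alpha> n / frac_partition \<alpha> (n - 1) - frac_partition \<alpha> (Suc n) / frac_partition \<alpha> n"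
    and "d \<equiv> pi * sqrt (\<alpha> / 6) * (1 / sqrt (\<mu> - 1) - 1 / sqrt \<mu>)"
  shows "15 / 100 * d \<le> X" "X \<le> 145 / 100 * d"
proof -
  define y where "y = pi * sqrt (\<alpha> / (6 * \<mu>))"
  note par = saddle_parameters[OF \<alpha> \<mu> y_def]
  interpret saddle_point \<alpha> y "\<alpha> / y" n
    by (rule saddle_point_parameters[OF \<alpha> \<mu> y_def n(1)])
  have l: "\<mu> > 0" using par(3) by simp
  define D where "D = pi * sqrt (\<alpha> / 6) * (1 / (2 * (\<mu> * sqrt \<mu>)))"
  have D: "D > 0" using \<alpha> l by (simp add: D_def)
  have Dd: "D \<le> d" "d \<le> 102 / 100 * D"
    using mult_left_mono[OF inverse_sqrt_diff_bounds(1)[OF par(3)], of "pi * sqrt (\<alpha> / 6)"]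
      mult_left_mono[OF inverse_sqrt_diff_bounds(2)[OF par(3)], of "pi * sqrt (\<alpha> / 6)"] \<alpha>
    by (simp_all add: D_def d_def)
  have Y: "y\<^sup>2 / (\<alpha> / y) = pi\<^sup>2 / 3 * D"
  proof -
    have y2: "y\<^sup>2 = pi\<^sup>2 * \<alpha> / (6 * \<mu>)" using \<alpha> l by (simp add: y_def power_mult_distrib)
    have yy: "y = pi * sqrt (\<alpha> / 6) / sqrt \<mu>" unfolding y_def by (simp add: real_sqrt_divide real_sqrt_mult)
    have "y\<^sup>2 / (\<alpha> / y) = y\<^sup>2 * y / \<alpha>" by simp
    also have "\<dots> = pi\<^sup>2 * \<alpha> / (6 * \<mu>) * (pi * sqrt (\<alpha> / 6) / sqrt \<mu>) / \<alpha>" by (simp only: y2 yy[symmetric])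
    also have "\<dots> = pi\<^sup>2 / 3 * D" unfolding D_def using \<alpha> l by (simp add: field_simps)
    finally show ?thesis .
  qed
  have X: "48 / 1000 * (pi\<^sup>2 / 3 * D) \<le> X" "X \<le> 44 / 100 * (pi\<^sup>2 / 3 * D)"
    using ratio_diff_bounds[OF n(2)] unfolding X_def Y by blast+
  have "98695 / 10000 * D \<le> pi\<^sup>2 * D" "pi\<^sup>2 * D \<le> 98697 / 10000 * D"
    using pi_square_bounds D by (auto intro!: mult_right_mono)
  \<comment> \<open>0.048 * \<pi>^2 / 3 is about 0.158 and exceeds 0.15 * 1.02; 0.44 * \<pi>^2 / 3
    is about 1.448.\<close>
  thus "15 / 100 * d \<le> X" "X \<le> 145 / 100 * d" using X Dd D by linarith+
qed

lemma ratio_bounds: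
  fixes \<alpha> L :: real
  assumes \<alpha>: "\<alpha> \<ge> 2" and L: "L \<ge> 2 * \<alpha> ^ 11" and l: "L = real l - \<alpha> / 24"
  defines "r \<equiv> \<lambda>j. frac_partition \<alpha> (Suc j) / frac_partition \<alpha> j"
    and "d \<equiv> \<lambda>k. pi * sqrt (\<alpha> / 6) * (1 / sqrt L - 1 / sqrt (L + real k))"
  shows "15 / 100 * d k \<le> r l - r (l + k)" "r l - r (l + k) \<le> 145 / 100 * d k"
proof -
  have "15 / 100 * d k \<le> r l - r (l + k) \<and> r l - r (l + k) \<le> 145 / 100 * d k"
  proof (induction k)
    case (Suc k)
    have 1: "L + real (Suc k) \<ge> 2 * \<alpha> ^ 11" using L by simp
    have 2: "L + real (Suc k) = real (l + Suc k) - \<alpha> / 24" using l by simp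
    have 3: "d (Suc k) = d k + pi * sqrt (\<alpha> / 6) * (1 / sqrt (L + real (Suc k) - 1) - 1 / sqrt (L + real (Suc k)))"
      by (simp add: d_def algebra_simps)
    show ?case
      using Suc ratio_step_bounds[OF \<alpha> 1 2] unfolding 3 r_def by simp
  qed (simp add: d_def)
  thus "15 / 100 * d k \<le> r l - r (l + k)" "r l - r (l + k) \<le> 145 / 100 * d k" by auto
qed

text \<open>\<open>1 / sqrt L - 1 / sqrt N\<close> equals
  \<open>(sqrt N - sqrt L) / (sqrt N * sqrt L)\<close>; the two roots raise the exponents from
  \<open>\<alpha> / 4 + 3 / 4\<close> to \<open>\<alpha> / 4 + 5 / 4\<close>.\<close>

lemma main_term_product:
  fixes \<alpha> N L :: real
  assumes \<alpha>: "\<alpha> > 0" and N: "N > 0" and L: "L > 0"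
  shows "main_term \<alpha> N * main_term \<alpha> L * (pi * sqrt (\<alpha> / 6) * (1 / sqrt L - 1 / sqrt N)) =
    pi * (\<alpha> / 24) powr (\<alpha> / 2 + 1) * N powr (- \<alpha> / 4 - 5 / 4) * L powr (- \<alpha> / 4 - 5 / 4)
        * exp (pi * sqrt (2 * \<alpha> / 3) * (sqrt N + sqrt L)) * (sqrt N - sqrt L)"
proof -
  define b where "b = \<alpha> / 24"
  have b: "b > 0" using \<alpha> by (simp add: b_def)
  have pw: "(b / x) powr (\<alpha> / 4 + 3 / 4) * (1 / sqrt x) = b powr (\<alpha> / 4 + 3 / 4) * x powr (- \<alpha> / 4 - 5 / 4)" if "x > 0" for x
  proof -
    have "x powr (- (\<alpha> / 4 + 3 / 4)) = 1 / x powr (\<alpha> / 4 + 3 / 4)" by (rule powr_minus_divide)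
    hence "(b / x) powr (\<alpha> / 4 + 3 / 4) = b powr (\<alpha> / 4 + 3 / 4) * x powr (- (\<alpha> / 4 + 3 / 4))"
      using that b by (simp only: powr_divide less_imp_le times_divide_eq_right mult_1_right)
    moreover have "1 / sqrt x = x powr (- 1 / 2)" using that by (simp add: powr_half_sqrt[symmetric] powr_minus_divide)
    ultimately have "(b / x) powr (\<alpha> / 4 + 3 / 4) * (1 / sqrt x) = b powr (\<alpha> / 4 + 3 / 4) * (x powr (- (\<alpha> / 4 + 3 / 4)) * x powr (- 1 / 2))"
      by (simp only: mult.assoc)
    also have "x powr (- (\<alpha> / 4 + 3 / 4)) * x powr (- 1 / 2) = x powr (- \<alpha> / 4 - 5 / 4)"
    proof -
      have "- (\<alpha> / 4 + 3 / 4) + - 1 / 2 = - \<alpha> / 4 - 5 / 4" by simp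
      thus ?thesis by (simp only: powr_add[symmetric])
    qed
    finally show ?thesis .
  qed
  have diff: "1 / sqrt L - 1 / sqrt N = (1 / sqrt N) * (1 / sqrt L) * (sqrt N - sqrt L)"
    using N L by (simp add: field_simps)
  have c: "sqrt (12 / \<alpha>) * sqrt (12 / \<alpha>) * (pi * sqrt (\<alpha> / 6)) * (b powr (\<alpha> / 4 + 3 / 4) * b powr (\<alpha> / 4 + 3 / 4)) = pi * b powr (\<alpha> / 2 + 1)"
  proof -
    have "\<alpha> / 6 = 4 * b" by (simp add: b_def)
    hence s: "sqrt (\<alpha> / 6) = 2 * b powr (1 / 2)" using b by (simp add: real_sqrt_mult powr_half_sqrt)
    have t: "sqrt (12 / \<alpha>) * sqrt (12 / \<alpha>) = 1 / 2 * b powr (- 1)"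
      using \<alpha> by (simp add: b_def powr_minus_divide)
    have "sqrt (12 / \<alpha>) * sqrt (12 / \<alpha>) * (pi * sqrt (\<alpha> / 6)) * (b powr (\<alpha> / 4 + 3 / 4) * b powr (\<alpha> / 4 + 3 / 4)) =
        pi * (b powr (- 1) * (b powr (1 / 2) * (b powr (\<alpha> / 4 + 3 / 4) * b powr (\<alpha> / 4 + 3 / 4))))"
      unfolding s t by simp
    also have "b powr (- 1) * (b powr (1 / 2) * (b powr (\<alpha> / 4 + 3 / 4) * b powr (\<alpha> / 4 + 3 / 4))) = b powr (\<alpha> / 2 + 1)"
    proof -
      have "- 1 + (1 / 2 + (\<alpha> / 4 + 3 / 4 + (\<alpha> / 4 + 3 / 4))) = \<alpha> / 2 + 1" by simp
      thus ?thesis by (simp only: powr_add[symmetric])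
    qed
    finally show ?thesis .
  qed
  define EN EL where "EN = exp (pi * sqrt (2 * \<alpha> / 3) * sqrt N)" and "EL = exp (pi * sqrt (2 * \<alpha> / 3) * sqrt L)"
  have E: "exp (pi * sqrt (2 * \<alpha> / 3) * (sqrt N + sqrt L)) = EN * EL"
    by (simp add: EN_def EL_def distrib_left exp_add)
  have "main_term \<alpha> N * main_term \<alpha> L * (pi * sqrt (\<alpha> / 6) * (1 / sqrt L - 1 / sqrt N)) =
     sqrt (12 / \<alpha>) * sqrt (12 / \<alpha>) * (pi * sqrt (\<alpha> / 6)) *
      ((b / N) powr (\<alpha> / 4 + 3 / 4) * (1 / sqrt N)) * ((b / L) powr (\<alpha> / 4 + 3 / 4) * (1 / sqrt L)) * (EN * EL) * (sqrt N - sqrt L)"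
    unfolding main_term_def diff b_def[symmetric] EN_def[symmetric] EL_def[symmetric] by (simp only: mult_ac)
  also have "\<dots> = (sqrt (12 / \<alpha>) * sqrt (12 / \<alpha>) * (pi * sqrt (\<alpha> / 6)) * (b powr (\<alpha> / 4 + 3 / 4) * b powr (\<alpha> / 4 + 3 / 4))) *
      N powr (- \<alpha> / 4 - 5 / 4) * L powr (- \<alpha> / 4 - 5 / 4) * (EN * EL) * (sqrt N - sqrt L)"
    unfolding pw[OF N] pw[OF L] by (simp only: mult_ac)
  finally show ?thesis unfolding c E unfolding b_def .
qed

theorem theorem1p2:
  fixes \<alpha> N L :: real and n l :: nat
  assumes "\<alpha> \<ge> 2" and "\<alpha> \<noteq> 24"
    and "n \<ge> 2" and "l \<ge> 2" and "n > l + 1"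
    and "N = real n - 1 - \<alpha> / 24"
    and "L = real l - \<alpha> / 24"
    and "L \<ge> max (2 * \<alpha> ^ 11) (100 / (\<alpha> - 24))"
  shows "\<exists>E::real. \<bar>E\<bar> \<le> 14 / 15 \<and>
    frac_partition \<alpha> (n - 1) * frac_partition \<alpha> (l + 1) - frac_partition \<alpha> n * frac_partition \<alpha> l =
      pi * (\<alpha> / 24) powr (\<alpha> / 2 + 1) * N powr (- \<alpha> / 4 - 5 / 4) * L powr (- \<alpha> / 4 - 5 / 4)
        * exp (pi * sqrt (2 * \<alpha> / 3) * (sqrt N + sqrt L)) * (sqrt N - sqrt L) * (1 + E)"
proof -
  have \<alpha>: "\<alpha> \<ge> 2" "\<alpha> > 0" using assms(1) by auto
  have L: "L \<ge> 2 * \<alpha> ^ 11" using assms(8) by simp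
  have "0 < 2 * \<alpha> ^ 11" using \<alpha> by simp
  hence L0: "L > 0" using L by linarith
  define k where "k = n - 1 - l"
  have k: "n - 1 = l + k" "n = Suc (l + k)" "k \<ge> 1" using assms(5) by (auto simp: k_def)
  have NL: "N = L + real k" using assms(6,7) k(2) by simp
  have N: "N \<ge> 2 * \<alpha> ^ 11" "N > 0" "N > L" using L L0 k(3) by (auto simp: NL)
  define pN pL where "pN = frac_partition \<alpha> (n - 1)" and "pL = frac_partition \<alpha> l"
  define d where "d = pi * sqrt (\<alpha> / 6) * (1 / sqrt L - 1 / sqrt N)"
  define R where "R = frac_partition \<alpha> (Suc l) / frac_partition \<alpha> l - frac_partition \<alpha> (Suc (l + k)) / frac_partition \<alpha> (l + k)"
  define P where "P = main_term \<alpha> N * main_term \<alpha> L * d"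
  have N_eq: "N = real (n - 1) - \<alpha> / 24" using NL assms(7) k(1) by simp
  have mN: "main_term \<alpha> N > 0" and mL: "main_term \<alpha> L > 0" using main_term_pos \<alpha> N L0 by auto
  have pN: "91 / 100 * main_term \<alpha> N \<le> pN" "pN \<le> 104 / 100 * main_term \<alpha> N"
    unfolding pN_def by (rule frac_partition_bounds[OF \<alpha>(1) N(1) N_eq])+
  have pL: "91 / 100 * main_term \<alpha> L \<le> pL" "pL \<le> 104 / 100 * main_term \<alpha> L"
    unfolding pL_def by (rule frac_partition_bounds[OF \<alpha>(1) L assms(7)])+
  have pos: "pN > 0" "pL > 0" using pN(1) pL(1) mN mL by (auto intro: less_le_trans[rotated])
  have R: "15 / 100 * d \<le> R" "R \<le> 145 / 100 * d"
    using ratio_bounds[OF \<alpha>(1) L assms(7), of k] unfolding R_def d_def NL by auto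
  have d0: "d > 0"
    unfolding d_def using \<alpha> L0 N by (intro mult_pos_pos) (auto simp: frac_less2)
  have P0: "P > 0" unfolding P_def using mN mL d0 by simp
  have lhs: "frac_partition \<alpha> (n - 1) * frac_partition \<alpha> (l + 1) - frac_partition \<alpha> n * frac_partition \<alpha> l = pN * pL * R"
    using pos k unfolding R_def pN_def pL_def by (simp add: field_simps)
  have "pN * pL * R \<le> (104 / 100 * main_term \<alpha> N) * (104 / 100 * main_term \<alpha> L) * (145 / 100 * d)"
    using pN pL R pos mN mL d0 by (intro mult_mono) auto
  also have "\<dots> = 104 / 100 * (104 / 100) * (145 / 100) * P" by (simp add: P_def)
  \<comment> \<open>1.04 * 1.04 * 1.45 is about 1.57, against 29/15; for the lower bound 0.91 * 0.91
    * 0.15 is about 0.124, against 1/15.\<close>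
  also have "\<dots> \<le> (1 + 14 / 15) * P" using P0 by (intro mult_right_mono) auto
  finally have up: "pN * pL * R \<le> (1 + 14 / 15) * P" .
  have "(1 - 14 / 15) * P \<le> 91 / 100 * (91 / 100) * (15 / 100) * P" using P0 by (intro mult_right_mono) auto
  also have "\<dots> = (91 / 100 * main_term \<alpha> N) * (91 / 100 * main_term \<alpha> L) * (15 / 100 * d)" by (simp add: P_def)
  also have "(91 / 100 * main_term \<alpha> N) * (91 / 100 * main_term \<alpha> L) * (15 / 100 * d) \<le> pN * pL * R"
    using pN pL R pos mN mL d0 by (intro mult_mono) auto
  finally have lo: "(1 - 14 / 15) * P \<le> pN * pL * R" .
  define E where "E = pN * pL * R / P - 1"
  have "pN * pL * R / P \<le> 1 + 14 / 15" "1 - 14 / 15 \<le> pN * pL * R / P"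
    using up lo P0 by (simp_all only: pos_divide_le_eq pos_le_divide_eq)
  hence "\<bar>E\<bar> \<le> 14 / 15" unfolding E_def by linarith
  moreover have "pN * pL * R = P * (1 + E)" using P0 by (simp add: E_def)
  ultimately show ?thesis
    unfolding lhs main_term_product[OF \<alpha>(2) N(2) L0, symmetric] P_def d_def by blast
qed

end
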